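(* Let $\mathbb{F}=\mathbb{Z}/2$ and consider the ring $$C=\mathbb{F}[y_0,y_1,\dotsc]/(y_i^3+y_iy_{i+1}\mid i\geq 0),$$ with the grading given by $|y_i|=2^i$. Then $C$ is self-injective and coherent. Put $x_0=y_0$ and $x_n=y_n+y_{n-1}^2$ for $n>0$ (equivalently, $y_n=\sum_{i=0}^n x_{n-i}^{2^i}$ for all $n\ge 0$). Then the reduced quotient of $C$ is $$C/\sqrt{0}=\mathbb{F}[x_0,x_1,\dotsc]/(x_ix_j\mid i\neq j)=\mathbb{F}\oplus\bigoplus_{n\ge 0}x_n\mathbb{F}[x_n].$$
   Context: Rings are $\mathbb{Z}$-graded, unital and commutative in the graded sense. Modules are graded, and ``element'' and ``ideal'' mean homogeneous element and homogeneous ideal. A graded ring $R$ is self-injective if $R$ is an injective object in the category of graded $R$-modules. A finitely generated free module is one of the form $\bigoplus_{i=1}^r\Sigma^{d_i}R$ (arbitrary degree shifts $d_i$ allowed). A module $M$ is finitely presented if there is an exact sequence $P_1\to P_0\to M\to 0$ with $P_0,P_1$ finitely generated free. $R$ is coherent if every finitely generated ideal is finitely presented. $\sqrt{0}$ is the ideal of nilpotent elements. The first description of $C/\sqrt 0$ means that it is generated as an $\mathbb{F}$-algebra by the images of the $x_n$, with defining relations $x_ix_j=0$ for $i\ne j$. *)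

theory Defs
  imports
    "HOL-Library.Poly_Mapping"
    "HOL-Library.Z2"
    "HOL-Library.Function_Algebras"
    "HOL-Computational_Algebra.Polynomial"
begin

section \<open>Graded rings and modules\<close>

text \<open>
  A grading is a family of subgroups of an ambient abelian group, indexed by the integers, whose
  sum is direct. The sum itself, \<open>total M\<close>, is the underlying group of the graded object; it need
  not be the whole ambient type, so that ideals and finitely generated free modules of any rank
  are covered.
\<close>

definition total :: "(int \<Rightarrow> 'm::ab_group_add set) \<Rightarrow> 'm set" where
  "total M = {\<Sum>d\<in>D. m d | D m. finite D \<and> (\<forall>d\<in>D. m d \<in> M d)}"

locale graded_group =
  fixes M :: "int \<Rightarrow> 'm::ab_group_add set"
  assumes gr_zero: "0 \<in> M d"
    and gr_diff: "a \<in> M d \<Longrightarrow> b \<in> M d \<Longrightarrow> a - b \<in> M d"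
    and gr_independent:
      "finite D \<Longrightarrow> (\<And>d. d \<in> D \<Longrightarrow> m d \<in> M d) \<Longrightarrow> (\<Sum>d\<in>D. m d) = 0 \<Longrightarrow> d \<in> D \<Longrightarrow> m d = 0"

text \<open>
  The sign rule is that of graded commutativity. The underlying rings are moreover assumed
  to be commutative in the ungraded sense, which over a ring of characteristic 2 is the same thing.
\<close>

locale graded_ring = graded_group A for A :: "int \<Rightarrow> 'r::comm_ring_1 set" +
  assumes gr_total: "total A = UNIV"
    and gr_one: "1 \<in> A 0"
    and gr_mult: "a \<in> A i \<Longrightarrow> b \<in> A j \<Longrightarrow> a * b \<in> A (i + j)"
    and gr_comm: "a \<in> A i \<Longrightarrow> b \<in> A j \<Longrightarrow> a * b = (if odd i \<and> odd j then - (b * a) else b * a)"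

locale graded_module =
  graded_ring A + module scale + graded_group M
  for A :: "int \<Rightarrow> 'r::comm_ring_1 set"
    and scale :: "'r \<Rightarrow> 'm::ab_group_add \<Rightarrow> 'm"
    and M :: "int \<Rightarrow> 'm set" +
  assumes gr_scale: "a \<in> A i \<Longrightarrow> m \<in> M j \<Longrightarrow> scale a m \<in> M (i + j)"

text \<open>
  Morphisms are linear of degree 0. They are only specified on the underlying group of the domain;
  their values elsewhere in the ambient type are irrelevant.
\<close>

definition graded_hom ::
  "('r::comm_ring_1 \<Rightarrow> 'm::ab_group_add \<Rightarrow> 'm) \<Rightarrow> (int \<Rightarrow> 'm set) \<Rightarrow>
   ('r \<Rightarrow> 'n::ab_group_add \<Rightarrow> 'n) \<Rightarrow> (int \<Rightarrow> 'n set) \<Rightarrow> ('m \<Rightarrow> 'n) \<Rightarrow> bool" where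
  "graded_hom sM M sN N f \<longleftrightarrow>
     (\<forall>u\<in>total M. \<forall>v\<in>total M. f (u + v) = f u + f v) \<and>
     (\<forall>a. \<forall>u\<in>total M. f (sM a u) = sN a (f u)) \<and>
     (\<forall>d. f ` M d \<subseteq> N d)"

text \<open>
  Injectivity of \<open>Q\<close> with respect to all monomorphisms from a graded module with elements in type
  \<open>'m\<close> to one with elements in type \<open>'n\<close>. A definition cannot quantify over types; injectivity in
  the category of all graded modules is this property for arbitrary type variables.
\<close>

definition graded_injective ::
  "(int \<Rightarrow> 'r::comm_ring_1 set) \<Rightarrow> ('r \<Rightarrow> 'q::ab_group_add \<Rightarrow> 'q) \<Rightarrow> (int \<Rightarrow> 'q set) \<Rightarrow>
   'm::ab_group_add itself \<Rightarrow> 'n::ab_group_add itself \<Rightarrow> bool" where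
  "graded_injective A sQ Q (_ :: 'm itself) (_ :: 'n itself) \<longleftrightarrow>
     graded_module A sQ Q \<and>
     (\<forall>(sM :: 'r \<Rightarrow> 'm \<Rightarrow> 'm) M (sN :: 'r \<Rightarrow> 'n \<Rightarrow> 'n) N i f.
        graded_module A sM M \<and> graded_module A sN N \<and>
        graded_hom sM M sN N i \<and> inj_on i (total M) \<and> graded_hom sM M sQ Q f \<longrightarrow>
        (\<exists>g. graded_hom sN N sQ Q g \<and> (\<forall>u\<in>total M. g (i u) = f u)))"

definition graded_self_injective ::
  "(int \<Rightarrow> 'r::comm_ring_1 set) \<Rightarrow> 'm::ab_group_add itself \<Rightarrow> 'n::ab_group_add itself \<Rightarrow> bool" where
  "graded_self_injective A m n \<longleftrightarrow> graded_injective A (*) A m n"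

text \<open>
  The finitely generated free module \<open>\<Oplus>\<^sub>i \<Sigma>\<^bsup>d\<^sub>i\<^esup> R\<close>, for a list of shifts \<open>d\<^sub>i\<close>: vectors are functions
  vanishing from position \<open>length ds\<close> on, and \<open>(\<Sigma>\<^bsup>d\<^esup> R)\<^sub>k = R\<^bsub>k - d\<^esub>\<close>.
\<close>

definition free_gr :: "(int \<Rightarrow> 'r::comm_ring_1 set) \<Rightarrow> int list \<Rightarrow> int \<Rightarrow> (nat \<Rightarrow> 'r) set" where
  "free_gr A ds k =
     {v. (\<forall>i<length ds. v i \<in> A (k - ds ! i)) \<and> (\<forall>i\<ge>length ds. v i = 0)}"

definition free_scale :: "'r::comm_ring_1 \<Rightarrow> (nat \<Rightarrow> 'r) \<Rightarrow> nat \<Rightarrow> 'r" where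
  "free_scale a v = (\<lambda>i. a * v i)"

definition finitely_presented ::
  "(int \<Rightarrow> 'r::comm_ring_1 set) \<Rightarrow> ('r \<Rightarrow> 'm::ab_group_add \<Rightarrow> 'm) \<Rightarrow> (int \<Rightarrow> 'm set) \<Rightarrow> bool" where
  "finitely_presented A sM M \<longleftrightarrow>
     graded_module A sM M \<and>
     (\<exists>ds es f g.
        graded_hom free_scale (free_gr A es) free_scale (free_gr A ds) f \<and>
        graded_hom free_scale (free_gr A ds) sM M g \<and>
        f ` total (free_gr A es) = {v \<in> total (free_gr A ds). g v = 0} \<and>
        g ` total (free_gr A ds) = total M)"

definition ideal_gen :: "'r::comm_ring_1 set \<Rightarrow> 'r set" where
  "ideal_gen S = module.span (*) S"

definition graded_coherent :: "(int \<Rightarrow> 'r::comm_ring_1 set) \<Rightarrow> bool" where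
  "graded_coherent A \<longleftrightarrow>
     graded_ring A \<and>
     (\<forall>S. finite S \<and> S \<subseteq> (\<Union>d. A d) \<longrightarrow>
          finitely_presented A (*) (\<lambda>d. ideal_gen S \<inter> A d))"

definition nilradical :: "'r::comm_ring_1 set" where
  "nilradical = {a. \<exists>n. a ^ n = 0}"

lemma module_times: "module ((*) :: 'r::comm_ring_1 \<Rightarrow> 'r \<Rightarrow> 'r)"
  by unfold_locales (simp_all add: algebra_simps)

lemma ideal_gen_0: "0 \<in> ideal_gen S"
  unfolding ideal_gen_def by (rule module.span_zero[OF module_times])

lemma ideal_gen_add: "a \<in> ideal_gen S \<Longrightarrow> b \<in> ideal_gen S \<Longrightarrow> a + b \<in> ideal_gen S"
  unfolding ideal_gen_def by (rule module.span_add[OF module_times])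

lemma ideal_gen_diff: "a \<in> ideal_gen S \<Longrightarrow> b \<in> ideal_gen S \<Longrightarrow> a - b \<in> ideal_gen S"
  unfolding ideal_gen_def by (rule module.span_diff[OF module_times])

lemma ideal_gen_neg: "a \<in> ideal_gen S \<Longrightarrow> - a \<in> ideal_gen S"
  unfolding ideal_gen_def by (rule module.span_neg[OF module_times])

lemma ideal_gen_mult: "a \<in> ideal_gen S \<Longrightarrow> r * a \<in> ideal_gen S"
  unfolding ideal_gen_def by (rule module.span_scale[OF module_times])

lemma nilradical_mult:
  assumes "a \<in> nilradical" shows "r * a \<in> (nilradical :: 'r::comm_ring_1 set)"
proof -
  obtain n where "a ^ n = 0" using assms by (auto simp: nilradical_def)
  then have "(r * a) ^ n = 0" by (simp add: power_mult_distrib)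
  then show ?thesis by (auto simp: nilradical_def)
qed

lemma nilradical_add:
  assumes "a \<in> nilradical" "b \<in> nilradical"
  shows "a + b \<in> (nilradical :: 'r::comm_ring_1 set)"
proof -
  obtain m n where m: "a ^ m = 0" and n: "b ^ n = 0"
    using assms by (auto simp: nilradical_def)
  have "of_nat (m + n choose k) * a ^ k * b ^ (m + n - k) = 0" for k
  proof (cases "m \<le> k")
    case True
    then have "a ^ k = a ^ m * a ^ (k - m)" by (simp flip: power_add)
    with m show ?thesis by simp
  next
    case False
    then have "b ^ (m + n - k) = b ^ n * b ^ (m - k)" by (simp add: add.commute flip: power_add)
    with n show ?thesis by simp
  qed
  then have "(a + b) ^ (m + n) = 0"
    by (subst binomial_ring) (simp only: sum.neutral_const)
  then show ?thesis by (auto simp: nilradical_def)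
qed

lemma nilradical_0: "0 \<in> (nilradical :: 'r::comm_ring_1 set)"
  unfolding nilradical_def by (auto intro: exI[of _ 1])

lemma nilradical_neg:
  "a \<in> nilradical \<Longrightarrow> - a \<in> (nilradical :: 'r::comm_ring_1 set)"
  using nilradical_mult[of a "-1"] by simp

section \<open>Polynomials over the field with two elements\<close>

type_synonym f2_poly = "(nat \<Rightarrow>\<^sub>0 nat) \<Rightarrow>\<^sub>0 bit"

definition var :: "nat \<Rightarrow> f2_poly" where
  "var i = Poly_Mapping.single (Poly_Mapping.single i 1) 1"

definition monom_weight :: "(nat \<Rightarrow>\<^sub>0 nat) \<Rightarrow> nat" where
  "monom_weight m = (\<Sum>i\<in>Poly_Mapping.keys m. Poly_Mapping.lookup m i * 2 ^ i)"

text \<open>The grading in which the \<open>i\<close>-th variable has degree \<open>2\<^sup>i\<close>.\<close>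

definition f2_poly_gr :: "int \<Rightarrow> f2_poly set" where
  "f2_poly_gr d = {p. \<forall>m\<in>Poly_Mapping.keys p. int (monom_weight m) = d}"

text \<open>
  Evaluation at a sequence of elements. This is the homomorphism of algebras over the two-element
  field determined by the sequence, provided that the target has characteristic 2.
\<close>

definition f2_eval :: "(nat \<Rightarrow> 'a::comm_ring_1) \<Rightarrow> f2_poly \<Rightarrow> 'a" where
  "f2_eval a p =
     (\<Sum>m\<in>Poly_Mapping.keys p. of_bit (Poly_Mapping.lookup p m) *
        (\<Prod>i\<in>Poly_Mapping.keys m. a i ^ Poly_Mapping.lookup m i))"

section \<open>The ring C and its reduced quotient\<close>

definition ideal_C :: "f2_poly set" where
  "ideal_C = ideal_gen (range (\<lambda>i. var i ^ 3 + var i * var (i + 1)))"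

lemma const_coeff_mult:
  "Poly_Mapping.lookup (p * q) 0 = Poly_Mapping.lookup p 0 * Poly_Mapping.lookup (q::f2_poly) 0"
proof -
  have sum0: "0 = l + k \<longleftrightarrow> l = 0 \<and> k = 0" for l k :: "nat \<Rightarrow>\<^sub>0 nat"
    by (auto simp: poly_mapping_eq_iff fun_eq_iff lookup_add)
  have "Poly_Mapping.lookup p l * (\<Sum>k. Poly_Mapping.lookup q k when 0 = l + k) =
        (Poly_Mapping.lookup p 0 * Poly_Mapping.lookup q 0 when l = 0)" for l
    by (cases "l = 0") (simp_all add: sum0)
  then show ?thesis by (simp add: lookup_mult)
qed

lemma one_notin_ideal_C: "1 \<notin> ideal_C"
proof
  assume "1 \<in> ideal_C"
  then have "1 \<in> module.span (*) (range (\<lambda>i. var i ^ 3 + var i * var (i + 1)))"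
    by (simp add: ideal_C_def ideal_gen_def)
  then have "Poly_Mapping.lookup (1::f2_poly) 0 = 0"
  proof (rule module.span_induct_alt[OF module_times])
    have "Poly_Mapping.lookup (var i) 0 = 0" for i
      by (auto simp: var_def lookup_single when_def dest: arg_cong[where f = Poly_Mapping.keys])
    then show "Poly_Mapping.lookup (c * x + y) 0 = 0"
      if "x \<in> range (\<lambda>i. var i ^ 3 + var i * var (i + 1))"
        and "Poly_Mapping.lookup y 0 = 0" for c x y
      using that by (auto simp: lookup_add const_coeff_mult power3_eq_cube)
  qed simp
  then show False by simp
qed

quotient_type ringC = "f2_poly" / "\<lambda>p q. p - q \<in> ideal_C"
proof (rule equivpI)
  show "reflp (\<lambda>p q. p - q \<in> ideal_C)"
    by (auto intro!: reflpI simp: ideal_C_def ideal_gen_0)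
  show "symp (\<lambda>p q. p - q \<in> ideal_C)"
  proof (rule sympI)
    fix p q assume "p - q \<in> ideal_C"
    then have "- (p - q) \<in> ideal_C"
      unfolding ideal_C_def by (rule ideal_gen_neg)
    then show "q - p \<in> ideal_C" by simp
  qed
  show "transp (\<lambda>p q. p - q \<in> ideal_C)"
  proof (rule transpI)
    fix p q r assume "p - q \<in> ideal_C" "q - r \<in> ideal_C"
    then have "(p - q) + (q - r) \<in> ideal_C"
      unfolding ideal_C_def by (rule ideal_gen_add)
    then show "p - r \<in> ideal_C" by simp
  qed
qed

instantiation ringC :: comm_ring_1
begin

lift_definition zero_ringC :: ringC is 0 .
lift_definition one_ringC :: ringC is 1 .
lift_definition plus_ringC :: "ringC \<Rightarrow> ringC \<Rightarrow> ringC" is "(+)"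
proof -
  fix p p' q q' :: f2_poly
  assume "p - p' \<in> ideal_C" "q - q' \<in> ideal_C"
  then have "(p - p') + (q - q') \<in> ideal_C"
    unfolding ideal_C_def by (rule ideal_gen_add)
  then show "(p + q) - (p' + q') \<in> ideal_C"
    by (simp add: algebra_simps)
qed
lift_definition minus_ringC :: "ringC \<Rightarrow> ringC \<Rightarrow> ringC" is "(-)"
proof -
  fix p p' q q' :: f2_poly
  assume "p - p' \<in> ideal_C" "q - q' \<in> ideal_C"
  then have "(p - p') - (q - q') \<in> ideal_C"
    unfolding ideal_C_def by (rule ideal_gen_diff)
  then show "(p - q) - (p' - q') \<in> ideal_C"
    by (simp add: algebra_simps)
qed
lift_definition uminus_ringC :: "ringC \<Rightarrow> ringC" is uminus
proof -
  fix p p' :: f2_poly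
  assume "p - p' \<in> ideal_C"
  then have "- (p - p') \<in> ideal_C"
    unfolding ideal_C_def by (rule ideal_gen_neg)
  then show "(- p) - (- p') \<in> ideal_C"
    by (simp add: algebra_simps)
qed
lift_definition times_ringC :: "ringC \<Rightarrow> ringC \<Rightarrow> ringC" is "(*)"
proof -
  fix p p' q q' :: f2_poly
  assume "p - p' \<in> ideal_C" "q - q' \<in> ideal_C"
  then have "q * (p - p') + p' * (q - q') \<in> ideal_C"
    unfolding ideal_C_def by (intro ideal_gen_add ideal_gen_mult)
  then show "p * q - p' * q' \<in> ideal_C"
    by (simp add: algebra_simps)
qed

instance
proof
  show "(0::ringC) \<noteq> 1"
    by transfer (use one_notin_ideal_C ideal_gen_neg[of "- 1"] in \<open>auto simp: ideal_C_def\<close>)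
qed (transfer; simp add: algebra_simps ideal_C_def ideal_gen_0)+

end

definition C_gr :: "int \<Rightarrow> ringC set" where
  "C_gr d = abs_ringC ` f2_poly_gr d"

definition y_C :: "nat \<Rightarrow> ringC" where
  "y_C i = abs_ringC (var i)"

fun x_C :: "nat \<Rightarrow> ringC" where
  "x_C 0 = y_C 0"
| "x_C (Suc n) = y_C (Suc n) + y_C n ^ 2"

quotient_type redC = "ringC" / "\<lambda>a b. a - b \<in> nilradical"
proof (rule equivpI)
  show "reflp (\<lambda>a b :: ringC. a - b \<in> nilradical)"
    by (auto intro!: reflpI simp: nilradical_0)
  show "symp (\<lambda>a b :: ringC. a - b \<in> nilradical)"
  proof (rule sympI)
    fix a b :: ringC assume "a - b \<in> nilradical"
    then have "- (a - b) \<in> nilradical"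
      by (rule nilradical_neg)
    then show "b - a \<in> nilradical" by simp
  qed
  show "transp (\<lambda>a b :: ringC. a - b \<in> nilradical)"
  proof (rule transpI)
    fix a b c :: ringC assume "a - b \<in> nilradical" "b - c \<in> nilradical"
    then have "(a - b) + (b - c) \<in> nilradical"
      by (rule nilradical_add)
    then show "a - c \<in> nilradical" by simp
  qed
qed

instantiation redC :: comm_ring_1
begin

lift_definition zero_redC :: redC is 0 .
lift_definition one_redC :: redC is 1 .
lift_definition plus_redC :: "redC \<Rightarrow> redC \<Rightarrow> redC" is "(+)"
proof -
  fix a a' b b' :: ringC
  assume "a - a' \<in> nilradical" "b - b' \<in> nilradical"
  then have "(a - a') + (b - b') \<in> nilradical"
    by (rule nilradical_add)
  then show "(a + b) - (a' + b') \<in> nilradical"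
    by (simp add: algebra_simps)
qed
lift_definition uminus_redC :: "redC \<Rightarrow> redC" is uminus
proof -
  fix a a' :: ringC
  assume "a - a' \<in> nilradical"
  then have "- (a - a') \<in> nilradical"
    by (rule nilradical_neg)
  then show "(- a) - (- a') \<in> nilradical"
    by (simp add: algebra_simps)
qed
lift_definition minus_redC :: "redC \<Rightarrow> redC \<Rightarrow> redC" is "(-)"
proof -
  fix a a' b b' :: ringC
  assume "a - a' \<in> nilradical" "b - b' \<in> nilradical"
  then have "(a - a') + - (b - b') \<in> nilradical"
    by (intro nilradical_add nilradical_neg)
  then show "(a - b) - (a' - b') \<in> nilradical"
    by (simp add: algebra_simps)
qed
lift_definition times_redC :: "redC \<Rightarrow> redC \<Rightarrow> redC" is "(*)"
proof -
  fix a a' b b' :: ringC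
  assume "a - a' \<in> nilradical" "b - b' \<in> nilradical"
  then have "b * (a - a') + a' * (b - b') \<in> nilradical"
    by (intro nilradical_add nilradical_mult)
  then show "a * b - a' * b' \<in> nilradical"
    by (simp add: algebra_simps)
qed

instance
proof
  show "(0::redC) \<noteq> 1"
    by transfer (use nilradical_neg[of "- 1 :: ringC"] in \<open>auto simp: nilradical_def\<close>)
qed (transfer; simp add: algebra_simps nilradical_0)+

end

definition redC_gr :: "int \<Rightarrow> redC set" where
  "redC_gr d = abs_redC ` C_gr d"

definition x_red :: "nat \<Rightarrow> redC" where
  "x_red n = abs_redC (x_C n)"

text \<open>
  The canonical map from the external direct sum of the two-element field and the \<open>x\<^sub>n F[x\<^sub>n]\<close> (with
  \<open>F[x\<^sub>n]\<close> a polynomial ring) to the reduced quotient. A pair \<open>(c, q)\<close> stands for the family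
  with components \<open>c\<close> and \<open>x\<^sub>n q\<^sub>n(x\<^sub>n)\<close>; finite support makes it a direct sum.
\<close>

definition red_sum :: "bit \<times> (nat \<Rightarrow>\<^sub>0 bit poly) \<Rightarrow> redC" where
  "red_sum = (\<lambda>(c, q). of_bit c +
     (\<Sum>n\<in>Poly_Mapping.keys q.
        x_red n * poly (map_poly of_bit (Poly_Mapping.lookup q n)) (x_red n)))"

end

theory Submission
  imports Defs
begin

text \<open>
  In characteristic 2 the relations \<open>y\<^sub>i\<^sup>3 = y\<^sub>i y\<^sub>i\<^sub>+\<^sub>1\<close> identify monomials with monomials, so C is
  the algebra of a commutative monoid. Rewriting \<open>y\<^sub>i\<^sup>3\<close> to \<open>y\<^sub>i y\<^sub>i\<^sub>+\<^sub>1\<close> is binary addition with digits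
  1 and 2 and with carries to the right; it has unique normal forms, and the monomials with all
  exponents at most 2 are a basis of C.
  It follows that the subring \<open>tail n\<close> generated by \<open>y\<^sub>n, y\<^sub>n\<^sub>+\<^sub>1, \<dots>\<close> is free over \<open>tail (Suc n)\<close> with
  basis \<open>1, y\<^sub>n, y\<^sub>n\<^sup>2\<close>, compatibly with the ideals \<open>high m = (y\<^sub>m\<^sub>+\<^sub>1, y\<^sub>m\<^sub>+\<^sub>2, \<dots>)\<close>
  (\<open>tail_decompose\<close>, \<open>high_components\<close>). The arguments about C are recursions along this tower.

  The truncations \<open>C / high m\<close> are finite-dimensional Frobenius algebras: every functional is
  represented by multiplication followed by the coefficient of \<open>y\<^sub>0\<^sup>2 \<dots> y\<^sub>m\<^sup>2\<close>
  (\<open>socle_form_represents\<close>). They agree with C in low degrees, but a relation that holds modulo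
  \<open>high m\<close> in high degree need not hold in C. The key finiteness statement controls this: the
  relations among given homogeneous elements are generated, modulo \<open>high m\<close> for all large \<open>m\<close> at
  once, by one finite set of exact relations (\<open>homogeneous_syzygies\<close>). To see it, expand over
  \<open>tail N\<close>, with \<open>N\<close> so large that only coefficients from the polynomial ring \<open>F[y\<^sub>N]\<close> occur. A
  homogeneous matrix over that ring
  can be diagonalized, which leaves the annihilators of powers of \<open>y\<^sub>N\<close>, and those are computed
  by another recursion along the tower (\<open>ann_y_power\<close>).

  Coherence follows because in each degree C agrees with a deep truncation
  (\<open>syzygies_finitely_generated\<close>). For self-injectivity, a homomorphism from a finitely
  generated ideal composed with the socle coefficient is a functional on an ideal of a truncation, so it is
  represented by an element, which then represents the homomorphism itself
  (\<open>homogeneous_system_solvable\<close>). Since C is finite in each degree, finitely many equations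
  suffice to pin down a value on an arbitrary ideal, and Baer's argument with Zorn's lemma does
  the rest.

  For the reduced quotient, \<open>y\<^sub>n x\<^sub>n\<^sub>+\<^sub>1 = 0\<close> implies that \<open>x\<^sub>i x\<^sub>j\<close> is nilpotent for \<open>i \<noteq> j\<close>. Conversely, C
  maps to the polynomial ring in one variable \<open>t\<close> by \<open>x\<^sub>n \<mapsto> t\<close> and \<open>x\<^sub>j \<mapsto> 0\<close> for \<open>j \<noteq> n\<close>, and
  these restrictions to the coordinate axes recover all coefficients of pure powers.
\<close>

abbreviation keys :: "('a \<Rightarrow>\<^sub>0 'b::zero) \<Rightarrow> 'a set" where
  "keys \<equiv> Poly_Mapping.keys"

abbreviation lookup :: "('a \<Rightarrow>\<^sub>0 'b::zero) \<Rightarrow> 'a \<Rightarrow> 'b" where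
  "lookup \<equiv> Poly_Mapping.lookup"

section \<open>Evaluation of polynomials over the two-element field\<close>

lemma bit_add_self [simp]: "(b::bit) + b = 0"
  by (cases b) simp_all

lemma f2_add_self: "(p::f2_poly) + p = 0"
  by (rule poly_mapping_eqI) (simp only: lookup_add bit_add_self lookup_zero)

lemma f2_poly_eq_sum_monomials:
  fixes p :: f2_poly
  shows "p = (\<Sum>m\<in>keys p. Poly_Mapping.single m 1)"
proof (rule poly_mapping_eqI)
  fix m
  have "lookup (\<Sum>m\<in>keys p. Poly_Mapping.single m (1::bit)) m
      = (\<Sum>k\<in>keys p. if k = m then 1 else 0)"
    by (simp add: lookup_sum lookup_single when_def)
  also have "\<dots> = lookup p m"
    by (simp add: in_keys_iff)
  finally show "lookup p m =
      lookup (\<Sum>m\<in>keys p. Poly_Mapping.single m 1) m" ..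
qed

text \<open>Over the two-element field a polynomial is a sum of distinct monomials, so properties can be
  proved by adding one monomial at a time.\<close>

lemma f2_poly_induct [case_names zero add]:
  fixes p :: f2_poly
  assumes "P 0"
    and "\<And>m q. m \<in> keys p \<Longrightarrow> P q \<Longrightarrow> P (Poly_Mapping.single m 1 + q)"
  shows "P p"
proof -
  have "P (\<Sum>m\<in>F. Poly_Mapping.single m 1)" if "finite F" "F \<subseteq> keys p" for F
    using that by (induction F) (auto intro: assms)
  from this[of "keys p"] show ?thesis
    using f2_poly_eq_sum_monomials[of p] by simp
qed

definition monomial_value :: "(nat \<Rightarrow> 'a::comm_ring_1) \<Rightarrow> (nat \<Rightarrow>\<^sub>0 nat) \<Rightarrow> 'a" where
  "monomial_value a m = (\<Prod>i\<in>keys m. a i ^ lookup m i)"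

lemma monomial_value_superset:
  assumes "finite S" "keys m \<subseteq> S"
  shows "monomial_value a m = (\<Prod>i\<in>S. a i ^ lookup m i)"
  unfolding monomial_value_def
  by (rule prod.mono_neutral_left) (use assms in \<open>auto simp: in_keys_iff\<close>)

lemma monomial_value_0 [simp]: "monomial_value a 0 = 1"
  by (simp add: monomial_value_def)

lemma monomial_value_single [simp]: "monomial_value a (Poly_Mapping.single i k) = a i ^ k"
  by (cases "k = 0") (simp_all add: monomial_value_def)

lemma monomial_value_add: "monomial_value a (m + m') = monomial_value a m * monomial_value a m'"
proof -
  let ?S = "keys m \<union> keys m'"
  show ?thesis
    using monomial_value_superset[of ?S m a] monomial_value_superset[of ?S m' a]
      monomial_value_superset[of ?S "m + m'" a] keys_add[of m m']
    by (simp add: lookup_add power_add prod.distrib)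
qed

lemma f2_eval_superset:
  assumes "finite S" "keys p \<subseteq> S"
  shows "f2_eval a p = (\<Sum>m\<in>S. of_bit (lookup p m) * monomial_value a m)"
  unfolding f2_eval_def monomial_value_def
  by (rule sum.mono_neutral_left) (use assms in \<open>auto simp: in_keys_iff\<close>)

lemma of_bit_add:
  assumes "(1::'a::comm_ring_1) + 1 = 0"
  shows "(of_bit (b + c) :: 'a) = of_bit b + of_bit c"
  using assms by (cases b; cases c) auto

lemma f2_eval_0 [simp]: "f2_eval a 0 = 0"
  by (simp add: f2_eval_def)

lemma f2_eval_monomial [simp]: "f2_eval a (Poly_Mapping.single m 1) = monomial_value a m"
  by (simp add: f2_eval_def monomial_value_def)

lemma f2_eval_1 [simp]: "f2_eval a 1 = 1"
  using f2_eval_monomial[of a 0] by simp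

lemma f2_eval_var [simp]: "f2_eval a (var i) = a i"
  by (simp add: var_def)

context
  fixes a :: "nat \<Rightarrow> 'a::comm_ring_1"
  assumes char2: "(1::'a) + 1 = 0"
begin

lemma f2_eval_add: "f2_eval a (p + q) = f2_eval a p + f2_eval a q"
proof -
  let ?S = "keys p \<union> keys q"
  have "f2_eval a (p + q) =
      (\<Sum>m\<in>?S. of_bit (lookup (p + q) m) * monomial_value a m)"
    by (rule f2_eval_superset) (simp_all add: keys_add)
  also have "\<dots> = (\<Sum>m\<in>?S. of_bit (lookup p m) * monomial_value a m) +
      (\<Sum>m\<in>?S. of_bit (lookup q m) * monomial_value a m)"
    by (simp only: lookup_add of_bit_add[OF char2] sum.distrib distrib_right)
  also have "\<dots> = f2_eval a p + f2_eval a q"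
    by (simp add: f2_eval_superset[of ?S])
  finally show ?thesis .
qed

lemma f2_eval_mult: "f2_eval a (p * q) = f2_eval a p * f2_eval a q"
proof -
  have single: "f2_eval a (Poly_Mapping.single m 1 * q) = monomial_value a m * f2_eval a q"
    for m q
    by (induction q rule: f2_poly_induct)
      (simp_all add: distrib_left f2_eval_add mult_single monomial_value_add)
  show ?thesis
    by (induction p rule: f2_poly_induct) (simp_all add: distrib_right f2_eval_add single)
qed

lemma f2_eval_power: "f2_eval a (p ^ k) = f2_eval a p ^ k"
  by (induction k) (simp_all add: f2_eval_mult)

end

section \<open>Monomials in C and their normal forms\<close>

abbreviation delta :: "nat \<Rightarrow> nat \<Rightarrow> (nat \<Rightarrow>\<^sub>0 nat)" where
  "delta i k \<equiv> Poly_Mapping.single i k"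

definition ym :: "(nat \<Rightarrow>\<^sub>0 nat) \<Rightarrow> ringC" where
  "ym e = abs_ringC (Poly_Mapping.single e 1)"

lemma abs_ringC_add: "abs_ringC (p + q) = abs_ringC p + abs_ringC q"
  by (simp add: plus_ringC.abs_eq)

lemma abs_ringC_mult: "abs_ringC (p * q) = abs_ringC p * abs_ringC q"
  by (simp add: times_ringC.abs_eq)

lemma abs_ringC_0: "abs_ringC 0 = 0" and abs_ringC_1: "abs_ringC 1 = 1"
  by (simp_all add: zero_ringC_def one_ringC_def)

lemma ringC_eq_iff: "abs_ringC p = abs_ringC q \<longleftrightarrow> p - q \<in> ideal_C"
  by (rule ringC.abs_eq_iff)

lemma ringC_add_self [simp]: "(u::ringC) + u = 0"
proof -
  obtain p where "u = abs_ringC p" by (metis Quotient3_abs_rep[OF Quotient3_ringC])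
  then show ?thesis by (simp flip: abs_ringC_add add: f2_add_self abs_ringC_0)
qed

lemma ringC_add_self_left [simp]: "(u::ringC) + (u + v) = v"
  by (simp flip: add.assoc)

lemma ringC_minus [simp]: "- (u::ringC) = u"
  by (metis ringC_add_self add.inverse_unique)

lemma ringC_diff [simp]: "(u::ringC) - v = u + v"
  by (metis ringC_minus diff_conv_add_uminus)

lemma ringC_char2: "(1::ringC) + 1 = 0"
  by simp

lemma ym_add: "ym (e + f) = ym e * ym f"
  by (simp add: ym_def mult_single flip: abs_ringC_mult)

lemma ym_0 [simp]: "ym 0 = 1"
  by (simp add: ym_def abs_ringC_1)

lemma ym_delta: "ym (delta i k) = y_C i ^ k"
proof (induction k)
  case (Suc k)
  then show ?case
    using ym_add[of "delta i 1" "delta i k"]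
    by (simp add: ym_def y_C_def var_def flip: single_add)
qed simp

lemma y_cubed: "y_C i ^ 3 = y_C i * y_C (Suc i)"
proof -
  have "abs_ringC (var i ^ 3) = abs_ringC (var i * var (i + 1))"
    unfolding ringC_eq_iff
  proof -
    have "var i ^ 3 - var i * var (i + 1) = var i ^ 3 + var i * var (i + 1)"
      by (simp only: diff_eq_eq add.assoc f2_add_self add_0_right)
    moreover have "var i ^ 3 + var i * var (i + 1) \<in> ideal_C"
      unfolding ideal_C_def ideal_gen_def
      by (intro module.span_base[OF module_times]) auto
    ultimately show "var i ^ 3 - var i * var (i + 1) \<in> ideal_C" by (simp only:)
  qed
  then show ?thesis
    by (simp add: y_C_def abs_ringC_mult power3_eq_cube)
qed

lemma y_cubed_mult: "y_C i * (y_C i * y_C i) = y_C i * y_C (Suc i)"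
  using y_cubed[of i] by (simp add: power3_eq_cube mult.assoc)

text \<open>All graded pieces, subrings and ideals that occur below are spanned by monomials, so that their
  closure properties reduce to statements about exponents.\<close>

inductive_set mspan :: "(nat \<Rightarrow>\<^sub>0 nat) set \<Rightarrow> ringC set" for S where
  mspan_0: "0 \<in> mspan S"
| mspan_plus: "e \<in> S \<Longrightarrow> u \<in> mspan S \<Longrightarrow> ym e + u \<in> mspan S"

lemma mspan_ym: "e \<in> S \<Longrightarrow> ym e \<in> mspan S"
  using mspan_plus[OF _ mspan_0] by simp

lemma mspan_add: "u \<in> mspan S \<Longrightarrow> v \<in> mspan S \<Longrightarrow> u + v \<in> mspan S"
  by (induction u rule: mspan.induct) (auto simp: add.assoc intro: mspan_plus)

lemma mspan_sum: "(\<And>x. x \<in> F \<Longrightarrow> u x \<in> mspan S) \<Longrightarrow> sum u F \<in> mspan S"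
  by (induction F rule: infinite_finite_induct) (auto intro: mspan_0 mspan_add)

lemma mspan_mono: "S \<subseteq> T \<Longrightarrow> mspan S \<subseteq> mspan T"
proof
  fix u assume "S \<subseteq> T" "u \<in> mspan S"
  from this(2,1) show "u \<in> mspan T"
    by (induction u rule: mspan.induct) (auto intro: mspan_0 mspan_plus)
qed

lemma mspan_mult_ym:
  assumes "v \<in> mspan T" "\<And>f. f \<in> T \<Longrightarrow> e + f \<in> U"
  shows "ym e * v \<in> mspan U"
  using assms
  by (induction v rule: mspan.induct)
    (auto simp: distrib_left intro: mspan_0 mspan_plus simp flip: ym_add)

lemma mspan_mult:
  assumes "u \<in> mspan S" "v \<in> mspan T" "\<And>e f. e \<in> S \<Longrightarrow> f \<in> T \<Longrightarrow> e + f \<in> U"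
  shows "u * v \<in> mspan U"
  using assms
  by (induction u rule: mspan.induct)
    (auto simp: distrib_right intro!: mspan_0 mspan_add mspan_mult_ym[of v T])

lemma mspan_eq_image: "mspan S = abs_ringC ` {p. keys p \<subseteq> S}"
proof (intro equalityI subsetI)
  fix u assume "u \<in> mspan S"
  then show "u \<in> abs_ringC ` {p. keys p \<subseteq> S}"
  proof (induction rule: mspan.induct)
    case mspan_0
    then show ?case by (auto intro!: image_eqI[of _ _ 0] simp: abs_ringC_0)
  next
    case (mspan_plus e u)
    then obtain p where "u = abs_ringC p" "keys p \<subseteq> S" by auto
    then show ?case
      using mspan_plus(1) keys_add[of "Poly_Mapping.single e 1" p]
      by (auto intro!: image_eqI[of _ _ "Poly_Mapping.single e 1 + p"] simp: ym_def abs_ringC_add)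
  qed
next
  fix u assume "u \<in> abs_ringC ` {p. keys p \<subseteq> S}"
  then obtain p where "u = abs_ringC p" "keys p \<subseteq> S" by auto
  moreover from this have "abs_ringC p \<in> mspan S"
    by (intro f2_poly_induct[of "\<lambda>q. abs_ringC q \<in> mspan S" p])
      (auto simp: abs_ringC_0 abs_ringC_add mspan_0 mspan_plus simp flip: ym_def)
  ultimately show "u \<in> mspan S" by simp
qed

lemma mspan_UNIV [simp]: "mspan UNIV = UNIV"
proof -
  have "u \<in> range abs_ringC" for u
    by (metis Quotient3_abs_rep[OF Quotient3_ringC] rangeI)
  then show ?thesis by (auto simp: mspan_eq_image)
qed

lemma ringC_induct [case_names zero add]:
  assumes "P 0" "\<And>e u. P u \<Longrightarrow> P (ym e + u)"
  shows "P (u::ringC)"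
proof -
  have "u \<in> mspan UNIV" by simp
  then show ?thesis by induction (auto intro: assms)
qed

subsection \<open>Normal forms\<close>

definition normal :: "(nat \<Rightarrow>\<^sub>0 nat) \<Rightarrow> bool" where
  "normal e \<longleftrightarrow> (\<forall>i. lookup e i \<le> 2)"

text \<open>Rewriting \<open>y\<^sub>i\<^sup>3\<close> to \<open>y\<^sub>i y\<^sub>i\<^sub>+\<^sub>1\<close> from left to right moves a carry from each exponent to the
  next, leaving a digit of the same parity that is zero only if nothing was there.\<close>

fun carry :: "(nat \<Rightarrow> nat) \<Rightarrow> nat \<Rightarrow> nat" where
  "carry e 0 = 0"
| "carry e (Suc i) = (e i + carry e i - 1) div 2"

definition digit :: "nat \<Rightarrow> nat" where
  "digit s = (if s = 0 then 0 else if odd s then 1 else 2)"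

definition digits :: "(nat \<Rightarrow>\<^sub>0 nat) \<Rightarrow> nat \<Rightarrow> nat" where
  "digits e i = digit (lookup e i + carry (lookup e) i)"

text \<open>The digit at \<open>i\<close> keeps its parity, and the two units lost there reappear as one unit at the next
  position: before the rewriting step as a carry, after it as an exponent.\<close>

lemma digits_rewrite: "digits (f + delta i 3) = digits (f + (delta i 1 + delta (Suc i) 1))"
proof -
  define e0 where "e0 = f + delta i 3"
  define e1 where "e1 = f + (delta i 1 + delta (Suc i) 1)"
  let ?e = "lookup e0"
  let ?e' = "lookup e1"
  let ?f = "lookup f"
  have e: "?e j = ?f j + (if j = i then 3 else 0)" for j
    by (auto simp: e0_def lookup_add lookup_single)
  have e': "?e' j = ?f j + (if j = i \<or> j = Suc i then 1 else 0)" for j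
    by (auto simp: e1_def lookup_add lookup_single)
  have le: "carry ?e j = carry ?e' j" if "j \<le> i" for j
    using that by (induction j) (auto simp: e e')
  have Suc: "carry ?e (Suc i) = carry ?e' (Suc i) + 1"
    using le[of i] by (simp only: carry.simps e[of i] e'[of i]) simp
  have gt: "?e j + carry ?e j = ?e' j + carry ?e' j" if "j > i" for j
  proof -
    have "Suc i \<le> j" using that by simp
    then show ?thesis
    proof (induction j rule: dec_induct)
      case base
      then show ?case using Suc by (simp only: e[of "Suc i"] e'[of "Suc i"]) simp
    next
      case (step j)
      then show ?case by (simp add: e e')
    qed
  qed
  have "digits e0 = digits e1"
  proof
    fix j
    consider "j < i" | "j = i" | "j > i" by linarith
    then show "digits e0 j = digits e1 j"
    proof cases
      case 1
      then show ?thesis using le[of j] by (simp add: digits_def e e')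
    next
      case 2
      have "digit (?f i + 3 + c) = digit (?f i + 1 + c)" for c
        by (simp add: digit_def)
      then show ?thesis using 2 le[of j] by (simp add: digits_def e e')
    next
      case 3
      then show ?thesis unfolding digits_def using gt by simp
    qed
  qed
  then show ?thesis by (simp only: e0_def e1_def)
qed

lemma digits_normal:
  assumes "normal e" shows "digits e = lookup e"
proof -
  have e: "lookup e i \<in> {0, 1, 2}" for i
    using assms unfolding normal_def by (metis insertCI le_SucE le_zero_eq numeral_2_eq_2 One_nat_def)
  have carry: "carry (lookup e) i = 0" for i
  proof (induction i)
    case (Suc i)
    then show ?case using e[of i] by auto
  qed simp
  show ?thesis
  proof
    fix i
    show "digits e i = lookup e i"
      using e[of i] by (auto simp: digits_def carry digit_def)
  qed
qed

lemma weight_superset: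
  assumes "finite S" "keys m \<subseteq> S"
  shows "monom_weight m = (\<Sum>i\<in>S. lookup m i * 2 ^ i)"
  unfolding monom_weight_def
  by (rule sum.mono_neutral_left) (use assms in \<open>auto simp: in_keys_iff\<close>)

lemma weight_add: "monom_weight (e + f) = monom_weight e + monom_weight f"
proof -
  let ?S = "keys e \<union> keys f"
  show ?thesis
    using weight_superset[of ?S e] weight_superset[of ?S f]
      weight_superset[of ?S "e + f"] keys_add[of e f]
    by (simp add: lookup_add sum.distrib distrib_right)
qed

lemma weight_0 [simp]: "monom_weight 0 = 0"
  by (simp add: monom_weight_def)

lemma weight_delta [simp]: "monom_weight (delta i k) = k * 2 ^ i"
  by (cases "k = 0") (simp_all add: monom_weight_def)

lemma keys_add_nat: "keys (e + f) = keys e \<union> keys (f :: nat \<Rightarrow>\<^sub>0 nat)"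
  by (auto simp: in_keys_iff lookup_add)

text \<open>The clauses besides the first two say what rewriting preserves: the weight, the absence of
  low variables, and the presence of high ones.\<close>

definition normalizes_to :: "(nat \<Rightarrow>\<^sub>0 nat) \<Rightarrow> (nat \<Rightarrow>\<^sub>0 nat) \<Rightarrow> bool" where
  "normalizes_to e e' \<longleftrightarrow> normal e' \<and> ym e' = ym e \<and> digits e' = digits e \<and>
     monom_weight e' = monom_weight e \<and>
     (\<forall>n. keys e \<subseteq> {n..} \<longrightarrow> keys e' \<subseteq> {n..}) \<and>
     (\<forall>m. (\<exists>i\<in>keys e. m < i) \<longrightarrow> (\<exists>i\<in>keys e'. m < i))"

lemma normalizes_ex: "\<exists>e'. normalizes_to e e'"
proof (induction "\<Sum>i\<in>keys e. lookup e i" arbitrary: e rule: less_induct)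
  case less
  let ?size = "\<lambda>e :: nat \<Rightarrow>\<^sub>0 nat. \<Sum>i\<in>keys e. lookup e i"
  show ?case
  proof (cases "normal e")
    case True
    then show ?thesis by (auto simp: normalizes_to_def)
  next
    case False
    then obtain i where i: "lookup e i \<ge> 3"
      unfolding normal_def by (metis not_less_eq_eq numeral_2_eq_2 numeral_3_eq_3)
    define f where "f = e - delta i 3"
    have e: "e = f + delta i 3"
      by (rule poly_mapping_eqI) (use i in \<open>auto simp: f_def lookup_add lookup_minus lookup_single when_def\<close>)
    define e1 where "e1 = f + (delta i 1 + delta (Suc i) 1)"
    have size_add: "?size (g + h) = ?size g + ?size h" for g h
    proof -
      let ?S = "keys g \<union> keys h"
      have "?size k = (\<Sum>i\<in>?S. lookup k i)" if "keys k \<subseteq> ?S" for k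
        by (rule sum.mono_neutral_left) (use that in \<open>auto simp: in_keys_iff\<close>)
      then show ?thesis by (simp add: keys_add_nat lookup_add sum.distrib)
    qed
    have "?size e1 < ?size e"
      unfolding e e1_def size_add by simp
    then obtain e' where e': "normalizes_to e1 e'" using less by blast
    have "ym e1 = ym e"
      unfolding e e1_def ym_add by (simp add: ym_delta y_cubed)
    moreover have "digits e1 = digits e"
      unfolding e e1_def by (rule digits_rewrite[symmetric])
    moreover have "monom_weight e1 = monom_weight e"
      unfolding e e1_def by (simp add: weight_add)
    moreover have "keys e1 = keys e \<union> {Suc i}" "i \<in> keys e"
      unfolding e e1_def by (auto simp: keys_add_nat)
    moreover from this have "keys e1 \<subseteq> {n..}" if "keys e \<subseteq> {n..}" for n
      using that by (auto simp: subset_iff intro: le_SucI)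
    ultimately show ?thesis
      using e' unfolding normalizes_to_def by (intro exI[of _ e']) auto
  qed
qed

definition nf :: "(nat \<Rightarrow>\<^sub>0 nat) \<Rightarrow> (nat \<Rightarrow>\<^sub>0 nat)" where
  "nf e = (SOME e'. normalizes_to e e')"

lemma normalizes_nf: "normalizes_to e (nf e)"
  unfolding nf_def by (rule someI_ex) (rule normalizes_ex)

lemma normal_nf: "normal (nf e)" and ym_nf: "ym (nf e) = ym e" and digits_nf: "digits (nf e) = digits e"
  and weight_nf: "monom_weight (nf e) = monom_weight e"
  and keys_nf_ge: "keys e \<subseteq> {n..} \<Longrightarrow> keys (nf e) \<subseteq> {n..}"
  and keys_nf_gt: "\<exists>i\<in>keys e. m < i \<Longrightarrow> \<exists>i\<in>keys (nf e). m < i"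
  using normalizes_nf[of e] unfolding normalizes_to_def by blast+

lemma nf_eq_iff_digits: "nf e = nf f \<longleftrightarrow> digits e = digits f"
  by (metis digits_nf digits_normal normal_nf poly_mapping_eqI)

lemma nf_normal: "normal e \<Longrightarrow> nf e = e"
  by (metis digits_nf digits_normal normal_nf poly_mapping_eqI)


text \<open>The coefficient of \<open>w\<close> after rewriting. It is invariant under the relations, hence defined on C,
  and this is what makes distinct normal monomials linearly independent.\<close>

definition poly_coef :: "(nat \<Rightarrow>\<^sub>0 nat) \<Rightarrow> f2_poly \<Rightarrow> bit" where
  "poly_coef w p = (\<Sum>m\<in>keys p. if nf m = w then lookup p m else 0)"

lemma poly_coef_add: "poly_coef w (p + q) = poly_coef w p + poly_coef w q"
proof -
  let ?S = "keys p \<union> keys q"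
  have "poly_coef w r = (\<Sum>m\<in>?S. if nf m = w then lookup r m else 0)"
    if "keys r \<subseteq> ?S" for r
    unfolding poly_coef_def
    by (rule sum.mono_neutral_left) (use that in \<open>auto simp: in_keys_iff\<close>)
  moreover have "(\<Sum>m\<in>?S. if nf m = w then lookup (p + q) m else 0) =
      (\<Sum>m\<in>?S. if nf m = w then lookup p m else 0) +
      (\<Sum>m\<in>?S. if nf m = w then lookup q m else 0)"
    unfolding sum.distrib[symmetric] by (rule sum.cong) (simp_all only: lookup_add if_distrib if_cancel add_0_left split: if_split, simp_all)
  ultimately show ?thesis by (simp only: keys_add Un_upper1 Un_upper2)
qed

lemma poly_coef_0 [simp]: "poly_coef w 0 = 0"
  by (simp add: poly_coef_def)

lemma poly_coef_monomial: "poly_coef w (Poly_Mapping.single e 1) = (if nf e = w then 1 else 0)"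
  by (simp add: poly_coef_def)

lemma poly_coef_relation:
  "poly_coef w (q * (var i ^ 3 + var i * var (i + 1))) = 0"
proof (induction q rule: f2_poly_induct)
  case (add m q)
  have "var i ^ 3 + var i * var (i + 1) =
      Poly_Mapping.single (delta i 3) 1 + Poly_Mapping.single (delta i 1 + delta (Suc i) 1) 1"
    by (simp add: var_def power3_eq_cube mult_single numeral_3_eq_3 flip: single_add)
  then have "Poly_Mapping.single m 1 * (var i ^ 3 + var i * var (i + 1)) =
      Poly_Mapping.single (m + delta i 3) 1 +
      Poly_Mapping.single (m + (delta i 1 + delta (Suc i) 1)) 1"
    by (simp add: distrib_left mult_single)
  moreover have "nf (m + delta i 3) = nf (m + (delta i 1 + delta (Suc i) 1))"
    unfolding nf_eq_iff_digits by (rule digits_rewrite)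
  ultimately have "poly_coef w (Poly_Mapping.single m 1 * (var i ^ 3 + var i * var (i + 1))) = 0"
    by (simp add: poly_coef_add poly_coef_monomial)
  with add show ?case by (simp only: distrib_right poly_coef_add) simp
qed simp

lemma poly_coef_ideal: "p \<in> ideal_C \<Longrightarrow> poly_coef w p = 0"
  unfolding ideal_C_def ideal_gen_def
proof (induction p rule: module.span_induct_alt[OF module_times, consumes 1, case_names base step])
  case (step c x y)
  then show ?case using poly_coef_relation[of w c] by (auto simp: poly_coef_add)
qed simp

lift_definition coef :: "(nat \<Rightarrow>\<^sub>0 nat) \<Rightarrow> ringC \<Rightarrow> bit" is poly_coef
proof -
  fix w p q assume "p - q \<in> ideal_C"
  then have "poly_coef w (p - q) = 0" by (rule poly_coef_ideal)
  moreover have "poly_coef w ((p - q) + q) = poly_coef w (p - q) + poly_coef w q"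
    by (rule poly_coef_add)
  ultimately show "poly_coef w p = poly_coef w q"
    by (simp only: diff_add_cancel add_0_left)
qed

lemma coef_add: "coef w (u + v) = coef w u + coef w v"
  by transfer (rule poly_coef_add)

lemma coef_0 [simp]: "coef w 0 = 0"
  by transfer simp

lemma coef_ym: "coef w (ym e) = (if nf e = w then 1 else 0)"
  unfolding ym_def coef.abs_eq by (rule poly_coef_monomial)

lemma coef_sum: "coef w (sum u F) = (\<Sum>x\<in>F. coef w (u x))"
  by (induction F rule: infinite_finite_induct) (auto simp: coef_add)

lemma nf_unique: "normal e' \<Longrightarrow> ym e = ym e' \<Longrightarrow> nf e = e'"
  by (metis coef_ym nf_normal zero_neq_one)

definition supp :: "ringC \<Rightarrow> (nat \<Rightarrow>\<^sub>0 nat) set" where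
  "supp u = {w. coef w u = 1}"

lemma supp_plus_ym:
  "supp (ym e + u) = (if nf e \<in> supp u then supp u - {nf e} else insert (nf e) (supp u))"
  by (auto simp: supp_def coef_add coef_ym split: if_splits)

lemma supp_finite_expansion: "finite (supp u) \<and> u = sum ym (supp u)"
proof (induction u rule: ringC_induct)
  case zero
  then show ?case by (simp add: supp_def)
next
  case (add e u)
  then have u: "finite (supp u)" "u = sum ym (supp u)" by auto
  have "ym e + u = sum ym (supp (ym e + u))"
  proof (cases "nf e \<in> supp u")
    case True
    then have "u = ym e + sum ym (supp u - {nf e})"
      using u by (metis sum.remove ym_nf)
    then have "ym e + u = sum ym (supp u - {nf e})"
      by (metis ringC_add_self_left)
    moreover have "supp (ym e + u) = supp u - {nf e}"
      using True by (simp add: supp_plus_ym)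
    ultimately show ?thesis by (simp only:)
  next
    case False
    then show ?thesis using u by (simp add: supp_plus_ym ym_nf)
  qed
  moreover have "finite (supp (ym e + u))"
    using u(1) by (simp add: supp_plus_ym)
  ultimately show ?case by blast
qed

lemmas finite_supp = supp_finite_expansion[THEN conjunct1]
  and sum_supp = supp_finite_expansion[THEN conjunct2]

lemma supp_normal: "w \<in> supp u \<Longrightarrow> normal w"
proof (induction u rule: ringC_induct)
  case zero
  then show ?case by (simp add: supp_def)
next
  case (add e u)
  then show ?case by (auto simp: supp_plus_ym normal_nf split: if_splits)
qed

text \<open>If a set of exponents is stable under normalization, then membership in the span of its
  monomials can be read off from the normal form.\<close>

lemma mspan_iff_supp:
  assumes "\<And>e. e \<in> S \<Longrightarrow> nf e \<in> S"
  shows "u \<in> mspan S \<longleftrightarrow> supp u \<subseteq> S"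
proof
  show "u \<in> mspan S \<Longrightarrow> supp u \<subseteq> S"
  proof (induction u rule: mspan.induct)
    case mspan_0
    then show ?case by (simp add: supp_def)
  next
    case (mspan_plus e u)
    then show ?case using assms by (auto simp: supp_plus_ym split: if_splits)
  qed
next
  assume "supp u \<subseteq> S"
  then have "sum ym (supp u) \<in> mspan S" by (auto intro!: mspan_sum mspan_ym)
  then show "u \<in> mspan S" using sum_supp[of u] by simp
qed

section \<open>The tower of subrings and the truncation ideals\<close>

text \<open>\<open>tail n\<close> is the subring generated by \<open>y\<^sub>n, y\<^sub>n\<^sub>+\<^sub>1, \<dots>\<close>, a copy of C itself with degrees
  multiplied by \<open>2\<^sup>n\<close>. \<open>high m\<close> is the ideal generated by \<open>y\<^sub>m\<^sub>+\<^sub>1, y\<^sub>m\<^sub>+\<^sub>2, \<dots>\<close>.\<close>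

definition tail :: "nat \<Rightarrow> ringC set" where
  "tail n = mspan {e. keys e \<subseteq> {n..}}"

definition high :: "nat \<Rightarrow> ringC set" where
  "high m = mspan {e. \<exists>i\<in>keys e. m < i}"

lemma y_cubed_mult_left: "y_C i * (y_C i * (y_C i * r)) = y_C i * (y_C (Suc i) * r)"
  using y_cubed_mult[of i] by (metis mult.assoc)

lemma tail_iff_supp: "u \<in> tail n \<longleftrightarrow> (\<forall>w\<in>supp u. keys w \<subseteq> {n..})"
  unfolding tail_def by (subst mspan_iff_supp) (auto dest: keys_nf_ge)

lemma high_iff_supp: "u \<in> high m \<longleftrightarrow> (\<forall>w\<in>supp u. \<exists>i\<in>keys w. m < i)"
  unfolding high_def by (subst mspan_iff_supp) (use keys_nf_gt in blast)+

lemma tail_0_UNIV [simp]: "tail 0 = UNIV"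
  by (simp add: tail_def)

lemma tail_zero [simp]: "0 \<in> tail n"
  by (simp add: tail_def mspan_0)

lemma tail_one [simp]: "1 \<in> tail n"
  using mspan_ym[of 0 "{e. keys e \<subseteq> {n..}}"] by (simp add: tail_def)

lemma tail_add: "u \<in> tail n \<Longrightarrow> v \<in> tail n \<Longrightarrow> u + v \<in> tail n"
  by (simp add: tail_def mspan_add)

lemma tail_mult: "u \<in> tail n \<Longrightarrow> v \<in> tail n \<Longrightarrow> u * v \<in> tail n"
  unfolding tail_def by (erule (1) mspan_mult) (simp add: keys_add_nat)

lemma tail_y: "n \<le> i \<Longrightarrow> y_C i \<in> tail n"
  using mspan_ym[of "delta i 1" "{e. keys e \<subseteq> {n..}}"] ym_delta[of i 1]
  by (simp add: tail_def)

lemma tail_power: "u \<in> tail n \<Longrightarrow> u ^ k \<in> tail n"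
  by (induction k) (auto intro: tail_mult)

lemma high_zero [simp]: "0 \<in> high m"
  by (simp add: high_def mspan_0)

lemma high_add: "u \<in> high m \<Longrightarrow> v \<in> high m \<Longrightarrow> u + v \<in> high m"
  by (simp add: high_def mspan_add)

lemma high_mult: "u \<in> high m \<Longrightarrow> v * u \<in> high m"
  unfolding high_def
  by (rule mspan_mult[where S = UNIV and T = "{e. \<exists>i\<in>keys e. m < i}"])
    (auto simp: keys_add_nat)

lemma high_sum: "(\<And>x. x \<in> F \<Longrightarrow> u x \<in> high m) \<Longrightarrow> sum u F \<in> high m"
  unfolding high_def by (rule mspan_sum)

lemma coef_high:
  assumes "u \<in> high m" "keys w \<subseteq> {..m}" shows "coef w u = 0"
proof (rule ccontr)
  assume "coef w u \<noteq> 0"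
  then have "w \<in> supp u" by (simp add: supp_def)
  then show False using assms unfolding high_iff_supp by fastforce
qed

subsection \<open>Each subring of the tower is free over the next\<close>

lemma y_power_reduce:
  "\<exists>i j. i \<le> 2 \<and> k = 2 * j + i \<and> y_C n ^ k = y_C (Suc n) ^ j * y_C n ^ i"
proof (induction k rule: less_induct)
  case (less k)
  show ?case
  proof (cases "k \<le> 2")
    case True
    then show ?thesis by (intro exI[of _ k] exI[of _ 0]) simp
  next
    case False
    then obtain l where k: "k = l + 3" by (metis add.commute le_iff_add not_less_eq_eq numeral_2_eq_2 numeral_3_eq_3)
    have "l + 1 < k" using k by simp
    from less[OF this] obtain i j where ij: "i \<le> 2" "l + 1 = 2 * j + i"
      "y_C n ^ (l + 1) = y_C (Suc n) ^ j * y_C n ^ i"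
      by blast
    have "y_C n ^ k = y_C n ^ (l + 1) * y_C (Suc n)"
      unfolding k power_add y_cubed by (simp add: ac_simps)
    then have "y_C n ^ k = y_C (Suc n) ^ Suc j * y_C n ^ i"
      unfolding ij(3) by (simp add: ac_simps)
    moreover have "k = 2 * Suc j + i" using ij(2) k by simp
    ultimately show ?thesis using ij(1) by blast
  qed
qed

text \<open>Only the lowest variable is rewritten, so that at most the next variable is new. Full
  normalization could involve arbitrarily high ones.\<close>

lemma ym_split_lowest:
  assumes "keys e \<subseteq> {n..}"
  shows "\<exists>i e'. i \<le> 2 \<and> ym e = ym e' * y_C n ^ i \<and>
    monom_weight e = monom_weight e' + i * 2 ^ n \<and>
    keys e' \<subseteq> {Suc n..} \<inter> insert (Suc n) (keys e)"
proof -
  define k where "k = lookup e n"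
  define r where "r = e - delta n k"
  have r: "e = r + delta n k"
    by (rule poly_mapping_eqI) (auto simp: r_def k_def lookup_add lookup_minus lookup_single when_def)
  have keys_r: "keys r \<subseteq> {Suc n..} \<inter> keys e"
  proof
    fix i assume "i \<in> keys r"
    then have "lookup r i \<noteq> 0" by (simp add: in_keys_iff)
    then have "i \<noteq> n" "lookup e i \<noteq> 0"
      by (auto simp: r_def k_def lookup_minus lookup_single when_def split: if_splits)
    then have "i \<in> keys e" by (simp add: in_keys_iff)
    with assms \<open>i \<noteq> n\<close> show "i \<in> {Suc n..} \<inter> keys e" by force
  qed
  obtain i j where ij: "i \<le> 2" "k = 2 * j + i" "y_C n ^ k = y_C (Suc n) ^ j * y_C n ^ i"
    using y_power_reduce by blast
  let ?e' = "r + delta (Suc n) j"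
  have "ym e = ym ?e' * y_C n ^ i"
    by (simp add: r ym_add ym_delta ij(3) mult.assoc)
  moreover have "monom_weight e = monom_weight ?e' + i * 2 ^ n"
    by (simp add: r weight_add ij(2) algebra_simps)
  moreover have "keys ?e' \<subseteq> {Suc n..} \<inter> insert (Suc n) (keys e)"
    using keys_r by (auto simp: keys_add_nat split: if_splits)
  ultimately show ?thesis using ij(1) by blast
qed

lemma mspan_decompose:
  assumes "u \<in> mspan S"
    and "\<And>e. e \<in> S \<Longrightarrow> \<exists>i\<le>2. \<exists>e'\<in>S' i. ym e = ym e' * y_C n ^ i"
  shows "\<exists>c0\<in>mspan (S' 0). \<exists>c1\<in>mspan (S' 1). \<exists>c2\<in>mspan (S' 2).
    u = c0 + c1 * y_C n + c2 * y_C n ^ 2"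
  using assms(1)
proof induction
  case mspan_0
  have "(0::ringC) = 0 + 0 * y_C n + 0 * y_C n ^ 2" by simp
  then show ?case using mspan.mspan_0 by blast
next
  case (mspan_plus e u)
  then obtain c0 c1 c2 where c: "c0 \<in> mspan (S' 0)" "c1 \<in> mspan (S' 1)" "c2 \<in> mspan (S' 2)"
    and u: "u = c0 + c1 * y_C n + c2 * y_C n ^ 2" by blast
  obtain i e' where e': "i \<le> 2" "e' \<in> S' i" "ym e = ym e' * y_C n ^ i"
    using assms(2) mspan_plus(1) by blast
  from e'(1) consider "i = 0" | "i = 1" | "i = 2" by linarith
  then show ?case
  proof cases
    case 1
    with u e' have "ym e + u = (ym e' + c0) + c1 * y_C n + c2 * y_C n ^ 2"
      by (simp add: algebra_simps)
    moreover have "ym e' + c0 \<in> mspan (S' 0)" using c 1 e' by (auto intro: mspan.mspan_plus)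
    ultimately show ?thesis using c by blast
  next
    case 2
    with u e' have "ym e + u = c0 + (ym e' + c1) * y_C n + c2 * y_C n ^ 2"
      by (simp add: algebra_simps)
    moreover have "ym e' + c1 \<in> mspan (S' 1)" using c 2 e' by (auto intro: mspan.mspan_plus)
    ultimately show ?thesis using c by blast
  next
    case 3
    with u e' have "ym e + u = c0 + c1 * y_C n + (ym e' + c2) * y_C n ^ 2"
      by (simp add: algebra_simps)
    moreover have "ym e' + c2 \<in> mspan (S' 2)" using c 3 e' by (auto intro: mspan.mspan_plus)
    ultimately show ?thesis using c by blast
  qed
qed

lemma tail_decompose:
  assumes "u \<in> tail n"
  obtains c0 c1 c2 where "c0 \<in> tail (Suc n)" "c1 \<in> tail (Suc n)" "c2 \<in> tail (Suc n)"
    "u = c0 + c1 * y_C n + c2 * y_C n ^ 2"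
proof -
  have "\<exists>i\<le>2. \<exists>e'\<in>{e. keys e \<subseteq> {Suc n..}}. ym e = ym e' * y_C n ^ i"
    if "e \<in> {e. keys e \<subseteq> {n..}}" for e
    using ym_split_lowest[of e n] that by auto
  from mspan_decompose[OF assms[unfolded tail_def] this, folded tail_def]
  show ?thesis using that by blast
qed

lemma lookup_0_if_keys_ge: "keys w \<subseteq> {Suc n..} \<Longrightarrow> lookup w n = 0"
  by (rule ccontr) (auto simp flip: in_keys_iff)

text \<open>Multiplying a normal monomial in higher variables by \<open>1\<close>, \<open>y\<^sub>n\<close> or \<open>y\<^sub>n\<^sup>2\<close> gives a normal monomial.\<close>

lemma coef_mult_y_power:
  assumes "c \<in> tail (Suc n)" "i \<le> 2" "j \<le> 2" "keys w \<subseteq> {Suc n..}"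
  shows "coef (w + delta n j) (c * y_C n ^ i) = (if i = j then coef w c else 0)"
  using assms(1) unfolding tail_def
proof (induction rule: mspan.induct)
  case (mspan_plus f u)
  have f: "keys (nf f) \<subseteq> {Suc n..}"
    using mspan_plus(1) keys_nf_ge by blast
  have "normal (nf f + delta n i)"
    using normal_nf[of f] lookup_0_if_keys_ge[OF f] assms(2)
    by (auto simp: normal_def lookup_add lookup_single when_def)
  moreover have "ym (f + delta n i) = ym (nf f + delta n i)"
    by (simp add: ym_add ym_nf)
  ultimately have "nf (f + delta n i) = nf f + delta n i"
    by (rule nf_unique)
  moreover have "nf f + delta n i = w + delta n j \<longleftrightarrow> i = j \<and> nf f = w"
  proof
    assume eq: "nf f + delta n i = w + delta n j"
    then have "lookup (nf f + delta n i) n = lookup (w + delta n j) n"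
      by simp
    then have "i = j"
      using lookup_0_if_keys_ge[OF f] lookup_0_if_keys_ge[OF assms(4)] by (simp add: lookup_add)
    with eq show "i = j \<and> nf f = w" by simp
  qed simp
  ultimately have "coef (w + delta n j) (ym f * y_C n ^ i) = (if i = j then coef w (ym f) else 0)"
    by (simp add: coef_ym flip: ym_delta ym_add)
  then show ?case using mspan_plus.IH by (simp add: distrib_right coef_add)
qed simp

text \<open>Reduction modulo a truncation ideal respects the decomposition over the next subring, because
  normal forms do.\<close>

lemma high_components:
  assumes c: "c0 \<in> tail (Suc n)" "c1 \<in> tail (Suc n)" "c2 \<in> tail (Suc n)"
    and "n \<le> m" and high: "c0 + c1 * y_C n + c2 * y_C n ^ 2 \<in> high m"
  shows "c0 \<in> high m" "c1 \<in> high m" "c2 \<in> high m"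
proof -
  have *: "\<exists>i\<in>keys w. m < i"
    if j: "j \<le> 2" and w: "keys w \<subseteq> {Suc n..}"
      and "coef (w + delta n j) (c0 + c1 * y_C n + c2 * y_C n ^ 2) = 1" for w j
  proof -
    have "\<exists>i\<in>keys (w + delta n j). m < i"
      using high that(3) unfolding high_iff_supp by (auto simp: supp_def)
    then show ?thesis using \<open>n \<le> m\<close> by (auto simp: keys_add_nat split: if_splits)
  qed
  have coef: "coef (w + delta n j) (c0 + c1 * y_C n + c2 * y_C n ^ 2) =
      (if j = 0 then coef w c0 else 0) + (if j = 1 then coef w c1 else 0) +
      (if j = 2 then coef w c2 else 0)"
    if "j \<le> 2" "keys w \<subseteq> {Suc n..}" for w j
    using coef_mult_y_power[OF c(1) _ that, of 0] coef_mult_y_power[OF c(2) _ that, of 1]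
      coef_mult_y_power[OF c(3) _ that, of 2]
    by (simp add: coef_add)
  show "c0 \<in> high m" unfolding high_iff_supp
  proof
    fix w assume "w \<in> supp c0"
    then have w: "coef w c0 = 1" "keys w \<subseteq> {Suc n..}"
      using c(1) by (auto simp: supp_def tail_iff_supp)
    then show "\<exists>i\<in>keys w. m < i" by (intro *[of 0]) (simp_all only: coef, simp_all)
  qed
  show "c1 \<in> high m" unfolding high_iff_supp
  proof
    fix w assume "w \<in> supp c1"
    then have w: "coef w c1 = 1" "keys w \<subseteq> {Suc n..}"
      using c(2) by (auto simp: supp_def tail_iff_supp)
    then show "\<exists>i\<in>keys w. m < i" by (intro *[of 1]) (simp_all only: coef, simp_all)
  qed
  show "c2 \<in> high m" unfolding high_iff_supp
  proof
    fix w assume "w \<in> supp c2"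
    then have w: "coef w c2 = 1" "keys w \<subseteq> {Suc n..}"
      using c(3) by (auto simp: supp_def tail_iff_supp)
    then show "\<exists>i\<in>keys w. m < i" by (intro *[of 2]) (simp_all only: coef, simp_all)
  qed
qed

section \<open>The truncations are Frobenius algebras\<close>

definition twos :: "nat \<Rightarrow> (nat \<Rightarrow>\<^sub>0 nat)" where
  "twos n = (\<Sum>i<n. delta i 2)"

lemma lookup_twos: "lookup (twos n) i = (if i < n then 2 else 0)"
  by (simp add: twos_def lookup_sum lookup_single when_def)

lemma keys_twos: "keys (twos n) = {..<n}"
  by (auto simp: in_keys_iff lookup_twos split: if_splits)

lemma twos_Suc: "twos (Suc n) = twos n + delta n 2"
  by (simp add: twos_def)

lemma normal_twos: "normal (twos n)"
  by (simp add: normal_def lookup_twos)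

text \<open>The monomial \<open>y\<^sub>0\<^sup>2 \<dots> y\<^sub>m\<^sup>2\<close> spans the socle of the truncation \<open>C / high m\<close>.\<close>

definition socle_form :: "nat \<Rightarrow> ringC \<Rightarrow> bit" where
  "socle_form m u = coef (twos (Suc m)) u"

lemma socle_form_add: "socle_form m (u + v) = socle_form m u + socle_form m v"
  by (simp add: socle_form_def coef_add)

lemma socle_form_0 [simp]: "socle_form m 0 = 0"
  by (simp add: socle_form_def)

lemma socle_form_high: "u \<in> high m \<Longrightarrow> socle_form m u = 0"
  unfolding socle_form_def by (rule coef_high) (auto simp: keys_twos)

lemma socle_form_low_power:
  assumes "w \<in> tail (Suc n)" "i < 2" "n \<le> m"
  shows "socle_form m (ym (twos n) * (w * y_C n ^ i)) = 0"
  using assms(1) unfolding tail_def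
proof (induction rule: mspan.induct)
  case (mspan_plus f u)
  let ?e = "twos n + (nf f + delta n i)"
  have f: "keys (nf f) \<subseteq> {Suc n..}"
    using mspan_plus(1) keys_nf_ge by blast
  have f0: "lookup (nf f) k = 0" if "k \<le> n" for k
  proof (rule ccontr)
    assume "lookup (nf f) k \<noteq> 0"
    then have "k \<in> keys (nf f)" by (simp add: in_keys_iff)
    then show False using f that by auto
  qed
  have "normal ?e" unfolding normal_def
  proof
    fix k show "lookup ?e k \<le> 2"
      using normal_nf[of f] f0[of k] assms(2)
      by (cases "k \<le> n") (auto simp: normal_def lookup_add lookup_single lookup_twos when_def)
  qed
  moreover have "ym (twos n + (f + delta n i)) = ym ?e"
    by (simp add: ym_add ym_nf)
  ultimately have "nf (twos n + (f + delta n i)) = ?e"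
    by (rule nf_unique)
  moreover have "?e \<noteq> twos (Suc m)"
  proof
    assume "?e = twos (Suc m)"
    then have "lookup ?e n = lookup (twos (Suc m)) n" by simp
    then show False using f0[of n] assms(2,3) by (simp add: lookup_add lookup_twos)
  qed
  ultimately have "socle_form m (ym (twos n) * (ym f * y_C n ^ i)) = 0"
    by (simp add: socle_form_def coef_ym flip: ym_delta ym_add)
  then show ?case using mspan_plus.IH by (simp add: distrib_left distrib_right socle_form_add)
qed simp

lemma socle_form_top_component:
  assumes "w0 \<in> tail (Suc n)" "w1 \<in> tail (Suc n)" "n \<le> m"
  shows "socle_form m (ym (twos n) * (w0 + w1 * y_C n + w2 * y_C n ^ 2)) =
    socle_form m (ym (twos (Suc n)) * w2)"
  using socle_form_low_power[OF assms(1) _ assms(3), of 0]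
    socle_form_low_power[OF assms(2) _ assms(3), of 1]
  by (simp add: distrib_left socle_form_add twos_Suc ym_add ym_delta ac_simps)

text \<open>Perfectness of the form \<open>(u, v) \<mapsto> socle_form m (u * v)\<close> on the truncation, by descending
  induction along the tower. With respect to the basis \<open>1, y\<^sub>n, y\<^sub>n\<^sup>2\<close> over the next subring, the
  component at \<open>y\<^sub>n\<^sup>2\<close> of \<open>c * u\<close>, \<open>c * u * y\<^sub>n\<close> and \<open>c * u * y\<^sub>n\<^sup>2\<close> is \<open>c\<^sub>2 * u\<close>, \<open>c\<^sub>1 * u\<close> and
  \<open>(c\<^sub>0 + c\<^sub>2 * y\<^sub>n\<^sub>+\<^sub>1) * u\<close>, so the three components of a representing element can be read off from
  representing elements of three functionals on the next subring.\<close>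

lemma socle_form_represents_tail:
  assumes "n \<le> Suc m" "\<And>u v. lam (u + v) = lam u + lam v" "\<And>u. u \<in> high m \<Longrightarrow> lam u = 0"
  shows "\<exists>c\<in>tail n. \<forall>u\<in>tail n. lam u = socle_form m (ym (twos n) * (c * u))"
  using assms
proof (induction n arbitrary: lam rule: inc_induct)
  case base
  define c :: ringC where "c = of_bit (lam 1)"
  have lam0: "lam 0 = 0" using base(2)[of 0] by simp
  have "lam u = socle_form m (ym (twos (Suc m)) * (c * u))" if "u \<in> tail (Suc m)" for u
    using that unfolding tail_def
  proof (induction rule: mspan.induct)
    case mspan_0
    then show ?case by (simp add: lam0)
  next
    case (mspan_plus e u)
    have "lam (ym e) = socle_form m (ym (twos (Suc m)) * (c * ym e))"
    proof (cases "e = 0")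
      case True
      then show ?thesis
        by (cases "lam 1") (simp_all add: c_def socle_form_def coef_ym nf_normal normal_twos)
    next
      case False
      then obtain i where "i \<in> keys e" by (metis ex_in_conv keys_eq_empty)
      moreover from this have "m < i" using mspan_plus(1) by auto
      ultimately have "ym e \<in> high m"
          using mspan_plus(1) unfolding high_def by (intro mspan_ym) blast
      then show ?thesis by (simp add: base(2) high_mult socle_form_high)
    qed
    then show ?case using mspan_plus.IH by (simp add: base(1) distrib_left socle_form_add)
  qed
  moreover have "c \<in> tail (Suc m)" by (simp add: c_def)
  ultimately show ?case by blast
next
  case (step n)
  have n: "n \<le> m" using step(2) by simp
  let ?y = "y_C n"
  let ?z = "y_C (Suc n)"
  have "\<exists>c\<in>tail (Suc n). \<forall>u\<in>tail (Suc n).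
      lam (u * ?y ^ i) = socle_form m (ym (twos (Suc n)) * (c * u))" for i
  proof (rule step.IH)
    show "lam ((u + v) * ?y ^ i) = lam (u * ?y ^ i) + lam (v * ?y ^ i)" for u v
      by (simp only: distrib_right step.prems(1))
    show "lam (u * ?y ^ i) = 0" if "u \<in> high m" for u
      using high_mult[OF that, of "?y ^ i"] step.prems(2) by (simp only: mult.commute)
  qed
  then obtain c where c: "\<And>i. c i \<in> tail (Suc n)"
    "\<And>i u. u \<in> tail (Suc n) \<Longrightarrow> lam (u * ?y ^ i) = socle_form m (ym (twos (Suc n)) * (c i * u))"
    by metis
  define d where "d = (c 2 + c 0 * ?z) + c 1 * ?y + c 0 * ?y ^ 2"
  have z: "?z \<in> tail (Suc n)" by (rule tail_y) simp
  have "y_C n \<in> tail n" and up: "\<And>v. v \<in> tail (Suc n) \<Longrightarrow> v \<in> tail n"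
    using tail_y[of n n] by (auto simp: tail_iff_supp intro: Suc_leD)
  then have "d \<in> tail n"
    unfolding d_def by (intro tail_add tail_mult tail_power) (auto intro: up c(1) z)
  moreover have "lam u = socle_form m (ym (twos n) * (d * u))" if "u \<in> tail n" for u
  proof -
    obtain u0 u1 u2 where u: "u0 \<in> tail (Suc n)" "u1 \<in> tail (Suc n)" "u2 \<in> tail (Suc n)"
      "u = u0 + u1 * ?y + u2 * ?y ^ 2"
      using \<open>u \<in> tail n\<close> by (rule tail_decompose)
    have "d * u = (c 2 + c 0 * ?z) * u0
        + ((c 2 + c 0 * ?z) * u1 + c 1 * u0 + (c 1 * u2 + c 0 * u1) * ?z) * ?y
        + (c 0 * u0 + c 1 * u1 + c 2 * u2) * ?y ^ 2"
      unfolding d_def u(4)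
      by (simp add: algebra_simps power2_eq_square y_cubed_mult y_cubed_mult_left)
    then have "socle_form m (ym (twos n) * (d * u)) =
        socle_form m (ym (twos (Suc n)) * (c 0 * u0 + c 1 * u1 + c 2 * u2))"
      using u c(1) z n by (simp only: socle_form_top_component tail_add tail_mult)
    also have "\<dots> = lam (u0 * ?y ^ 0) + lam (u1 * ?y ^ 1) + lam (u2 * ?y ^ 2)"
      by (simp only: distrib_left socle_form_add c(2) u)
    also have "\<dots> = lam u"
      by (simp add: u(4) step.prems(1))
    finally show ?thesis by simp
  qed
  ultimately show ?case by blast
qed

lemma socle_form_represents:
  assumes "\<And>u v. lam (u + v) = lam u + lam v" "\<And>u. u \<in> high m \<Longrightarrow> lam u = 0"
  obtains c where "\<And>u. lam u = socle_form m (c * u)"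
  using socle_form_represents_tail[of 0 m lam, OF _ assms] by (auto simp: twos_def)

text \<open>A nonzero element of the truncation is detected by a coefficient, and coefficients are
  represented by the form.\<close>

lemma socle_form_nondegenerate:
  assumes "\<And>u. socle_form m (c * u) = 0" shows "c \<in> high m"
proof (rule ccontr)
  assume "c \<notin> high m"
  then obtain w where w: "coef w c = 1" "keys w \<subseteq> {..m}"
    unfolding high_iff_supp by (force simp: supp_def)
  obtain d where d: "\<And>u. coef w u = socle_form m (d * u)"
    by (rule socle_form_represents[of "coef w" m]) (auto simp: coef_add coef_high w(2))
  show False using d[of c] assms[of d] w(1) by (simp add: mult.commute)
qed

section \<open>Annihilators of powers of the lowest variable\<close>

lemma y_mult_x: "y_C n * x_C (Suc n) = 0"
  by (simp add: distrib_left power2_eq_square y_cubed_mult mult.commute)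

lemma y_odd_power: "y_C n ^ (2 * j + 1) = y_C (Suc n) ^ j * y_C n"
proof (induction j)
  case (Suc j)
  have "y_C n ^ (2 * Suc j + 1) = y_C n ^ 2 * y_C n ^ (2 * j + 1)"
    by (simp add: power2_eq_square ac_simps)
  also have "\<dots> = y_C (Suc n) ^ j * (y_C n * (y_C n * y_C n))"
    unfolding Suc by (simp add: power2_eq_square ac_simps)
  finally show ?case by (simp add: y_cubed_mult ac_simps)
qed simp

lemma ideal_gen_mono: "S \<subseteq> T \<Longrightarrow> ideal_gen S \<subseteq> ideal_gen T"
  unfolding ideal_gen_def by (rule module.span_mono[OF module_times])

lemma ideal_gen_base: "a \<in> S \<Longrightarrow> a \<in> ideal_gen S"
  unfolding ideal_gen_def by (rule module.span_base[OF module_times])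

lemma module_span_image:
  assumes "module s1" "module s2" "\<And>x y. f (x + y) = f x + f y" "\<And>r x. f (s1 r x) = s2 r (f x)"
    and "d \<in> module.span s1 G"
  shows "f d \<in> module.span s2 (f ` G)"
proof -
  interpret module_hom s1 s2 f
    using assms(1-4) by (simp add: module_hom_def module_hom_axioms_def)
  show ?thesis using assms(5) span_image by blast
qed

lemma ideal_gen_image_mult: "d \<in> ideal_gen G \<Longrightarrow> r * d \<in> ideal_gen ((*) r ` G)"
  unfolding ideal_gen_def
  by (rule module_span_image[OF module_times module_times]) (simp_all add: algebra_simps)

text \<open>In terms of the basis \<open>1, y\<^sub>n, y\<^sub>n\<^sup>2\<close>, a power of \<open>y\<^sub>n\<close> kills \<open>c\<^sub>0 + c\<^sub>1 y\<^sub>n + c\<^sub>2 y\<^sub>n\<^sup>2\<close> if and only if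
  about half that power of \<open>y\<^sub>n\<^sub>+\<^sub>1\<close> kills \<open>c\<^sub>0 + c\<^sub>2 y\<^sub>n\<^sub>+\<^sub>1\<close> and \<open>c\<^sub>1\<close>, and the element equals
  \<open>(c\<^sub>0 + c\<^sub>2 y\<^sub>n\<^sub>+\<^sub>1) + c\<^sub>1 y\<^sub>n + c\<^sub>2 x\<^sub>n\<^sub>+\<^sub>1\<close>. By recursion the annihilator is finitely generated, and since the
  decomposition is compatible with truncation, the same generators work modulo \<open>high m\<close>. The
  recursion moves up one variable at a time, at most \<open>k\<close> times, so \<open>m \<ge> n + k\<close> is deep enough.\<close>

lemma ann_y_power:
  "\<exists>G. finite G \<and> (\<forall>g\<in>G. y_C n ^ k * g = 0) \<and>
    (\<forall>m\<ge>n + k. \<forall>c\<in>tail n. y_C n ^ k * c \<in> high m \<longrightarrow> (\<exists>d\<in>ideal_gen G. c + d \<in> high m))"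
proof (induction k arbitrary: n rule: less_induct)
  case (less k)
  let ?y = "y_C n"
  let ?z = "y_C (Suc n)"
  let ?x = "x_C (Suc n)"
  have z: "?z \<in> tail (Suc n)" by (rule tail_y) simp
  have zj: "?z ^ j * c \<in> tail (Suc n)" if "c \<in> tail (Suc n)" for c j
    using that z by (intro tail_mult tail_power)
  consider "k = 0" | j where "k = 2 * j + 1" | j where "k = 2 * j + 2"
    by (metis One_nat_def Suc_1 add_Suc_right add_0_right evenE oddE old.nat.exhaust even_Suc)
  then show ?case
  proof cases
    case 1
    then show ?thesis by (intro exI[of _ "{}"]) (auto intro: bexI[of _ 0] ideal_gen_0)
  next
    case 2
    have pow: "?y ^ k = ?z ^ j * ?y" unfolding 2 by (rule y_odd_power)
    obtain G where G: "finite G" "\<And>g. g \<in> G \<Longrightarrow> ?z ^ j * g = 0"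
      "\<And>m c. m \<ge> Suc n + j \<Longrightarrow> c \<in> tail (Suc n) \<Longrightarrow> ?z ^ j * c \<in> high m \<Longrightarrow>
        \<exists>d\<in>ideal_gen G. c + d \<in> high m"
      using less[of j "Suc n"] 2 by force
    have exact: "?y ^ k * g = 0" if "g \<in> insert ?x G" for g
    proof (cases "g = ?x")
      case True
      then show ?thesis unfolding pow by (simp only: mult.assoc y_mult_x) simp
    next
      case False
      then have "?z ^ j * g = 0" using that G(2) by blast
      moreover have "?y ^ k * g = ?y * (?z ^ j * g)" unfolding pow by (simp add: ac_simps)
      ultimately show ?thesis by simp
    qed
    have "\<exists>d\<in>ideal_gen (insert ?x G). c + d \<in> high m"
      if m: "m \<ge> n + k" and c: "c \<in> tail n" and yc: "?y ^ k * c \<in> high m" for m c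
    proof -
      obtain c0 c1 c2 where cs: "c0 \<in> tail (Suc n)" "c1 \<in> tail (Suc n)" "c2 \<in> tail (Suc n)"
        "c = c0 + c1 * ?y + c2 * ?y ^ 2"
        using c by (rule tail_decompose)
      have "?y * c = 0 + (c0 + c2 * ?z) * ?y + c1 * ?y ^ 2"
        using y_cubed_mult[of n] by (simp add: cs(4) power2_eq_square algebra_simps)
      then have "?y ^ k * c = 0 + (?z ^ j * (c0 + c2 * ?z)) * ?y + (?z ^ j * c1) * ?y ^ 2"
        unfolding pow mult.assoc by (simp add: algebra_simps)
      with yc have "0 + (?z ^ j * (c0 + c2 * ?z)) * ?y + (?z ^ j * c1) * ?y ^ 2 \<in> high m"
        by (simp only:)
      moreover have "?z ^ j * (c0 + c2 * ?z) \<in> tail (Suc n)" "?z ^ j * c1 \<in> tail (Suc n)"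
        by (intro zj tail_add tail_mult cs z)+
      moreover have "n \<le> m" using m by simp
      ultimately have hi: "?z ^ j * (c0 + c2 * ?z) \<in> high m" "?z ^ j * c1 \<in> high m"
        using high_components(2,3)[OF tail_zero] by blast+
      obtain d0 where d0: "d0 \<in> ideal_gen G" "c0 + c2 * ?z + d0 \<in> high m"
        using G(3)[of m "c0 + c2 * ?z"] hi(1) m 2 cs z by (auto intro: tail_add tail_mult)
      obtain d1 where d1: "d1 \<in> ideal_gen G" "c1 + d1 \<in> high m"
        using G(3)[of m c1] hi(2) m 2 cs by auto
      have "c2 * ?x + (d0 + ?y * d1) \<in> ideal_gen (insert ?x G)"
        using d0(1) d1(1) ideal_gen_mono[of G "insert ?x G"] ideal_gen_base[of ?x "insert ?x G"]
        by (meson ideal_gen_add ideal_gen_mult insertI1 subsetD subset_insertI)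
      moreover have "c + (c2 * ?x + (d0 + ?y * d1)) = (c0 + c2 * ?z + d0) + ?y * (c1 + d1)"
        by (simp add: cs(4) algebra_simps)
      ultimately show ?thesis using d0(2) d1(2) by (metis high_add high_mult)
    qed
    then show ?thesis using G(1) exact by (intro exI[of _ "insert ?x G"]) blast
  next
    case 3
    have pow: "?y ^ k = ?z ^ j * ?y ^ 2"
      unfolding 3 using y_odd_power[of n j] by (simp add: power2_eq_square ac_simps)
    have pow': "?y ^ k * ?y = ?z ^ (j + 1) * ?y"
      unfolding 3 using y_odd_power[of n "j + 1"] by (simp add: ac_simps)
    obtain G where G: "finite G" "\<And>g. g \<in> G \<Longrightarrow> ?z ^ j * g = 0"
      "\<And>m c. m \<ge> Suc n + j \<Longrightarrow> c \<in> tail (Suc n) \<Longrightarrow> ?z ^ j * c \<in> high m \<Longrightarrow>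
        \<exists>d\<in>ideal_gen G. c + d \<in> high m"
      using less[of j "Suc n"] 3 by force
    obtain H where H: "finite H" "\<And>g. g \<in> H \<Longrightarrow> ?z ^ (j + 1) * g = 0"
      "\<And>m c. m \<ge> Suc n + (j + 1) \<Longrightarrow> c \<in> tail (Suc n) \<Longrightarrow> ?z ^ (j + 1) * c \<in> high m \<Longrightarrow>
        \<exists>d\<in>ideal_gen H. c + d \<in> high m"
      using less[of "j + 1" "Suc n"] 3 by force
    let ?G = "insert ?x (G \<union> (*) ?y ` H)"
    have exact: "?y ^ k * g = 0" if g: "g \<in> ?G" for g
    proof -
      consider "g = ?x" | "g \<in> G" | h where "h \<in> H" "g = ?y * h" using g by blast
      then show ?thesis
      proof cases
        case 1
        have "?y ^ k * g = ?z ^ j * ?y * (?y * ?x)"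
          unfolding pow 1 by (simp add: power2_eq_square mult.assoc del: x_C.simps)
        then show ?thesis unfolding y_mult_x by simp
      next
        case 2
        have "?y ^ k * g = ?y ^ 2 * (?z ^ j * g)" unfolding pow by (simp add: ac_simps)
        then show ?thesis using G(2)[OF 2] by simp
      next
        case 3
        then have "?y ^ k * g = ?y * (?z ^ (j + 1) * h)"
          using pow' by (metis mult.assoc mult.commute)
        then show ?thesis using H(2)[OF 3(1)] by simp
      qed
    qed
    have "\<exists>d\<in>ideal_gen ?G. c + d \<in> high m"
      if m: "m \<ge> n + k" and c: "c \<in> tail n" and yc: "?y ^ k * c \<in> high m" for m c
    proof -
      obtain c0 c1 c2 where cs: "c0 \<in> tail (Suc n)" "c1 \<in> tail (Suc n)" "c2 \<in> tail (Suc n)"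
        "c = c0 + c1 * ?y + c2 * ?y ^ 2"
        using c by (rule tail_decompose)
      have "?y ^ 2 * c = 0 + (?z * c1) * ?y + (c0 + c2 * ?z) * ?y ^ 2"
        using y_cubed_mult[of n] by (simp add: cs(4) power2_eq_square algebra_simps)
      then have "?y ^ k * c = 0 + (?z ^ (j + 1) * c1) * ?y + (?z ^ j * (c0 + c2 * ?z)) * ?y ^ 2"
        unfolding pow mult.assoc by (simp add: algebra_simps)
      with yc have "0 + (?z ^ (j + 1) * c1) * ?y + (?z ^ j * (c0 + c2 * ?z)) * ?y ^ 2 \<in> high m"
        by (simp only:)
      moreover have "?z ^ (j + 1) * c1 \<in> tail (Suc n)" "?z ^ j * (c0 + c2 * ?z) \<in> tail (Suc n)"
        by (intro zj tail_add tail_mult cs z)+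
      moreover have "n \<le> m" using m by simp
      ultimately have hi: "?z ^ (j + 1) * c1 \<in> high m" "?z ^ j * (c0 + c2 * ?z) \<in> high m"
        using high_components(2,3)[OF tail_zero] by blast+
      obtain d0 where d0: "d0 \<in> ideal_gen G" "c0 + c2 * ?z + d0 \<in> high m"
        using G(3)[of m "c0 + c2 * ?z"] hi(2) m 3 cs z by (auto intro: tail_add tail_mult)
      obtain d1 where d1: "d1 \<in> ideal_gen H" "c1 + d1 \<in> high m"
        using H(3)[of m c1] hi(1) m 3 cs by auto
      have "c2 * ?x + (d0 + ?y * d1) \<in> ideal_gen ?G"
      proof -
        have "d0 \<in> ideal_gen ?G" "?y * d1 \<in> ideal_gen ?G" "?x \<in> ideal_gen ?G"
          using d0(1) ideal_gen_mono[of G ?G] ideal_gen_image_mult[OF d1(1), of ?y]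
            ideal_gen_mono[of "(*) ?y ` H" ?G] ideal_gen_base[of ?x ?G]
          by blast+
        then show ?thesis by (meson ideal_gen_add ideal_gen_mult)
      qed
      moreover have "c + (c2 * ?x + (d0 + ?y * d1)) = (c0 + c2 * ?z + d0) + ?y * (c1 + d1)"
        by (simp add: cs(4) algebra_simps)
      ultimately show ?thesis using d0(2) d1(2) by (metis high_add high_mult)
    qed
    then show ?thesis using G(1) H(1) exact by (intro exI[of _ ?G]) blast
  qed
qed

section \<open>Homogeneous linear systems over C\<close>

lemma module_free_scale: "module (free_scale :: 'r::comm_ring_1 \<Rightarrow> _)"
  by unfold_locales (simp_all add: free_scale_def fun_eq_iff algebra_simps)

abbreviation vec_span :: "(nat \<Rightarrow> ringC) set \<Rightarrow> (nat \<Rightarrow> ringC) set" where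
  "vec_span \<equiv> module.span free_scale"

definition row :: "(nat \<Rightarrow> nat \<Rightarrow> ringC) \<Rightarrow> nat set \<Rightarrow> nat \<Rightarrow> (nat \<Rightarrow> ringC) \<Rightarrow> ringC" where
  "row a S i c = (\<Sum>j\<in>S. a i j * c j)"

lemma row_cong: "(\<And>j. j \<in> S \<Longrightarrow> c j = d j) \<Longrightarrow> row a S i c = row a S i d"
  by (simp add: row_def)

lemma tail_row:
  assumes "\<And>j. j \<in> S \<Longrightarrow> a i j \<in> tail n" "\<And>j. j \<in> S \<Longrightarrow> c j \<in> tail n"
  shows "row a S i c \<in> tail n"
  unfolding row_def using assms
  by (induction S rule: infinite_finite_induct) (auto intro!: tail_add tail_mult)

text \<open>The point is that \<open>G\<close> is independent of \<open>m\<close> and consists of exact solutions: modulo each deep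
  truncation ideal, approximate solutions are then consequences of exact ones.\<close>

definition stable_syzygies :: "nat \<Rightarrow> nat set \<Rightarrow> nat set \<Rightarrow> (nat \<Rightarrow> nat \<Rightarrow> ringC) \<Rightarrow> bool" where
  "stable_syzygies n R S a \<longleftrightarrow> (\<exists>G m0. finite G \<and> (\<forall>g\<in>G. \<forall>i\<in>R. row a S i g = 0) \<and>
     (\<forall>m\<ge>m0. \<forall>c. (\<forall>j\<in>S. c j \<in> tail n) \<longrightarrow> (\<forall>i\<in>R. row a S i c \<in> high m) \<longrightarrow>
        (\<exists>d\<in>vec_span G. \<forall>j\<in>S. c j + d j \<in> high m)))"

subsection \<open>Systems whose coefficients are powers of one variable\<close>

text \<open>The homogeneous elements of degree \<open>d\<close> in the polynomial ring \<open>F[y\<^sub>N]\<close>.\<close>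

definition power_entry :: "nat \<Rightarrow> int \<Rightarrow> ringC \<Rightarrow> bool" where
  "power_entry N d u \<longleftrightarrow> u = 0 \<or> (\<exists>k. u = y_C N ^ k \<and> int (k * 2 ^ N) = d)"

lemma power_entry_add: "power_entry N d u \<Longrightarrow> power_entry N d v \<Longrightarrow> power_entry N d (u + v)"
  unfolding power_entry_def by auto

lemma power_entry_mult: "power_entry N d u \<Longrightarrow> power_entry N d' v \<Longrightarrow> power_entry N (d + d') (u * v)"
  unfolding power_entry_def by (force simp flip: power_add simp: algebra_simps)

lemma power_entry_divide:
  assumes "power_entry N d u" "u \<noteq> 0 \<Longrightarrow> int (k * 2 ^ N) \<le> d"
  shows "\<exists>q. u = q * y_C N ^ k \<and> power_entry N (d - int (k * 2 ^ N)) q"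
proof (cases "u = 0")
  case True
  then show ?thesis by (intro exI[of _ 0]) (simp add: power_entry_def)
next
  case False
  then obtain l where l: "u = y_C N ^ l" "int (l * 2 ^ N) = d"
    using assms(1) by (auto simp: power_entry_def)
  then have "int (k * 2 ^ N) \<le> int (l * 2 ^ N)" using assms(2) False by simp
  then have "k \<le> l" unfolding of_nat_le_iff by simp
  then have "u = y_C N ^ (l - k) * y_C N ^ k" "int ((l - k) * 2 ^ N) = d - int (k * 2 ^ N)"
    using l by (simp_all flip: power_add l(2) add: of_nat_diff algebra_simps)
  then show ?thesis unfolding power_entry_def by blast
qed

lemma power_entry_tail: "power_entry N d u \<Longrightarrow> u \<in> tail N"
  unfolding power_entry_def by (auto intro: tail_power tail_y)

lemma stable_syzygies_zero:
  assumes "finite S" "\<And>i j. i \<in> R \<Longrightarrow> j \<in> S \<Longrightarrow> a i j = 0"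
  shows "stable_syzygies n R S a"
proof -
  define unit :: "nat \<Rightarrow> nat \<Rightarrow> ringC" where "unit j = (\<lambda>l. if l = j then 1 else 0)" for j
  have "\<exists>d\<in>vec_span (unit ` S). \<forall>j\<in>S. c j + d j \<in> high m" for c m
  proof
    let ?d = "\<Sum>j\<in>S. free_scale (c j) (unit j)"
    show "?d \<in> vec_span (unit ` S)"
      by (intro module.span_sum[OF module_free_scale] module.span_scale[OF module_free_scale]
          module.span_base[OF module_free_scale]) auto
    have "?d l = (\<Sum>j\<in>S. if l = j then c j else 0)" for l
      using assms(1) by (induction S) (auto simp: free_scale_def unit_def)
    then show "\<forall>j\<in>S. c j + ?d j \<in> high m"
      using assms(1) by simp
  qed
  moreover have "row a S i g = 0" if "i \<in> R" for g i
    unfolding row_def using assms(2)[OF that] by simp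
  ultimately show ?thesis
    unfolding stable_syzygies_def using assms(1) by (intro exI[of _ "unit ` S"]) auto
qed

text \<open>Elimination with a pivot \<open>y\<^sup>k\<close> of least degree, in row \<open>i0\<close> and column \<open>j0\<close>. By homogeneity it
  divides its row and its column. The equation of its row becomes \<open>y\<^sup>k (c j0 + \<Sum>l. q l * c l) = 0\<close>,
  which the annihilator of \<open>y\<^sup>k\<close> solves; the other unknowns satisfy a smaller system of the same
  kind.\<close>

lemma stable_syzygies_powers:
  assumes "finite S" "\<And>i j. i \<in> R \<Longrightarrow> j \<in> S \<Longrightarrow> power_entry N (al i - be j) (a i j)"
  shows "stable_syzygies N R S a"
  using assms
proof (induction "card S" arbitrary: R S a rule: less_induct)
  case less
  show ?case
  proof (cases "\<forall>i\<in>R. \<forall>j\<in>S. a i j = 0")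
    case True
    then show ?thesis using less.prems(1) by (intro stable_syzygies_zero) auto
  next
    case False
    define P where "P = (\<lambda>(i, j). i \<in> R \<and> j \<in> S \<and> a i j \<noteq> 0)"
    from False obtain p where "P p" by (auto simp: P_def)
    then obtain p0 where "P p0" and least: "\<And>p. P p \<Longrightarrow>
        nat (al (fst p0) - be (snd p0)) \<le> nat (al (fst p) - be (snd p))"
      using ex_has_least_nat[of P p "\<lambda>p. nat (al (fst p) - be (snd p))"] by auto
    define i0 where "i0 = fst p0"
    define j0 where "j0 = snd p0"
    have i0: "i0 \<in> R" and j0: "j0 \<in> S" and nz: "a i0 j0 \<noteq> 0"
      using \<open>P p0\<close> by (auto simp: P_def i0_def j0_def split: prod.splits)
    obtain k where k: "a i0 j0 = y_C N ^ k" "int (k * 2 ^ N) = al i0 - be j0"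
      using less.prems(2)[OF i0 j0] nz by (auto simp: power_entry_def)
    have min: "int (k * 2 ^ N) \<le> al i - be j" if ij: "i \<in> R" "j \<in> S" "a i j \<noteq> 0" for i j
    proof -
      obtain l where "int (l * 2 ^ N) = al i - be j"
        using less.prems(2)[OF ij(1,2)] ij(3) by (auto simp: power_entry_def)
      then have "0 \<le> al i - be j" by (metis of_nat_0_le_iff)
      moreover have "nat (al i0 - be j0) \<le> nat (al i - be j)"
        using least[of "(i, j)"] that by (simp add: P_def i0_def j0_def)
      ultimately show ?thesis unfolding k(2) by linarith
    qed
    let ?S = "S - {j0}"
    let ?R = "R - {i0}"
    have fin: "finite ?S" using less.prems(1) by simp
    have "\<exists>q. a i0 j = q * y_C N ^ k \<and> power_entry N (be j0 - be j) q" if "j \<in> S" for j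
      using power_entry_divide[OF less.prems(2)[OF i0 that] min[OF i0 that]] k(2) by simp
    then obtain q where q: "\<And>j. j \<in> S \<Longrightarrow> a i0 j = q j * y_C N ^ k"
      "\<And>j. j \<in> S \<Longrightarrow> power_entry N (be j0 - be j) (q j)" by metis
    have "\<exists>p. a i j0 = p * y_C N ^ k \<and> power_entry N (al i - al i0) p" if "i \<in> R" for i
      using power_entry_divide[OF less.prems(2)[OF that j0] min[OF that j0]] k(2) by simp
    then obtain p where p: "\<And>i. i \<in> R \<Longrightarrow> a i j0 = p i * y_C N ^ k"
      "\<And>i. i \<in> R \<Longrightarrow> power_entry N (al i - al i0) (p i)" by metis
    \<comment> \<open>The rows after clearing the pivot column; subtraction is addition in characteristic 2.\<close>
    define a' where "a' i j = a i j + p i * a i0 j" for i j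
    have "power_entry N (al i - be j) (a' i j)" if "i \<in> ?R" "j \<in> ?S" for i j
    proof -
      have "power_entry N ((al i - al i0) + (al i0 - be j)) (p i * a i0 j)"
        by (rule power_entry_mult) (use that i0 p(2) less.prems(2) in auto)
      then have "power_entry N (al i - be j) (p i * a i0 j)" by simp
      then show ?thesis unfolding a'_def
        by (intro power_entry_add less.prems(2)) (use that in auto)
    qed
    moreover have "card ?S < card S"
      using less.prems(1) j0 by (meson card_Diff1_less)
    ultimately have "stable_syzygies N ?R ?S a'"
      using less.hyps[of ?S ?R a'] fin by blast
    then obtain G m1 where G: "finite G" "\<And>g i. g \<in> G \<Longrightarrow> i \<in> ?R \<Longrightarrow> row a' ?S i g = 0"
      and G_gen: "\<And>m c. m \<ge> m1 \<Longrightarrow> (\<And>j. j \<in> ?S \<Longrightarrow> c j \<in> tail N) \<Longrightarrow>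
        (\<And>i. i \<in> ?R \<Longrightarrow> row a' ?S i c \<in> high m) \<Longrightarrow>
        \<exists>d\<in>vec_span G. \<forall>j\<in>?S. c j + d j \<in> high m"
      unfolding stable_syzygies_def by metis
    obtain H where H: "finite H" "\<And>h. h \<in> H \<Longrightarrow> y_C N ^ k * h = 0"
      and H_gen: "\<And>m c. m \<ge> N + k \<Longrightarrow> c \<in> tail N \<Longrightarrow> y_C N ^ k * c \<in> high m \<Longrightarrow>
        \<exists>d\<in>ideal_gen H. c + d \<in> high m"
      using ann_y_power[of N k] by metis
    \<comment> \<open>Solutions of the smaller system extend by solving the pivot row for the unknown \<open>j0\<close>; to these
      one adds the vectors concentrated at \<open>j0\<close> that the pivot annihilates.\<close>
    define qsum where "qsum c = (\<Sum>l\<in>?S. q l * c l)" for c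
    define ext where "ext g = (\<lambda>j. if j = j0 then qsum g else g j)" for g
    define unit where "unit u = (\<lambda>j. if j = j0 then u else (0::ringC))" for u
    have qsum_cong: "qsum c = qsum d" if "\<And>j. j \<in> ?S \<Longrightarrow> c j = d j" for c d
      unfolding qsum_def using that by (intro sum.cong) auto
    have row_split: "row a S i c = a i j0 * c j0 + row a ?S i c" for i c
      unfolding row_def by (rule sum.remove[OF less.prems(1) j0])
    have row_i0: "row a S i0 c = y_C N ^ k * (c j0 + qsum c)" for c
    proof -
      have "row a ?S i0 c = y_C N ^ k * qsum c"
        unfolding row_def qsum_def sum_distrib_left
        by (rule sum.cong) (simp_all add: q(1) ac_simps)
      then show ?thesis by (simp add: row_split k(1) distrib_left)
    qed
    have row_i: "row a S i c = p i * row a S i0 c + row a' ?S i c" if "i \<in> R" for i c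
    proof -
      have "row a' ?S i c = row a ?S i c + p i * row a ?S i0 c"
        unfolding row_def a'_def sum_distrib_left sum.distrib[symmetric]
        by (rule sum.cong) (simp_all add: algebra_simps)
      then show ?thesis
        using p(1)[OF that] by (simp add: row_split[of i] row_split[of i0] k(1) algebra_simps)
    qed
    have ext_exact: "row a S i (ext g) = 0" if g: "g \<in> G" and i: "i \<in> R" for g i
    proof -
      have "qsum (ext g) = qsum g" by (rule qsum_cong) (simp add: ext_def)
      then have i0_0: "row a S i0 (ext g) = 0" unfolding row_i0 by (simp add: ext_def)
      have "row a' ?S i (ext g) = row a' ?S i g" by (rule row_cong) (simp add: ext_def)
      then show ?thesis
        using row_i[OF i, of "ext g"] i0_0 G(2)[OF g, of i] i by (cases "i = i0") auto
    qed
    have unit_exact: "row a S i (unit u) = 0" if u: "u \<in> H" and i: "i \<in> R" for u i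
    proof -
      have "qsum (unit u) = 0" unfolding qsum_def by (rule sum.neutral) (simp add: unit_def)
      then have i0_0: "row a S i0 (unit u) = 0"
        unfolding row_i0 using H(2)[OF u] by (simp add: unit_def)
      have "row a' ?S i (unit u) = 0"
        unfolding row_def by (rule sum.neutral) (simp add: unit_def)
      then show ?thesis using row_i[OF i, of "unit u"] i0_0 by simp
    qed
    have gen: "\<exists>d\<in>vec_span (ext ` G \<union> unit ` H). \<forall>j\<in>S. c j + d j \<in> high m"
      if m: "m \<ge> max m1 (N + k)" and c: "\<And>j. j \<in> S \<Longrightarrow> c j \<in> tail N"
        and row: "\<And>i. i \<in> R \<Longrightarrow> row a S i c \<in> high m" for m c
    proof -
      have "row a' ?S i c \<in> high m" if "i \<in> ?R" for i
      proof -
        have "row a' ?S i c = row a S i c + p i * row a S i0 c"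
          using row_i[of i c] that by (simp add: add.assoc[symmetric] add.commute)
        then show ?thesis using row[OF i0] row[of i] that by (auto intro: high_add high_mult)
      qed
      then obtain d where d: "d \<in> vec_span G" "\<And>j. j \<in> ?S \<Longrightarrow> c j + d j \<in> high m"
        using G_gen[of m c] m c by auto
      have "qsum c \<in> tail N"
        using tail_row[of ?S "\<lambda>_. q" 0 N c] q(2) c
        by (auto simp: qsum_def row_def intro: power_entry_tail)
      then obtain e where e: "e \<in> ideal_gen H" "c j0 + qsum c + e \<in> high m"
        using H_gen[of m "c j0 + qsum c"] m c[OF j0] row[OF i0] by (auto simp: row_i0 intro: tail_add)
      have "ext d \<in> vec_span (ext ` G)"
        using module_free_scale module_free_scale _ _ d(1)
        by (rule module_span_image)
          (auto simp: ext_def qsum_def free_scale_def fun_eq_iff distrib_left sum.distrib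
            sum_distrib_left ac_simps)
      moreover have "unit e \<in> vec_span (unit ` H)"
        using module_times module_free_scale _ _ e(1)[unfolded ideal_gen_def]
        by (rule module_span_image) (auto simp: unit_def free_scale_def fun_eq_iff)
      ultimately have "ext d + unit e \<in> vec_span (ext ` G \<union> unit ` H)"
        using module.span_mono[OF module_free_scale, of "ext ` G" "ext ` G \<union> unit ` H"]
          module.span_mono[OF module_free_scale, of "unit ` H" "ext ` G \<union> unit ` H"]
        by (intro module.span_add[OF module_free_scale]) auto
      moreover have "c j + (ext d + unit e) j \<in> high m" if "j \<in> S" for j
      proof (cases "j = j0")
        case True
        have "qsum c + qsum d = (\<Sum>l\<in>?S. q l * (c l + d l))"
          by (simp add: qsum_def distrib_left sum.distrib)
        also have "\<dots> \<in> high m" using d(2) by (intro high_sum high_mult)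
        finally have "(c j0 + qsum c + e) + (qsum c + qsum d) \<in> high m"
          by (rule high_add[OF e(2)])
        then show ?thesis by (simp add: True ext_def unit_def ac_simps)
      next
        case False
        then show ?thesis using d(2)[of j] that by (simp add: ext_def unit_def)
      qed
      ultimately show ?thesis by blast
    qed
    show ?thesis
      unfolding stable_syzygies_def
      using G(1) H(1) ext_exact unit_exact gen
      by (intro exI[of _ "ext ` G \<union> unit ` H"] exI[of _ "max m1 (N + k)"]) blast
  qed
qed

subsection \<open>Descent along the tower\<close>

text \<open>The matrix of multiplication by \<open>a 0 + a 1 y + a 2 y\<^sup>2\<close> in the basis \<open>1, y, y\<^sup>2\<close>, where
  \<open>y\<^sup>3 = z y\<close>.\<close>

definition mult_block :: "ringC \<Rightarrow> (nat \<Rightarrow> ringC) \<Rightarrow> nat \<Rightarrow> nat \<Rightarrow> ringC" where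
  "mult_block z a e f =
    (if e = 0 then (if f = 0 then a 0 else 0)
     else if f = 0 then a e
     else if e = f then a 0 + z * a 2
     else if e < f then z * a 1 else a 1)"

text \<open>Unknowns and equations of the tripled system are numbered \<open>3 * j + e\<close>, for the component of the
  \<open>j\<close>-th one at \<open>y\<^sup>e\<close>.\<close>

definition triple :: "ringC \<Rightarrow> (nat \<Rightarrow> nat \<Rightarrow> nat \<Rightarrow> ringC) \<Rightarrow> nat \<Rightarrow> nat \<Rightarrow> ringC" where
  "triple z A i j = mult_block z (\<lambda>e. A e (i div 3) (j div 3)) (i mod 3) (j mod 3)"

lemma sum_triple:
  fixes s :: nat
  shows "(\<Sum>j<3 * s. f j) = (\<Sum>j<s. f (3 * j) + f (3 * j + 1) + f (3 * j + 2))"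
proof (induction s)
  case (Suc s)
  have "3 * Suc s = Suc (Suc (Suc (3 * s)))" by simp
  then have "(\<Sum>j<3 * Suc s. f j) = (\<Sum>j<3 * s. f j) + (f (3 * s) + f (3 * s + 1) + f (3 * s + 2))"
    by (simp only: sum.lessThan_Suc) (simp add: add.assoc)
  then show ?case by (simp only: Suc sum.lessThan_Suc)
qed simp

definition fold3 :: "ringC \<Rightarrow> (nat \<Rightarrow> ringC) \<Rightarrow> nat \<Rightarrow> ringC" where
  "fold3 y g j = g (3 * j) + g (3 * j + 1) * y + g (3 * j + 2) * y ^ 2"

lemma div_mod_triple: "(3 * i) div 3 = i" "(3 * i) mod 3 = 0" "(3 * i + 1) div 3 = i"
  "(3 * i + 1) mod 3 = 1" "(3 * i + 2) div 3 = i" "(3 * i + 2) mod 3 = 2" for i :: nat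
  by presburger+

lemma row_fold3:
  fixes s :: nat
  assumes "\<And>j. j < s \<Longrightarrow> a i j = A 0 i j + A 1 i j * y_C n + A 2 i j * y_C n ^ 2"
  shows "row a {..<s} i (fold3 (y_C n) g) =
    fold3 (y_C n) (\<lambda>i. row (triple (y_C (Suc n)) A) {..<3 * s} i g) i"
proof -
  let ?y = "y_C n"
  let ?z = "y_C (Suc n)"
  let ?T = "triple ?z A"
  let ?t = "\<lambda>i j. ?T i (3 * j) * g (3 * j) + ?T i (3 * j + 1) * g (3 * j + 1)
      + ?T i (3 * j + 2) * g (3 * j + 2)"
  have "a i j * fold3 ?y g j = ?t (3 * i) j + ?t (3 * i + 1) j * ?y + ?t (3 * i + 2) j * ?y ^ 2"
    if "j < s" for j
    unfolding assms[OF that] fold3_def triple_def div_mod_triple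
    by (simp add: mult_block_def algebra_simps power2_eq_square y_cubed_mult y_cubed_mult_left)
  then have "row a {..<s} i (fold3 ?y g) =
      (\<Sum>j<s. ?t (3 * i) j + ?t (3 * i + 1) j * ?y + ?t (3 * i + 2) j * ?y ^ 2)"
    unfolding row_def by (intro sum.cong) auto
  also have "\<dots> = fold3 ?y (\<lambda>i. row ?T {..<3 * s} i g) i"
    unfolding fold3_def row_def sum_triple
    by (simp only: sum.distrib sum_distrib_right distrib_right)
  finally show ?thesis .
qed

lemma tail_triple:
  assumes "\<And>e. e \<le> 2 \<Longrightarrow> A e (i div 3) (j div 3) \<in> tail (Suc n)"
  shows "triple (y_C (Suc n)) A i j \<in> tail (Suc n)"
proof -
  have "i mod 3 \<le> 2" by linarith
  then show ?thesis
    unfolding triple_def mult_block_def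
    by (auto intro!: tail_add tail_mult tail_y assms)
qed

text \<open>Splitting unknowns and equations into components turns a system over \<open>tail n\<close> into one over
  \<open>tail (Suc n)\<close>. Exact solutions can be reassembled, and by freeness modulo \<open>high m\<close> so can
  approximate ones.\<close>

lemma stable_syzygies_descend:
  fixes s t :: nat
  assumes A: "\<And>e i j. i < t \<Longrightarrow> j < s \<Longrightarrow> e \<le> 2 \<Longrightarrow> A e i j \<in> tail (Suc n)"
    and a: "\<And>i j. i < t \<Longrightarrow> j < s \<Longrightarrow> a i j = A 0 i j + A 1 i j * y_C n + A 2 i j * y_C n ^ 2"
    and stable: "stable_syzygies (Suc n) {..<3 * t} {..<3 * s} (triple (y_C (Suc n)) A)"
  shows "stable_syzygies n {..<t} {..<s} a"
proof -
  let ?y = "y_C n"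
  let ?T = "triple (y_C (Suc n)) A"
  obtain G m0 where G: "finite G" "\<And>g i. g \<in> G \<Longrightarrow> i < 3 * t \<Longrightarrow> row ?T {..<3 * s} i g = 0"
    and gen: "\<And>m c. m \<ge> m0 \<Longrightarrow> (\<And>j. j < 3 * s \<Longrightarrow> c j \<in> tail (Suc n)) \<Longrightarrow>
        (\<And>i. i < 3 * t \<Longrightarrow> row ?T {..<3 * s} i c \<in> high m) \<Longrightarrow>
        \<exists>d\<in>vec_span G. \<forall>j<3 * s. c j + d j \<in> high m"
    using stable unfolding stable_syzygies_def Ball_def lessThan_iff by metis
  have fold: "row a {..<s} i (fold3 ?y g) = fold3 ?y (\<lambda>i. row ?T {..<3 * s} i g) i" if "i < t" for i g
    by (rule row_fold3) (rule a[OF that])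
  have "row a {..<s} i (fold3 ?y g) = 0" if "g \<in> G" "i < t" for g i
    unfolding fold[OF that(2)] fold3_def using G(2)[OF that(1)] that(2) by simp
  moreover have "\<exists>d\<in>vec_span (fold3 ?y ` G). \<forall>j<s. c j + d j \<in> high m"
    if m: "m \<ge> max m0 n" and c: "\<And>j. j < s \<Longrightarrow> c j \<in> tail n"
      and row: "\<And>i. i < t \<Longrightarrow> row a {..<s} i c \<in> high m" for m c
  proof -
    have "\<exists>D. (\<forall>e. D e \<in> tail (Suc n)) \<and> c j = D 0 + D 1 * ?y + D (2::nat) * ?y ^ 2" if j: "j < s" for j
    proof -
      obtain c0 c1 c2 where *: "c0 \<in> tail (Suc n)" "c1 \<in> tail (Suc n)" "c2 \<in> tail (Suc n)"
        "c j = c0 + c1 * ?y + c2 * ?y ^ 2"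
        using c[OF j] by (rule tail_decompose)
      then show ?thesis
        by (intro exI[of _ "\<lambda>e. if e = 0 then c0 else if e = 1 then c1 else c2"]) auto
    qed
    then obtain D where D: "\<And>j e. j < s \<Longrightarrow> D j e \<in> tail (Suc n)"
      "\<And>j. j < s \<Longrightarrow> c j = D j 0 + D j 1 * ?y + D j (2::nat) * ?y ^ 2"
      by metis
    define g where "g j = D (j div 3) (j mod 3)" for j
    have g: "g j \<in> tail (Suc n)" if "j < 3 * s" for j
      using that unfolding g_def by (intro D) linarith
    have cg: "fold3 ?y g j = c j" if "j < s" for j
      unfolding fold3_def g_def div_mod_triple D(2)[OF that] ..
    have "row ?T {..<3 * s} i g \<in> high m" if "i < 3 * t" for i
    proof -
      let ?i = "i div 3"
      have i: "?i < t" using that by linarith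
      have tl: "row ?T {..<3 * s} l g \<in> tail (Suc n)" if "l div 3 = ?i" for l
        by (intro tail_row tail_triple) (use g i that in \<open>auto intro!: A\<close>)
      have "row a {..<s} ?i (fold3 ?y g) = row a {..<s} ?i c"
        by (rule row_cong) (simp add: cg)
      then have "fold3 ?y (\<lambda>i. row ?T {..<3 * s} i g) ?i \<in> high m"
        using row[OF i] fold[OF i] by simp
      from high_components[OF _ _ _ _ this[unfolded fold3_def]]
      have "row ?T {..<3 * s} (3 * ?i) g \<in> high m" "row ?T {..<3 * s} (3 * ?i + 1) g \<in> high m"
        "row ?T {..<3 * s} (3 * ?i + 2) g \<in> high m"
        using m by (simp_all only: tl div_mod_triple max.bounded_iff)
      moreover have "i = 3 * ?i \<or> i = 3 * ?i + 1 \<or> i = 3 * ?i + 2" by linarith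
      ultimately show ?thesis by metis
    qed
    then obtain d where d: "d \<in> vec_span G" "\<And>j. j < 3 * s \<Longrightarrow> g j + d j \<in> high m"
      using gen[of m g] g m by auto
    have "fold3 ?y d \<in> vec_span (fold3 ?y ` G)"
      using module_free_scale module_free_scale _ _ d(1)
      by (rule module_span_image)
        (auto simp: fold3_def free_scale_def fun_eq_iff algebra_simps)
    moreover have "c j + fold3 ?y d j \<in> high m" if "j < s" for j
    proof -
      have "c j + fold3 ?y d j = (g (3 * j) + d (3 * j)) + ?y * (g (3 * j + 1) + d (3 * j + 1))
          + ?y ^ 2 * (g (3 * j + 2) + d (3 * j + 2))"
        unfolding cg[OF that, symmetric] fold3_def by (simp add: algebra_simps)
      then show ?thesis using that by (simp only:) (intro high_add high_mult d(2); simp)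
    qed
    ultimately show ?thesis by blast
  qed
  ultimately show ?thesis
    unfolding stable_syzygies_def Ball_def lessThan_iff using G(1)
    by (intro exI[of _ "fold3 ?y ` G"] exI[of _ "max m0 n"]) blast
qed

definition block :: "nat \<Rightarrow> nat \<Rightarrow> int \<Rightarrow> (nat \<Rightarrow>\<^sub>0 nat) set" where
  "block n N d = {e. keys e \<subseteq> {n..N} \<and> int (monom_weight e) = d}"

lemma mspan_block_power_entry:
  assumes "u \<in> mspan (block N N d)" shows "power_entry N d u"
  using assms
proof (induction rule: mspan.induct)
  case mspan_0
  then show ?case by (simp add: power_entry_def)
next
  case (mspan_plus e u)
  have "e = delta N (lookup e N)"
    using mspan_plus(1) by (intro poly_mapping_eqI) (auto simp: block_def lookup_single when_def in_keys_iff)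
  then obtain k where e: "e = delta N k" by blast
  have "power_entry N d (ym e)"
    using mspan_plus(1) unfolding power_entry_def block_def by (auto simp: e ym_delta)
  then show ?case using mspan_plus.IH by (rule power_entry_add)
qed

lemma block_decompose:
  assumes "u \<in> mspan (block n N d)" "n < N"
  shows "\<exists>c. (\<forall>i. c i \<in> mspan (block (Suc n) N (d - int i * 2 ^ n))) \<and>
    u = c 0 + c 1 * y_C n + c (2::nat) * y_C n ^ 2"
proof -
  have "\<exists>i\<le>2. \<exists>e'\<in>block (Suc n) N (d - int i * 2 ^ n). ym e = ym e' * y_C n ^ i"
    if "e \<in> block n N d" for e
  proof -
    have "keys e \<subseteq> {n..}" using that by (auto simp: block_def)
    from ym_split_lowest[OF this] obtain i e' where e': "i \<le> 2" "ym e = ym e' * y_C n ^ i"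
      "monom_weight e = monom_weight e' + i * 2 ^ n"
      "keys e' \<subseteq> {Suc n..} \<inter> insert (Suc n) (keys e)" by blast
    have "keys e' \<subseteq> {Suc n..N}"
    proof
      fix x assume "x \<in> keys e'"
      then have "Suc n \<le> x" "x = Suc n \<or> x \<in> keys e"
        using e'(4) by auto
      then show "x \<in> {Suc n..N}" using that assms(2) by (auto simp: block_def)
    qed
    then have "e' \<in> block (Suc n) N (d - int i * 2 ^ n)"
      using that e'(3) by (auto simp: block_def)
    then show ?thesis using e' by blast
  qed
  from mspan_decompose[of u "block n N d" "\<lambda>i. block (Suc n) N (d - int i * 2 ^ n)", OF assms(1) this]
  obtain c0 c1 c2 where c: "c0 \<in> mspan (block (Suc n) N (d - int 0 * 2 ^ n))"
    "c1 \<in> mspan (block (Suc n) N (d - int 1 * 2 ^ n))"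
    "c2 \<in> mspan (block (Suc n) N (d - int 2 * 2 ^ n))"
    "u = c0 + c1 * y_C n + c2 * y_C n ^ 2"
    by blast
  show ?thesis
    using c by (intro exI[of _ "\<lambda>i. if i = 0 then c0 else if i = 1 then c1 else if i = 2 then c2 else 0"])
      (auto simp: mspan.mspan_0)
qed

lemma block_mult_y:
  assumes "u \<in> mspan (block n N d)" "n \<le> N"
  shows "y_C n * u \<in> mspan (block n N (d + 2 ^ n))"
proof -
  have "ym (delta n 1) * u \<in> mspan (block n N (d + 2 ^ n))"
    by (rule mspan_mult_ym[OF assms(1)])
      (use assms(2) in \<open>auto simp: block_def keys_add_nat weight_add\<close>)
  then show ?thesis by (simp only: ym_delta power_one_right)
qed

text \<open>Each step of the descent eliminates the lowest variable from the coefficients at the price of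
  tripling the system, until only powers of \<open>y\<^sub>N\<close> are left.\<close>

lemma stable_syzygies_homogeneous:
  fixes s t :: nat
  assumes "n \<le> N" "\<And>i j. i < t \<Longrightarrow> j < s \<Longrightarrow> a i j \<in> mspan (block n N (al i - be j))"
  shows "stable_syzygies n {..<t} {..<s} a"
  using assms
proof (induction n arbitrary: a s t al be rule: inc_induct)
  case base
  then show ?case
    by (intro stable_syzygies_powers[of _ _ _ al be]) (auto intro: mspan_block_power_entry)
next
  case (step n)
  let ?z = "y_C (Suc n)"
  have "\<exists>c. (\<forall>e. c e \<in> mspan (block (Suc n) N (al i - be j - int e * 2 ^ n))) \<and>
      a i j = c 0 + c 1 * y_C n + c (2::nat) * y_C n ^ 2" if "i < t" "j < s" for i j
    using step.prems[OF that] step.hyps(2) by (rule block_decompose)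
  then obtain c where c: "\<And>i j e. i < t \<Longrightarrow> j < s \<Longrightarrow>
      c i j e \<in> mspan (block (Suc n) N (al i - be j - int e * 2 ^ n))"
    "\<And>i j. i < t \<Longrightarrow> j < s \<Longrightarrow> a i j = c i j 0 + c i j 1 * y_C n + c i j (2::nat) * y_C n ^ 2"
    by metis
  define A where "A e i j = c i j e" for e i j
  note A = c[folded A_def]
  have tail: "A e i j \<in> tail (Suc n)" if "i < t" "j < s" for e i j
    using A(1)[OF that, of e] mspan_mono[of "block (Suc n) N (al i - be j - int e * 2 ^ n)"]
    unfolding tail_def by (auto simp: block_def subset_iff)
  \<comment> \<open>The component at \<open>y\<^sub>n\<^sup>e\<close> has degree lower by \<open>e * 2 ^ n\<close>.\<close>
  define al' where "al' i = al (i div 3) - int (i mod 3) * 2 ^ n" for i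
  define be' where "be' j = be (j div 3) - int (j mod 3) * 2 ^ n" for j
  have "triple ?z A i j \<in> mspan (block (Suc n) N (al' i - be' j))" if "i < 3 * t" "j < 3 * s" for i j
  proof -
    let ?i = "i div 3" and ?j = "j div 3" and ?e = "i mod 3" and ?f = "j mod 3"
    have ij: "?i < t" "?j < s" using that by linarith+
    define d where "d = al ?i - be ?j"
    have d: "al' i - be' j = d - int ?e * 2 ^ n + int ?f * 2 ^ n"
      by (simp add: al'_def be'_def d_def)
    have A0: "A 0 ?i ?j \<in> mspan (block (Suc n) N d)"
      and A1: "A 1 ?i ?j \<in> mspan (block (Suc n) N (d - 2 ^ n))"
      and A2: "A 2 ?i ?j \<in> mspan (block (Suc n) N (d - 2 * 2 ^ n))"
      using A(1)[OF ij, of 0] A(1)[OF ij, of 1] A(1)[OF ij, of 2] by (simp_all add: d_def)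
    have zA1: "?z * A 1 ?i ?j \<in> mspan (block (Suc n) N (d + 2 ^ n))"
      and zA2: "?z * A 2 ?i ?j \<in> mspan (block (Suc n) N d)"
    proof -
      have "d - 2 ^ n + 2 ^ Suc n = d + 2 ^ n" "d - 2 * 2 ^ n + 2 ^ Suc n = d" by simp_all
      then show "?z * A 1 ?i ?j \<in> mspan (block (Suc n) N (d + 2 ^ n))"
        and "?z * A 2 ?i ?j \<in> mspan (block (Suc n) N d)"
        using block_mult_y[OF A1] block_mult_y[OF A2] step.hyps(2)
        by (simp_all add: ac_simps)
    qed
    have "?e = 0 \<or> ?e = 1 \<or> ?e = 2" "?f = 0 \<or> ?f = 1 \<or> ?f = 2" by linarith+
    moreover have "d - 2 ^ n + 2 * 2 ^ n = d + 2 ^ n" "d - 2 * 2 ^ n + 2 ^ n = d - 2 ^ n" by simp_all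
    ultimately show ?thesis
      unfolding triple_def mult_block_def d
      using A0 A1 A2 zA1 zA2 by (elim disjE) (simp_all add: mspan_add mspan.mspan_0 add.commute)
  qed
  then have "stable_syzygies (Suc n) {..<3 * t} {..<3 * s} (triple ?z A)"
    by (rule step.IH)
  then show ?case
    using tail A(2) by (intro stable_syzygies_descend[of t s A n a]) auto
qed

section \<open>Homogeneous components\<close>

definition component :: "(int \<Rightarrow> 'm::ab_group_add set) \<Rightarrow> 'm \<Rightarrow> int \<Rightarrow> 'm" where
  "component M u = (SOME c. (\<forall>d. c d \<in> M d) \<and> finite {d. c d \<noteq> 0} \<and> u = (\<Sum>d | c d \<noteq> 0. c d))"

context graded_group
begin

lemma gr_neg: "a \<in> M d \<Longrightarrow> - a \<in> M d"
  using gr_diff[OF gr_zero] by force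

lemma gr_add: "a \<in> M d \<Longrightarrow> b \<in> M d \<Longrightarrow> a + b \<in> M d"
  using gr_diff[of a d "- b"] gr_neg by simp

lemma gr_sum: "(\<And>x. x \<in> F \<Longrightarrow> u x \<in> M d) \<Longrightarrow> sum u F \<in> M d"
  by (induction F rule: infinite_finite_induct) (auto intro: gr_zero gr_add)

lemma total_sum:
  assumes "finite D" "\<And>d. d \<in> D \<Longrightarrow> c d \<in> M d"
  shows "(\<Sum>d\<in>D. c d) \<in> total M"
  using assms unfolding total_def by blast

lemma total_homogeneous: "a \<in> M d \<Longrightarrow> a \<in> total M"
  using total_sum[of "{d}" "\<lambda>_. a"] by simp

lemma total_zero: "0 \<in> total M"
  using total_homogeneous[OF gr_zero] .

lemma component_total:
  assumes "u \<in> total M"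
  shows "component M u d \<in> M d" "finite {d. component M u d \<noteq> 0}"
    "u = (\<Sum>d | component M u d \<noteq> 0. component M u d)"
proof -
  obtain D c where c: "finite D" "\<forall>d\<in>D. c d \<in> M d" "u = (\<Sum>d\<in>D. c d)"
    using assms unfolding total_def by auto
  define c' where "c' d = (if d \<in> D then c d else 0)" for d
  have sub: "{d. c' d \<noteq> 0} \<subseteq> D" by (auto simp: c'_def)
  have "u = (\<Sum>d\<in>D. c' d)" unfolding c(3) by (rule sum.cong) (auto simp: c'_def)
  also have "\<dots> = (\<Sum>d | c' d \<noteq> 0. c' d)"
    by (rule sum.mono_neutral_right) (use c(1) sub in auto)
  finally have "\<exists>c. (\<forall>d. c d \<in> M d) \<and> finite {d. c d \<noteq> 0} \<and> u = (\<Sum>d | c d \<noteq> 0. c d)"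
    using c(2) finite_subset[OF sub c(1)] gr_zero by (intro exI[of _ c']) (auto simp: c'_def)
  from someI_ex[OF this]
  show "component M u d \<in> M d" "finite {d. component M u d \<noteq> 0}"
    "u = (\<Sum>d | component M u d \<noteq> 0. component M u d)"
    unfolding component_def by blast+
qed

lemma component_sum:
  assumes "u \<in> total M" "finite D" "{d. component M u d \<noteq> 0} \<subseteq> D"
  shows "(\<Sum>d\<in>D. component M u d) = u"
  using component_total(3)[OF assms(1)] sum.mono_neutral_left[OF assms(2,3), of "component M u"] by auto

lemma component_eqI:
  assumes "finite D" "\<And>d. d \<in> D \<Longrightarrow> c d \<in> M d" "u = (\<Sum>d\<in>D. c d)"
  shows "component M u d = (if d \<in> D then c d else 0)"
proof -
  have u: "u \<in> total M" unfolding assms(3) using assms(1,2) by (rule total_sum)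
  let ?D = "insert d (D \<union> {d. component M u d \<noteq> 0})"
  let ?c = "\<lambda>d. if d \<in> D then c d else 0"
  have fin: "finite ?D" using assms(1) component_total(2)[OF u] by simp
  have "(\<Sum>d\<in>?D. component M u d - ?c d) = (\<Sum>d\<in>?D. component M u d) - (\<Sum>d\<in>?D. ?c d)"
    by (rule sum_subtractf)
  also have "(\<Sum>d\<in>?D. component M u d) = u" by (rule component_sum[OF u fin]) auto
  also have "(\<Sum>d\<in>?D. ?c d) = (\<Sum>d\<in>D. ?c d)"
    by (rule sum.mono_neutral_right[OF fin]) auto
  also have "\<dots> = u" unfolding assms(3) by (rule sum.cong) auto
  finally have "(\<Sum>d\<in>?D. component M u d - ?c d) = 0" by simp
  then have "component M u d - ?c d = 0"
    by (rule gr_independent[OF fin, rotated])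
      (use component_total(1)[OF u] assms(2) in \<open>auto intro: gr_diff gr_zero\<close>)
  then show ?thesis by simp
qed

lemma component_homogeneous: "u \<in> M e \<Longrightarrow> component M u d = (if d = e then u else 0)"
  using component_eqI[of "{e}" "\<lambda>_. u" u d] by simp

lemma component_0 [simp]: "component M 0 d = 0"
  using component_homogeneous[OF gr_zero] by simp

lemma component_add:
  assumes "u \<in> total M" "v \<in> total M"
  shows "u + v \<in> total M" "component M (u + v) d = component M u d + component M v d"
proof -
  let ?D = "insert d ({d. component M u d \<noteq> 0} \<union> {d. component M v d \<noteq> 0})"
  have fin: "finite ?D" using component_total(2) assms by simp
  have eq: "u + v = (\<Sum>d\<in>?D. component M u d + component M v d)"
  proof -
    have "(\<Sum>d\<in>?D. component M u d) = u" "(\<Sum>d\<in>?D. component M v d) = v"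
      by (rule component_sum[OF _ fin]; use assms in auto)+
    then show ?thesis by (simp only: sum.distrib)
  qed
  have mem: "component M u d + component M v d \<in> M d" for d
    using component_total(1) assms by (intro gr_add) auto
  show "u + v \<in> total M" unfolding eq by (rule total_sum[OF fin mem])
  show "component M (u + v) d = component M u d + component M v d"
    using component_eqI[OF fin mem eq] by simp
qed

lemma component_sum_distrib:
  assumes "\<And>x. x \<in> F \<Longrightarrow> u x \<in> total M"
  shows "sum u F \<in> total M" "component M (sum u F) d = (\<Sum>x\<in>F. component M (u x) d)"
proof -
  have "sum u F \<in> total M \<and> component M (sum u F) d = (\<Sum>x\<in>F. component M (u x) d)"
    using assms
    by (induction F rule: infinite_finite_induct) (auto simp: component_add total_zero)
  then show "sum u F \<in> total M" "component M (sum u F) d = (\<Sum>x\<in>F. component M (u x) d)" by auto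
qed

lemma total_eqI:
  assumes "u \<in> total M" "v \<in> total M" "\<And>d. component M u d = component M v d"
  shows "u = v"
  using component_total(3)[OF assms(1)] component_total(3)[OF assms(2)] assms(3)
  by (metis (no_types, lifting) ext)

end

context graded_module
begin

lemma component_scale:
  assumes "a \<in> A k" "u \<in> total M"
  shows "scale a u \<in> total M" "component M (scale a u) (k + d) = scale a (component M u d)"
proof -
  let ?S = "insert d {d. component M u d \<noteq> 0}"
  have fin: "finite ?S" using component_total(2)[OF assms(2)] by simp
  have "u = (\<Sum>d\<in>?S. component M u d)"
    by (rule component_sum[OF assms(2) fin, symmetric]) auto
  then have "scale a u = (\<Sum>d\<in>?S. scale a (component M u d))"
    by (metis scale_sum_right)
  also have "\<dots> = (\<Sum>e\<in>(+) k ` ?S. scale a (component M u (e - k)))"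
    by (subst sum.reindex) auto
  finally have eq: "scale a u = (\<Sum>e\<in>(+) k ` ?S. scale a (component M u (e - k)))" .
  have mem: "scale a (component M u (e - k)) \<in> M e" for e
    using gr_scale[OF assms(1) component_total(1)[OF assms(2)], of "e - k"] by simp
  have fin': "finite ((+) k ` ?S)" using fin by simp
  show "scale a u \<in> total M" unfolding eq by (rule total_sum[OF fin' mem])
  show "component M (scale a u) (k + d) = scale a (component M u d)"
    using component_eqI[OF fin' mem eq, of "k + d"] by simp
qed

end

section \<open>C as a graded ring\<close>

lemma C_gr_eq_mspan: "C_gr d = mspan {e. int (monom_weight e) = d}"
  unfolding C_gr_def f2_poly_gr_def mspan_eq_image by (rule arg_cong[where f = "image _"]) auto

lemma C_gr_iff_supp: "u \<in> C_gr d \<longleftrightarrow> (\<forall>w\<in>supp u. int (monom_weight w) = d)"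
  unfolding C_gr_eq_mspan by (subst mspan_iff_supp) (auto simp: weight_nf)

lemma coef_C_gr: "u \<in> C_gr d \<Longrightarrow> int (monom_weight w) \<noteq> d \<Longrightarrow> coef w u = 0"
  unfolding C_gr_iff_supp by (auto simp: supp_def)

lemma ringC_eqI: "(\<And>w. coef w u = coef w v) \<Longrightarrow> u = v"
  by (subst (1 2) sum_supp) (simp add: supp_def)

interpretation C: graded_module C_gr "(*)" C_gr
proof -
  have group: "graded_group C_gr"
  proof
    show "0 \<in> C_gr d" for d by (simp add: C_gr_eq_mspan mspan_0)
    show "a - b \<in> C_gr d" if "a \<in> C_gr d" "b \<in> C_gr d" for a b d
      using that by (simp add: C_gr_eq_mspan mspan_add)
    show "m d = 0" if D: "finite D" "\<And>d. d \<in> D \<Longrightarrow> m d \<in> C_gr d" "(\<Sum>d\<in>D. m d) = 0" "d \<in> D" for D m d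
    proof (rule ringC_eqI)
      fix w
      show "coef w (m d) = coef w 0"
      proof (cases "int (monom_weight w) = d")
        case True
        have "0 = (\<Sum>e\<in>D. coef w (m e))" using D(3) by (metis coef_sum coef_0)
        also have "\<dots> = (\<Sum>e\<in>{d}. coef w (m e))"
          by (rule sum.mono_neutral_right) (use D True in \<open>auto intro!: coef_C_gr[OF D(2)]\<close>)
        finally show ?thesis by simp
      next
        case False
        then show ?thesis using coef_C_gr[OF D(2)[OF D(4)]] by simp
      qed
    qed
  qed
  have "u \<in> total C_gr" for u
  proof (induction u rule: ringC_induct)
    case zero
    show ?case using graded_group.total_zero[OF group] .
  next
    case (add e u)
    have "ym e \<in> C_gr (int (monom_weight e))" by (simp add: C_gr_eq_mspan mspan_ym)
    then show ?case
      using graded_group.component_add(1)[OF group graded_group.total_homogeneous[OF group] add] by blast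
  qed
  then have total: "total C_gr = UNIV" by blast
  have one: "1 \<in> C_gr 0"
    using mspan_ym[of 0] by (simp add: C_gr_eq_mspan)
  have mult: "a * b \<in> C_gr (i + j)" if "a \<in> C_gr i" "b \<in> C_gr j" for a b i j
    using that unfolding C_gr_eq_mspan by (rule mspan_mult) (simp add: weight_add)
  show "graded_module C_gr (*) C_gr"
    by (intro graded_module.intro graded_ring.intro group module_times
        graded_ring_axioms.intro graded_module_axioms.intro)
      (auto simp: total one mult mult.commute)
qed

(* For multiplication in C this rule is associativity from right to left. *)
declare C.scale_scale [simp del]

lemma C_total [simp]: "u \<in> total C_gr"
  by (simp add: C.gr_total)

lemma C_component_mult:
  "a \<in> C_gr k \<Longrightarrow> component C_gr (u * a) d = component C_gr u (d - k) * a"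
  using C.component_scale(2)[of a k u "d - k"] by (simp add: mult.commute)

lemma weight_ge: "i \<in> keys e \<Longrightarrow> 2 ^ i \<le> monom_weight e"
proof -
  assume i: "i \<in> keys e"
  then have "1 * 2 ^ i \<le> lookup e i * 2 ^ i"
    by (intro mult_right_mono) (auto simp: in_keys_iff)
  also have "\<dots> \<le> monom_weight e"
    unfolding monom_weight_def using i by (intro member_le_sum) auto
  finally show ?thesis by simp
qed

text \<open>A variable \<open>y\<^sub>i\<close> with \<open>i > m\<close> has degree \<open>2\<^sup>i > m\<close>.\<close>

lemma C_gr_Int_high:
  assumes "u \<in> C_gr d" "u \<in> high m" "d \<le> int m" shows "u = 0"
proof -
  have "supp u = {}"
  proof (rule ccontr)
    assume "supp u \<noteq> {}"
    then obtain w where w: "w \<in> supp u" by blast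
    then obtain i where i: "i \<in> keys w" "m < i"
      using assms(2) by (auto simp: high_iff_supp)
    have "int (monom_weight w) = d" using assms(1) w by (simp add: C_gr_iff_supp)
    moreover have "i < 2 ^ i" by simp
    then have "m < monom_weight w" using weight_ge[OF i(1)] i(2) by linarith
    ultimately show False using assms(3) by simp
  qed
  then show ?thesis using sum_supp[of u] by simp
qed

lemma coef_component: "coef w (component C_gr u d) = (if int (monom_weight w) = d then coef w u else 0)"
proof (cases "int (monom_weight w) = d")
  case True
  let ?D = "insert d {d. component C_gr u d \<noteq> 0}"
  have fin: "finite ?D" using C.component_total(2)[of u] by simp
  have "(\<Sum>e\<in>?D. component C_gr u e) = u"
    by (rule C.component_sum[OF _ fin]) auto
  then have "coef w u = coef w (\<Sum>e\<in>?D. component C_gr u e)" by simp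
  also have "\<dots> = (\<Sum>e\<in>?D. coef w (component C_gr u e))" by (rule coef_sum)
  also have "\<dots> = (\<Sum>e\<in>{d}. coef w (component C_gr u e))"
    by (rule sum.mono_neutral_right[OF fin])
      (use True in \<open>auto intro!: coef_C_gr[OF C.component_total(1)]\<close>)
  finally show ?thesis using True by simp
next
  case False
  then show ?thesis using coef_C_gr[OF C.component_total(1)[of u]] by simp
qed

lemma high_component: "u \<in> high m \<Longrightarrow> component C_gr u d \<in> high m"
  unfolding high_iff_supp by (auto simp: supp_def coef_component split: if_splits)

lemma block_eq_weight:
  assumes "d \<le> int N" shows "block 0 N d = {e. int (monom_weight e) = d}"
proof -
  have "i \<le> N" if "i \<in> keys e" "int (monom_weight e) = d" for i e
  proof -
    have "i < 2 ^ i" by simp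
    then show ?thesis using weight_ge[OF that(1)] that(2) assms by linarith
  qed
  then show ?thesis by (auto simp: block_def)
qed

text \<open>Only \<open>y\<^sub>i\<close> with \<open>i \<le> d\<close> occur in degree \<open>d\<close>, with exponent at most 2 in normal form.\<close>

lemma finite_C_gr: "finite (C_gr d)"
proof -
  define W where "W = {e. normal e \<and> int (monom_weight e) = d}"
  define F where "F = {f. \<forall>i. (i \<in> {..nat d} \<longrightarrow> f i \<in> {..2::nat}) \<and> (i \<notin> {..nat d} \<longrightarrow> f i = 0)}"
  have "finite F"
    unfolding F_def by (rule finite_set_of_finite_funs) auto
  moreover have "lookup ` W \<subseteq> F"
  proof (rule image_subsetI)
    fix e assume "e \<in> W"
    then have e: "normal e" "int (monom_weight e) = d" by (simp_all add: W_def)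
    have "e \<in> block 0 (nat d) d"
      using e(2) by (subst block_eq_weight) auto
    then have keys: "keys e \<subseteq> {0..nat d}" by (simp add: block_def)
    have "lookup e i = 0" if "i \<notin> {..nat d}" for i
    proof -
      have "i \<notin> keys e" using keys that by auto
      then show ?thesis by (simp add: in_keys_iff)
    qed
    then show "lookup e \<in> F" using e(1) by (simp add: F_def normal_def)
  qed
  ultimately have "finite (lookup ` W)" by (rule rev_finite_subset)
  then have "finite W"
    by (rule finite_imageD) (auto intro!: inj_onI poly_mapping_eqI)
  then have "finite (sum ym ` Pow W)" by (intro finite_imageI finite_Pow_iff[THEN iffD2])
  moreover have "C_gr d \<subseteq> sum ym ` Pow W"
  proof
    fix u assume "u \<in> C_gr d"
    then have "supp u \<in> Pow W" by (auto simp: W_def C_gr_iff_supp supp_normal)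
    then show "u \<in> sum ym ` Pow W" by (subst sum_supp) (rule imageI)
  qed
  ultimately show ?thesis by (rule rev_finite_subset)
qed

text \<open>The finiteness statement for a single equation. The bound \<open>N\<close> is chosen so that all coefficients are
  polynomials in \<open>y\<^sub>0, \<dots>, y\<^sub>N\<close>.\<close>

lemma homogeneous_syzygies:
  fixes s :: nat
  assumes "\<forall>j<s. a j \<in> C_gr (deg j)"
  shows "\<exists>G m0. finite G \<and> (\<forall>g\<in>G. (\<Sum>j<s. g j * a j) = 0) \<and>
    (\<forall>m\<ge>m0. \<forall>c. (\<Sum>j<s. c j * a j) \<in> high m \<longrightarrow>
       (\<exists>d\<in>vec_span G. \<forall>j<s. c j + d j \<in> high m))"
proof -
  define N where "N = nat (Max (insert 0 (deg ` {..<s})))"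
  have N: "deg j \<le> int N" if "j < s" for j
  proof -
    have "deg j \<le> Max (insert 0 (deg ` {..<s}))" using that by (intro Max_ge) auto
    then show ?thesis by (simp add: N_def)
  qed
  have "stable_syzygies 0 {..<1} {..<s} (\<lambda>_. a)"
    by (rule stable_syzygies_homogeneous[of 0 N _ _ _ "\<lambda>_. 0" "\<lambda>j. - deg j"])
      (use assms N in \<open>auto simp: block_eq_weight C_gr_eq_mspan\<close>)
  then show ?thesis
    unfolding stable_syzygies_def row_def by (simp add: Ball_def mult.commute)
qed

section \<open>Self-injectivity\<close>

lemma extend_bit_functional:
  fixes V :: "ringC set" and lam :: "ringC \<Rightarrow> bit"
  assumes V: "0 \<in> V" "\<And>u v. u \<in> V \<Longrightarrow> v \<in> V \<Longrightarrow> u + v \<in> V"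
    and lam: "\<And>u v. u \<in> V \<Longrightarrow> v \<in> V \<Longrightarrow> lam (u + v) = lam u + lam v"
  obtains lam' where "\<And>u v. lam' (u + v) = lam' u + lam' v" "\<And>u. u \<in> V \<Longrightarrow> lam' u = lam u"
proof -
  define sc :: "bit \<Rightarrow> ringC \<Rightarrow> ringC" where "sc b u = of_bit b * u" for b u
  interpret vector_space_pair sc "(*) :: bit \<Rightarrow> bit \<Rightarrow> bit"
  proof
    fix a b :: bit and x y :: ringC
    show "sc a (x + y) = sc a x + sc a y" by (simp add: sc_def distrib_left)
    show "sc (a + b) x = sc a x + sc b x"
      unfolding sc_def of_bit_add[OF ringC_char2] by (rule distrib_right)
    show "sc a (sc b x) = sc (a * b) x" by (cases a; cases b) (simp_all add: sc_def)
    show "sc 1 x = x" by (simp add: sc_def)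
    fix c :: bit
    show "a * (b + c) = a * b + a * c" "(a + b) * c = a * c + b * c" "a * (b * c) = a * b * c"
      by (rule distrib_left distrib_right mult.assoc[symmetric])+
    show "1 * a = a" by (rule mult_1_left)
  qed
  obtain B where B: "B \<subseteq> V" "vs1.independent B" "V \<subseteq> vs1.span B"
    by (rule vs1.maximal_independent_subset)
  obtain g where g: "Vector_Spaces.linear sc (*) g" "\<forall>x\<in>B. g x = lam x"
    using linear_independent_extend[OF B(2)] by blast
  interpret g: Vector_Spaces.linear sc "(*)" g by (rule g(1))
  have "u \<in> V \<and> g u = lam u" if "u \<in> vs1.span B" for u
    using that
  proof (induction u rule: vs1.span_induct_alt)
    case base
    have "lam 0 = 0" using lam[OF V(1) V(1)] by simp
    then show ?case using V(1) by (simp add: g.zero)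
  next
    case (step c x y)
    then show ?case
      using V(2)[of x y] lam[of x y] B(1) g(2) by (cases c) (auto simp: sc_def g.add)
  qed
  then show ?thesis using that[of g] B(3) by (auto simp: g.add)
qed

text \<open>A finite system \<open>a\<^sub>j b = c\<^sub>j\<close> is solvable once every relation among the \<open>a\<^sub>j\<close> holds for the
  \<open>c\<^sub>j\<close>. Work modulo a deep truncation ideal. The functional sending \<open>\<Sum> h\<^sub>j a\<^sub>j\<close> to the socle
  coefficient of \<open>\<Sum> h\<^sub>j c\<^sub>j\<close> is well defined there, because all relations modulo that ideal come
  from exact ones; the element that represents an extension of it solves the system modulo the
  ideal, which in the degrees at hand means exactly.\<close>

lemma homogeneous_system_solvable:
  fixes s :: nat
  assumes a: "\<And>j. j < s \<Longrightarrow> a j \<in> C_gr (deg j)"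
    and c: "\<And>j. j < s \<Longrightarrow> c j \<in> C_gr (deg j + d)"
    and rel: "\<And>e h. (\<And>j. j < s \<Longrightarrow> h j \<in> C_gr (e - deg j)) \<Longrightarrow>
      (\<Sum>j<s. h j * a j) = 0 \<Longrightarrow> (\<Sum>j<s. h j * c j) = 0"
  shows "\<exists>b\<in>C_gr d. \<forall>j<s. a j * b = c j"
proof -
  \<comment> \<open>The hypothesis on homogeneous relations extends to all relations by taking components.\<close>
  have rel': "(\<Sum>j<s. h j * c j) = 0" if h: "(\<Sum>j<s. h j * a j) = 0" for h
  proof (rule C.total_eqI)
    fix e
    have "(\<Sum>j<s. component C_gr (h j) (e - d - deg j) * a j) = component C_gr (\<Sum>j<s. h j * a j) (e - d)"
      unfolding C.component_sum_distrib(2)[OF C_total]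
      by (rule sum.cong) (simp_all add: C_component_mult[OF a])
    then have "(\<Sum>j<s. component C_gr (h j) (e - d - deg j) * c j) = 0"
      unfolding h by (intro rel[of _ "e - d"]) (simp_all add: C.component_total(1))
    also have "(\<Sum>j<s. component C_gr (h j) (e - d - deg j) * c j) = component C_gr (\<Sum>j<s. h j * c j) e"
      unfolding C.component_sum_distrib(2)[OF C_total]
      by (rule sum.cong) (use c in \<open>simp_all add: C_component_mult[OF c] diff_diff_eq add.commute\<close>)
    finally show "component C_gr (\<Sum>j<s. h j * c j) e = component C_gr 0 e" by simp
  qed simp_all
  have "\<forall>j<s. a j \<in> C_gr (deg j)" using a by blast
  from homogeneous_syzygies[OF this]
  obtain G m0 where G: "finite G" "\<forall>g\<in>G. (\<Sum>j<s. g j * a j) = 0"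
    "\<forall>m\<ge>m0. \<forall>h. (\<Sum>j<s. h j * a j) \<in> high m \<longrightarrow>
       (\<exists>d\<in>vec_span G. \<forall>j<s. h j + d j \<in> high m)"
    by (elim exE conjE)
  define m where "m = max m0 (nat (Max (insert 0 ((\<lambda>j. deg j + d) ` {..<s}))))"
  have m: "deg j + d \<le> int m" if "j < s" for j
  proof -
    have "deg j + d \<le> Max (insert 0 ((\<lambda>j. deg j + d) ` {..<s}))" using that by (intro Max_ge) auto
    then show ?thesis by (simp add: m_def)
  qed
  have span_rel: "(\<Sum>j<s. g j * c j) = 0" if g: "g \<in> vec_span G" for g
  proof -
    obtain r where r: "g = (\<Sum>x\<in>G. free_scale (r x) x)"
      using g module.span_finite[OF module_free_scale G(1)] by auto
    have "(\<Sum>j<s. (\<Sum>x\<in>F. free_scale (r x) x) j * c j) = 0" if "finite F" "F \<subseteq> G" for F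
      using that
    proof (induction F)
      case (insert x F)
      have "x \<in> G" using insert.prems by simp
      then have "(\<Sum>j<s. x j * a j) = 0" by (rule G(2)[rule_format])
      then have x: "(\<Sum>j<s. x j * c j) = 0" by (rule rel')
      have "(\<Sum>j<s. (\<Sum>x\<in>insert x F. free_scale (r x) x) j * c j) =
          r x * (\<Sum>j<s. x j * c j) + (\<Sum>j<s. (\<Sum>x\<in>F. free_scale (r x) x) j * c j)"
        using insert.hyps
        by (simp add: free_scale_def distrib_right sum.distrib sum_distrib_left mult.assoc)
      then show ?case using insert.IH insert.prems unfolding x by simp
    qed simp
    from this[OF G(1) subset_refl] show ?thesis by (simp only: r)
  qed
  have rel_high: "(\<Sum>j<s. h j * c j) \<in> high m" if h: "(\<Sum>j<s. h j * a j) \<in> high m" for h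
  proof -
    have m0: "m0 \<le> m" by (simp add: m_def)
    obtain g where g: "g \<in> vec_span G" "\<And>j. j < s \<Longrightarrow> h j + g j \<in> high m"
      using G(3)[rule_format, OF m0 h] by blast
    have "(\<Sum>j<s. c j * (h j + g j)) = (\<Sum>j<s. h j * c j) + (\<Sum>j<s. g j * c j)"
      by (simp only: distrib_left sum.distrib mult.commute)
    also have "\<dots> = (\<Sum>j<s. h j * c j)"
      by (simp only: span_rel[OF g(1)] add_0_right)
    finally show ?thesis
      using high_sum[of "{..<s}" "\<lambda>j. c j * (h j + g j)" m] high_mult g(2) by auto
  qed
  define V where "V = {v. \<exists>h. v + (\<Sum>j<s. h j * a j) \<in> high m}"
  have V_intro: "v \<in> V" if "v + (\<Sum>j<s. h j * a j) \<in> high m" for v h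
    unfolding V_def using that by blast
  define H where "H v = (SOME h. v + (\<Sum>j<s. h j * a j) \<in> high m)" for v
  define lam where "lam v = socle_form m (\<Sum>j<s. H v j * c j)" for v
  have lam: "lam v = socle_form m (\<Sum>j<s. h j * c j)" if h: "v + (\<Sum>j<s. h j * a j) \<in> high m" for v h
  proof -
    have "v + (\<Sum>j<s. H v j * a j) \<in> high m"
      unfolding H_def by (rule someI[of "\<lambda>h. v + (\<Sum>j<s. h j * a j) \<in> high m", OF h])
    from high_add[OF this h] have "(\<Sum>j<s. (H v j + h j) * a j) \<in> high m"
      by (simp add: distrib_right distrib_left sum.distrib ac_simps)
    then have "socle_form m (\<Sum>j<s. (H v j + h j) * c j) = 0"
      by (intro socle_form_high rel_high)
    then have "lam v + socle_form m (\<Sum>j<s. h j * c j) = 0"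
      by (simp add: lam_def distrib_right sum.distrib socle_form_add)
    then show ?thesis by (cases "lam v"; cases "socle_form m (\<Sum>j<s. h j * c j)") auto
  qed
  have sum_V: "u + v + (\<Sum>j<s. (h j + k j) * a j) \<in> high m"
    if "u + (\<Sum>j<s. h j * a j) \<in> high m" "v + (\<Sum>j<s. k j * a j) \<in> high m" for u v h k
    using high_add[OF that] by (simp add: distrib_right distrib_left sum.distrib ac_simps)
  have add_V: "u + v \<in> V" "lam (u + v) = lam u + lam v" if uv: "u \<in> V" "v \<in> V" for u v
  proof -
    obtain h k where hk: "u + (\<Sum>j<s. h j * a j) \<in> high m" "v + (\<Sum>j<s. k j * a j) \<in> high m"
      using uv unfolding V_def by blast
    show "u + v \<in> V" by (rule V_intro[OF sum_V[OF hk]])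
    show "lam (u + v) = lam u + lam v"
      unfolding lam[OF hk(1)] lam[OF hk(2)] lam[OF sum_V[OF hk]]
      by (simp add: distrib_right sum.distrib socle_form_add)
  qed
  have "0 \<in> V" by (rule V_intro[of _ "\<lambda>_. 0"]) simp
  then obtain lam' where lam': "\<And>u v. lam' (u + v) = lam' u + lam' v" "\<And>u. u \<in> V \<Longrightarrow> lam' u = lam u"
    using extend_bit_functional[of V lam] add_V by metis
  have "lam' u = 0" if "u \<in> high m" for u
  proof -
    have *: "u + (\<Sum>j<s. 0 * a j) \<in> high m" using that by simp
    then have "u \<in> V" by (rule V_intro)
    then show ?thesis using lam'(2) lam[OF *] by simp
  qed
  then obtain b0 where b0: "\<And>u. lam' u = socle_form m (b0 * u)"
    using socle_form_represents[of lam' m] lam'(1) by blast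
  define b where "b = component C_gr b0 d"
  have "a j * b = c j" if j: "j < s" for j
  proof -
    have "socle_form m ((a j * b0 + c j) * u) = 0" for u
    proof -
      let ?h = "\<lambda>l. if l = j then u else 0"
      have h: "(\<Sum>l<s. ?h l * x l) = u * x j" for x :: "nat \<Rightarrow> ringC"
        using j by (subst sum.remove[of _ j]) auto
      then have *: "u * a j + (\<Sum>l<s. ?h l * a l) \<in> high m" by simp
      then have "u * a j \<in> V" by (rule V_intro)
      then have "socle_form m (b0 * (u * a j)) = socle_form m (u * c j)"
        using lam[OF *] lam'(2) b0 h by metis
      moreover have "(a j * b0 + c j) * u = b0 * (u * a j) + u * c j"
        by (simp add: algebra_simps)
      ultimately show ?thesis by (simp only: socle_form_add bit_add_self)
    qed
    then have "a j * b0 + c j \<in> high m" by (rule socle_form_nondegenerate)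
    then have "component C_gr (a j * b0 + c j) (deg j + d) \<in> high m" by (rule high_component)
    moreover have "component C_gr (a j * b0 + c j) (deg j + d) = a j * b + c j"
      using C_component_mult[OF a[OF j], of b0 "deg j + d"] C.component_homogeneous[OF c[OF j]]
      by (simp add: C.component_add b_def mult.commute)
    moreover have "a j * b + c j \<in> C_gr (deg j + d)"
      unfolding b_def using a[OF j] c[OF j] by (intro C.gr_add C.gr_mult C.component_total) auto
    ultimately have "a j * b + c j = 0" using C_gr_Int_high[OF _ _ m[OF j]] by simp
    then show ?thesis by (metis ringC_add_self_left add_0_right)
  qed
  moreover have "b \<in> C_gr d" unfolding b_def by (rule C.component_total) simp
  ultimately show ?thesis by blast
qed

text \<open>Graphs of homomorphisms into C defined on a graded submodule of \<open>N\<close>, recorded on homogeneous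
  elements together with their degrees.\<close>

definition partial_hom_graph ::
  "(ringC \<Rightarrow> 'n \<Rightarrow> 'n) \<Rightarrow> (int \<Rightarrow> 'n::ab_group_add set) \<Rightarrow> (int \<times> 'n \<times> ringC) set \<Rightarrow> bool" where
  "partial_hom_graph sN N \<Gamma> \<longleftrightarrow>
     (\<forall>d v c. (d, v, c) \<in> \<Gamma> \<longrightarrow> v \<in> N d \<and> c \<in> C_gr d) \<and>
     (\<forall>d. (d, 0, 0) \<in> \<Gamma>) \<and>
     (\<forall>d v c v' c'. (d, v, c) \<in> \<Gamma> \<longrightarrow> (d, v', c') \<in> \<Gamma> \<longrightarrow> (d, v + v', c + c') \<in> \<Gamma>) \<and>
     (\<forall>d v c k a. (d, v, c) \<in> \<Gamma> \<longrightarrow> a \<in> C_gr k \<longrightarrow> (k + d, sN a v, a * c) \<in> \<Gamma>) \<and>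
     (\<forall>d c. (d, 0, c) \<in> \<Gamma> \<longrightarrow> c = 0)"

lemma partial_hom_graphD:
  assumes "partial_hom_graph sN N \<Gamma>"
  shows "(d, v, c) \<in> \<Gamma> \<Longrightarrow> v \<in> N d" "(d, v, c) \<in> \<Gamma> \<Longrightarrow> c \<in> C_gr d" "(d, 0, 0) \<in> \<Gamma>"
    "(d, v, c) \<in> \<Gamma> \<Longrightarrow> (d, v', c') \<in> \<Gamma> \<Longrightarrow> (d, v + v', c + c') \<in> \<Gamma>"
    "(d, v, c) \<in> \<Gamma> \<Longrightarrow> a \<in> C_gr k \<Longrightarrow> (k + d, sN a v, a * c) \<in> \<Gamma>"
    "(d, 0, c) \<in> \<Gamma> \<Longrightarrow> c = 0"
  using assms unfolding partial_hom_graph_def by blast+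

text \<open>The value at a new element \<open>v\<close> has to solve \<open>a b = \<phi>(a v)\<close> for all \<open>a\<close> with \<open>a v\<close> in the domain of
  \<open>\<phi>\<close>. There are only finitely many candidates \<open>b\<close> in the degree of \<open>v\<close>; if each of them violated
  some equation, then so many equations would have no common solution.\<close>

lemma partial_hom_value:
  assumes N: "graded_module C_gr sN N" and \<Gamma>: "partial_hom_graph sN N \<Gamma>" and v: "v \<in> N d"
  shows "\<exists>b\<in>C_gr d. \<forall>k a c. a \<in> C_gr k \<longrightarrow> (k + d, sN a v, c) \<in> \<Gamma> \<longrightarrow> c = a * b"
proof (rule ccontr)
  interpret N: graded_module C_gr sN N by (rule N)
  assume "\<not> ?thesis"
  then have "\<forall>b\<in>C_gr d. \<exists>k a c. a \<in> C_gr k \<and> (k + d, sN a v, c) \<in> \<Gamma> \<and> c \<noteq> a * b" by blast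
  then obtain k a c where kac: "\<And>b. b \<in> C_gr d \<Longrightarrow> a b \<in> C_gr (k b)"
    "\<And>b. b \<in> C_gr d \<Longrightarrow> (k b + d, sN (a b) v, c b) \<in> \<Gamma>" "\<And>b. b \<in> C_gr d \<Longrightarrow> c b \<noteq> a b * b"
    by metis
  obtain bs where bs: "set bs = C_gr d" using finite_list[OF finite_C_gr] by blast
  have mem: "bs ! j \<in> C_gr d" if "j < length bs" for j using that bs nth_mem by blast
  have "\<exists>b\<in>C_gr d. \<forall>j<length bs. a (bs ! j) * b = c (bs ! j)"
  proof (rule homogeneous_system_solvable)
    show "a (bs ! j) \<in> C_gr (k (bs ! j))" if "j < length bs" for j using kac(1)[OF mem[OF that]] .
    show "c (bs ! j) \<in> C_gr (k (bs ! j) + d)" if "j < length bs" for j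
      using partial_hom_graphD(2)[OF \<Gamma> kac(2)[OF mem[OF that]]] .
    fix e h
    assume h: "\<And>j. j < length bs \<Longrightarrow> h j \<in> C_gr (e - k (bs ! j))"
      and rel: "(\<Sum>j<length bs. h j * a (bs ! j)) = 0"
    have "(e + d, sN (\<Sum>j<l. h j * a (bs ! j)) v, \<Sum>j<l. h j * c (bs ! j)) \<in> \<Gamma>" if "l \<le> length bs" for l
      using that
    proof (induction l)
      case 0
      then show ?case using partial_hom_graphD(3)[OF \<Gamma>] by simp
    next
      case (Suc l)
      have "(e - k (bs ! l) + (k (bs ! l) + d), sN (h l) (sN (a (bs ! l)) v), h l * c (bs ! l)) \<in> \<Gamma>"
        using Suc.prems by (intro partial_hom_graphD(5)[OF \<Gamma>] kac(2) mem h) auto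
      then have "(e + d, sN (h l * a (bs ! l)) v, h l * c (bs ! l)) \<in> \<Gamma>" by simp
      then show ?case
        using partial_hom_graphD(4)[OF \<Gamma>] Suc by (simp add: N.scale_left_distrib)
    qed
    from this[of "length bs"] rel show "(\<Sum>j<length bs. h j * c (bs ! j)) = 0"
      using partial_hom_graphD(6)[OF \<Gamma>] by simp
  qed
  then obtain b where b: "b \<in> C_gr d" "\<forall>j<length bs. a (bs ! j) * b = c (bs ! j)" by blast
  obtain j where "j < length bs" "bs ! j = b" using b(1) bs by (metis in_set_conv_nth)
  then show False using kac(3)[OF b(1)] b(2) by auto
qed

text \<open>The graph generated by the old one and the pair of \<open>v\<close> and its value.\<close>

lemma partial_hom_extend:
  assumes N: "graded_module C_gr sN N" and \<Gamma>: "partial_hom_graph sN N \<Gamma>" and v: "v \<in> N d"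
  shows "\<exists>\<Gamma>'. partial_hom_graph sN N \<Gamma>' \<and> \<Gamma> \<subseteq> \<Gamma>' \<and> (\<exists>c. (d, v, c) \<in> \<Gamma>')"
proof -
  interpret N: graded_module C_gr sN N by (rule N)
  obtain b where b: "b \<in> C_gr d"
    "\<And>k a c. a \<in> C_gr k \<Longrightarrow> (k + d, sN a v, c) \<in> \<Gamma> \<Longrightarrow> c = a * b"
    using partial_hom_value[OF assms] by blast
  define \<Gamma>' where "\<Gamma>' = {(e, w + sN a v, c + a * b) | e w a c. (e, w, c) \<in> \<Gamma> \<and> a \<in> C_gr (e - d)}"
  have intro: "(e, w + sN a v, c + a * b) \<in> \<Gamma>'" if "(e, w, c) \<in> \<Gamma>" "a \<in> C_gr (e - d)" for e w a c
    using that unfolding \<Gamma>'_def by blast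
  have "partial_hom_graph sN N \<Gamma>'"
    unfolding partial_hom_graph_def
  proof (intro conjI allI impI)
    show "u \<in> N e" "c \<in> C_gr e" if uc: "(e, u, c) \<in> \<Gamma>'" for e u c
    proof -
      obtain w a c' where *: "u = w + sN a v" "c = c' + a * b" "(e, w, c') \<in> \<Gamma>" "a \<in> C_gr (e - d)"
        using uc unfolding \<Gamma>'_def by blast
      show "u \<in> N e" unfolding *(1)
        using N.gr_scale[OF *(4) v] partial_hom_graphD(1)[OF \<Gamma> *(3)] by (intro N.gr_add) auto
      show "c \<in> C_gr e" unfolding *(2)
        using C.gr_mult[OF *(4) b(1)] partial_hom_graphD(2)[OF \<Gamma> *(3)] by (intro C.gr_add) auto
    qed
    show "(e, 0, 0) \<in> \<Gamma>'" for e
      using intro[OF partial_hom_graphD(3)[OF \<Gamma>] C.gr_zero] by simp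
    show "(e, u + u', c + c') \<in> \<Gamma>'" if uc: "(e, u, c) \<in> \<Gamma>'" "(e, u', c') \<in> \<Gamma>'" for e u c u' c'
    proof -
      obtain w a f where 1: "u = w + sN a v" "c = f + a * b" "(e, w, f) \<in> \<Gamma>" "a \<in> C_gr (e - d)"
        using uc(1) unfolding \<Gamma>'_def by blast
      obtain w' a' f' where 2: "u' = w' + sN a' v" "c' = f' + a' * b" "(e, w', f') \<in> \<Gamma>"
        "a' \<in> C_gr (e - d)"
        using uc(2) unfolding \<Gamma>'_def by blast
      show ?thesis
        using intro[OF partial_hom_graphD(4)[OF \<Gamma> 1(3) 2(3)] C.gr_add[OF 1(4) 2(4)]]
        by (simp add: 1(1,2) 2(1,2) N.scale_left_distrib distrib_right distrib_left ac_simps)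
    qed
    show "(k + e, sN r u, r * c) \<in> \<Gamma>'" if uc: "(e, u, c) \<in> \<Gamma>'" "r \<in> C_gr k" for e u c k r
    proof -
      obtain w a f where 1: "u = w + sN a v" "c = f + a * b" "(e, w, f) \<in> \<Gamma>" "a \<in> C_gr (e - d)"
        using uc(1) unfolding \<Gamma>'_def by blast
      have "r * a \<in> C_gr (k + e - d)" using C.gr_mult[OF uc(2) 1(4)] by (simp add: algebra_simps)
      from intro[OF partial_hom_graphD(5)[OF \<Gamma> 1(3) uc(2)] this] show ?thesis
        by (simp add: 1(1,2) N.scale_right_distrib distrib_left mult.assoc)
    qed
    show "c = 0" if c: "(e, 0, c) \<in> \<Gamma>'" for e c
    proof -
      obtain w a f where 1: "0 = w + sN a v" "c = f + a * b" "(e, w, f) \<in> \<Gamma>" "a \<in> C_gr (e - d)"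
        using c unfolding \<Gamma>'_def by blast
      have "w = - sN a v" using 1(1) by (metis eq_neg_iff_add_eq_0)
      also have "\<dots> = sN a v" by (metis N.scale_minus_left ringC_minus)
      finally have "(e - d + d, sN a v, f) \<in> \<Gamma>" using 1(3) by simp
      then have "f = a * b" by (rule b(2)[OF 1(4)])
      then show ?thesis by (simp add: 1(2))
    qed
  qed
  moreover have "\<Gamma> \<subseteq> \<Gamma>'"
  proof
    fix t assume "t \<in> \<Gamma>"
    then show "t \<in> \<Gamma>'" using intro[of "fst t" "fst (snd t)" "snd (snd t)" 0] C.gr_zero by simp
  qed
  moreover have "(d, v, b) \<in> \<Gamma>'"
    using intro[OF partial_hom_graphD(3)[OF \<Gamma>], of 1 d] C.gr_one by simp
  ultimately show ?thesis by blast
qed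

lemma partial_hom_maximal:
  assumes N: "graded_module C_gr sN N" and \<Gamma>: "partial_hom_graph sN N \<Gamma>"
  obtains \<Delta> where "partial_hom_graph sN N \<Delta>" "\<Gamma> \<subseteq> \<Delta>" "\<And>d v. v \<in> N d \<Longrightarrow> \<exists>c. (d, v, c) \<in> \<Delta>"
proof -
  let ?P = "{\<Delta>. partial_hom_graph sN N \<Delta> \<and> \<Gamma> \<subseteq> \<Delta>}"
  have "\<exists>M\<in>?P. \<forall>X\<in>?P. M \<subseteq> X \<longrightarrow> X = M"
  proof (rule subset_Zorn_nonempty)
    show "?P \<noteq> {}" using \<Gamma> by blast
    fix \<C> assume ne: "\<C> \<noteq> {}" and chain: "subset.chain ?P \<C>"
    have P: "partial_hom_graph sN N X" "\<Gamma> \<subseteq> X" if "X \<in> \<C>" for X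
      using chain that unfolding subset_chain_def by auto
    have two: "\<exists>X\<in>\<C>. s \<in> X \<and> t \<in> X" if st: "s \<in> \<Union>\<C>" "t \<in> \<Union>\<C>" for s t
    proof -
      obtain X Y where XY: "X \<in> \<C>" "s \<in> X" "Y \<in> \<C>" "t \<in> Y" using st by blast
      then have "X \<subseteq> Y \<or> Y \<subseteq> X" using chain unfolding subset_chain_def by blast
      then show ?thesis using XY by blast
    qed
    have "partial_hom_graph sN N (\<Union>\<C>)"
      unfolding partial_hom_graph_def
    proof (intro conjI allI impI)
      fix d v c assume "(d, v, c) \<in> \<Union>\<C>"
      then obtain X where X: "X \<in> \<C>" "(d, v, c) \<in> X" by blast
      show "v \<in> N d" by (rule partial_hom_graphD(1)[OF P(1)[OF X(1)] X(2)])
      show "c \<in> C_gr d" by (rule partial_hom_graphD(2)[OF P(1)[OF X(1)] X(2)])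
    next
      fix d
      obtain X where X: "X \<in> \<C>" using ne by blast
      show "(d, 0, 0) \<in> \<Union>\<C>" using partial_hom_graphD(3)[OF P(1)[OF X]] X by blast
    next
      fix d v c v' c' assume "(d, v, c) \<in> \<Union>\<C>" "(d, v', c') \<in> \<Union>\<C>"
      from two[OF this] obtain X where X: "X \<in> \<C>" "(d, v, c) \<in> X" "(d, v', c') \<in> X" by blast
      show "(d, v + v', c + c') \<in> \<Union>\<C>"
        using partial_hom_graphD(4)[OF P(1)[OF X(1)] X(2,3)] X(1) by (rule UnionI[rotated])
    next
      fix d v c k a assume "(d, v, c) \<in> \<Union>\<C>" and a: "a \<in> C_gr k"
      then obtain X where X: "X \<in> \<C>" "(d, v, c) \<in> X" by blast
      show "(k + d, sN a v, a * c) \<in> \<Union>\<C>"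
        using partial_hom_graphD(5)[OF P(1)[OF X(1)] X(2) a] X(1) by (rule UnionI[rotated])
    next
      fix d c assume "(d, 0, c) \<in> \<Union>\<C>"
      then obtain X where X: "X \<in> \<C>" "(d, 0, c) \<in> X" by blast
      show "c = 0" by (rule partial_hom_graphD(6)[OF P(1)[OF X(1)] X(2)])
    qed
    then show "\<Union>\<C> \<in> ?P" using ne P(2) by blast
  qed
  then obtain \<Delta> where \<Delta>: "partial_hom_graph sN N \<Delta>" "\<Gamma> \<subseteq> \<Delta>"
    and max: "\<forall>X\<in>?P. \<Delta> \<subseteq> X \<longrightarrow> X = \<Delta>" by blast
  have "\<exists>c. (d, v, c) \<in> \<Delta>" if v: "v \<in> N d" for d v
  proof -
    obtain X c where X: "partial_hom_graph sN N X" "\<Delta> \<subseteq> X" "(d, v, c) \<in> X"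
      using partial_hom_extend[OF N \<Delta>(1) v] by blast
    then have "X = \<Delta>" using max \<Delta>(2) by blast
    then show ?thesis using X(3) by blast
  qed
  with \<Delta> show ?thesis by (rule that)
qed

lemma C_graded_hom_from_components:
  assumes N: "graded_module C_gr sN N"
    and phi: "\<And>d v. v \<in> N d \<Longrightarrow> phi d v \<in> C_gr d"
      "\<And>d v w. v \<in> N d \<Longrightarrow> w \<in> N d \<Longrightarrow> phi d (v + w) = phi d v + phi d w"
      "\<And>d v k a. v \<in> N d \<Longrightarrow> a \<in> C_gr k \<Longrightarrow> phi (k + d) (sN a v) = a * phi d v"
  obtains g where "graded_hom sN N (*) C_gr g" "\<And>d v. v \<in> N d \<Longrightarrow> g v = phi d v"
proof -
  interpret N: graded_module C_gr sN N by (rule N)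
  have phi0: "phi d 0 = 0" for d using phi(2)[OF N.gr_zero N.gr_zero, of d] by simp
  define g where "g u = (\<Sum>d | component N u d \<noteq> 0. phi d (component N u d))" for u
  have g_sum: "g u = (\<Sum>d\<in>D. phi d (component N u d))"
    if "finite D" "{d. component N u d \<noteq> 0} \<subseteq> D" for u D
    unfolding g_def by (rule sum.mono_neutral_left) (use that phi0 in auto)
  have homogeneous: "g v = phi d v" if "v \<in> N d" for d v
  proof -
    have "component N v e = (if e = d then v else 0)" for e
      by (rule N.component_homogeneous[OF that])
    then have "g v = (\<Sum>e\<in>{d}. phi e (component N v e))"
      by (intro g_sum) (simp, simp add: subset_iff)
    then show ?thesis using N.component_homogeneous[OF that, of d] by simp
  qed
  have g0: "g 0 = 0" using homogeneous[OF N.gr_zero, of 0] phi0 by simp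
  have add: "g (u + v) = g u + g v" if "u \<in> total N" "v \<in> total N" for u v
  proof -
    let ?D = "{d. component N u d \<noteq> 0} \<union> {d. component N v d \<noteq> 0}"
    have fin: "finite ?D" using N.component_total(2) that by simp
    have "g (u + v) = (\<Sum>d\<in>?D. phi d (component N (u + v) d))"
      by (rule g_sum[OF fin]) (auto simp: N.component_add[OF that])
    also have "\<dots> = (\<Sum>d\<in>?D. phi d (component N u d) + phi d (component N v d))"
      using that by (intro sum.cong) (auto simp: N.component_add N.component_total phi(2))
    also have "\<dots> = g u + g v"
      unfolding sum.distrib using g_sum[OF fin, of u] g_sum[OF fin, of v] by auto
    finally show ?thesis .
  qed
  have sum: "sum u F \<in> total N \<and> g (sum u F) = (\<Sum>x\<in>F. g (u x))"
    if "\<And>x. x \<in> F \<Longrightarrow> u x \<in> total N" for u and F :: "int set"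
    using that
    by (induction F rule: infinite_finite_induct)
      (auto simp: add N.component_add N.total_zero g0)
  have scale_homogeneous: "g (sN a u) = a * g u" if a: "a \<in> C_gr k" and u: "u \<in> total N" for a k u
  proof -
    let ?D = "{d. component N u d \<noteq> 0}"
    have uD: "u = (\<Sum>d\<in>?D. component N u d)" by (rule N.component_total(3)[OF u])
    have "g (sN a u) = g (\<Sum>d\<in>?D. sN a (component N u d))"
      by (subst uD) (simp only: N.scale_sum_right)
    also have "\<dots> = (\<Sum>d\<in>?D. g (sN a (component N u d)))"
      using N.component_scale(1)[OF a N.total_homogeneous[OF N.component_total(1)[OF u]]]
      by (intro sum[THEN conjunct2])
    also have "\<dots> = (\<Sum>d\<in>?D. a * phi d (component N u d))"
      using homogeneous[OF N.gr_scale[OF a N.component_total(1)[OF u]]]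
        phi(3)[OF N.component_total(1)[OF u] a] by simp
    finally show ?thesis by (simp add: g_def sum_distrib_left)
  qed
  have scale: "g (sN a u) = a * g u" if u: "u \<in> total N" for a u
  proof -
    let ?D = "{d. component C_gr a d \<noteq> 0}"
    have aD: "a = (\<Sum>d\<in>?D. component C_gr a d)" by (rule C.component_total(3)) simp
    have a: "component C_gr a d \<in> C_gr d" for d by (rule C.component_total) simp
    have "g (sN a u) = g (\<Sum>d\<in>?D. sN (component C_gr a d) u)"
      by (subst aD) (simp only: N.scale_sum_left)
    also have "\<dots> = (\<Sum>d\<in>?D. g (sN (component C_gr a d) u))"
      using N.component_scale(1)[OF a u] by (intro sum[THEN conjunct2])
    also have "\<dots> = (\<Sum>d\<in>?D. component C_gr a d) * g u"
      unfolding sum_distrib_right using scale_homogeneous[OF a u] by simp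
    finally show ?thesis using aD by simp
  qed
  have "graded_hom sN N (*) C_gr g"
    unfolding graded_hom_def using add scale homogeneous phi(1) by auto
  then show ?thesis using homogeneous that by blast
qed

text \<open>A homomorphism on a submodule has a maximal extension, which is defined everywhere because any
  element outside its domain could be added.\<close>

theorem C_self_injective:
  "graded_self_injective C_gr TYPE('m::ab_group_add) TYPE('n::ab_group_add)"
  unfolding graded_self_injective_def graded_injective_def
proof (intro conjI allI impI)
  show "graded_module C_gr (*) C_gr" by (rule C.graded_module_axioms)
  fix sM :: "ringC \<Rightarrow> 'm \<Rightarrow> 'm" and M and sN :: "ringC \<Rightarrow> 'n \<Rightarrow> 'n" and N i f
  assume "graded_module C_gr sM M \<and> graded_module C_gr sN N \<and>
    graded_hom sM M sN N i \<and> inj_on i (total M) \<and> graded_hom sM M (*) C_gr f"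
  then have M: "graded_module C_gr sM M" and N: "graded_module C_gr sN N"
    and i: "graded_hom sM M sN N i" and inj: "inj_on i (total M)" and f: "graded_hom sM M (*) C_gr f"
    by auto
  interpret M: graded_module C_gr sM M by (rule M)
  interpret N: graded_module C_gr sN N by (rule N)
  have i_add: "i (u + v) = i u + i v" if "u \<in> total M" "v \<in> total M" for u v
    using i that by (simp add: graded_hom_def)
  have f_add: "f (u + v) = f u + f v" if "u \<in> total M" "v \<in> total M" for u v
    using f that by (simp add: graded_hom_def)
  have i_0: "i 0 = 0" using i_add[OF M.total_zero M.total_zero] by simp
  have f_0: "f 0 = 0" using f_add[OF M.total_zero M.total_zero] by simp
  define \<Gamma> where "\<Gamma> = {(d, i u, f u) | d u. u \<in> M d}"
  have intro: "(d, i u, f u) \<in> \<Gamma>" if "u \<in> M d" for d u using that unfolding \<Gamma>_def by blast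
  have "partial_hom_graph sN N \<Gamma>"
    unfolding partial_hom_graph_def
  proof (intro conjI allI impI)
    fix d v c assume "(d, v, c) \<in> \<Gamma>"
    then show "v \<in> N d" "c \<in> C_gr d"
      using i f unfolding \<Gamma>_def graded_hom_def by blast+
  next
    show "(d, 0, 0) \<in> \<Gamma>" for d using intro[OF M.gr_zero] by (simp add: i_0 f_0)
  next
    fix d v c v' c' assume "(d, v, c) \<in> \<Gamma>" "(d, v', c') \<in> \<Gamma>"
    then obtain u u' where *: "u \<in> M d" "v = i u" "c = f u" "u' \<in> M d" "v' = i u'" "c' = f u'"
      unfolding \<Gamma>_def by blast
    then show "(d, v + v', c + c') \<in> \<Gamma>"
      using intro[OF M.gr_add[OF *(1,4)]] by (simp add: i_add f_add M.total_homogeneous)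
  next
    fix d v c k a assume "(d, v, c) \<in> \<Gamma>" and a: "a \<in> C_gr k"
    then obtain u where *: "u \<in> M d" "v = i u" "c = f u" unfolding \<Gamma>_def by blast
    have "i (sM a u) = sN a (i u)" "f (sM a u) = a * f u"
      using i f M.total_homogeneous[OF *(1)] by (auto simp: graded_hom_def)
    then show "(k + d, sN a v, a * c) \<in> \<Gamma>"
      using intro[OF M.gr_scale[OF a *(1)]] * by simp
  next
    fix d c assume "(d, 0, c) \<in> \<Gamma>"
    then obtain u where *: "u \<in> M d" "0 = i u" "c = f u" unfolding \<Gamma>_def by blast
    then have "u = 0"
      using inj_onD[OF inj, of u 0] i_0 M.total_homogeneous M.total_zero by metis
    then show "c = 0" using * f_0 by simp
  qed
  then obtain \<Delta> where \<Delta>: "partial_hom_graph sN N \<Delta>" "\<Gamma> \<subseteq> \<Delta>"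
    "\<And>d v. v \<in> N d \<Longrightarrow> \<exists>c. (d, v, c) \<in> \<Delta>"
    using partial_hom_maximal[OF N] by blast
  have unique: "c = c'" if "(d, v, c) \<in> \<Delta>" "(d, v, c') \<in> \<Delta>" for d v c c'
  proof -
    have "- v \<in> N d" using partial_hom_graphD(1)[OF \<Delta>(1) that(1)] by (rule N.gr_neg)
    then obtain e where e: "(d, - v, e) \<in> \<Delta>" using \<Delta>(3) by blast
    have "c + e = 0" "c' + e = 0"
      using partial_hom_graphD(6)[OF \<Delta>(1)] partial_hom_graphD(4)[OF \<Delta>(1) that(1) e]
        partial_hom_graphD(4)[OF \<Delta>(1) that(2) e] by auto
    then show ?thesis by (metis add_right_cancel)
  qed
  define phi where "phi d v = (THE c. (d, v, c) \<in> \<Delta>)" for d v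
  have phi: "phi d v = c" if "(d, v, c) \<in> \<Delta>" for d v c
    unfolding phi_def using that unique by blast
  have in_\<Delta>: "(d, v, phi d v) \<in> \<Delta>" if "v \<in> N d" for d v
    using \<Delta>(3)[OF that] phi by blast
  obtain g where g: "graded_hom sN N (*) C_gr g" "\<And>d v. v \<in> N d \<Longrightarrow> g v = phi d v"
  proof (rule C_graded_hom_from_components[OF N, of phi])
    show "phi d v \<in> C_gr d" if "v \<in> N d" for d v
      using partial_hom_graphD(2)[OF \<Delta>(1) in_\<Delta>[OF that]] .
    show "phi d (v + w) = phi d v + phi d w" if "v \<in> N d" "w \<in> N d" for d v w
      by (rule phi) (rule partial_hom_graphD(4)[OF \<Delta>(1) in_\<Delta>[OF that(1)] in_\<Delta>[OF that(2)]])
    show "phi (k + d) (sN a v) = a * phi d v" if "v \<in> N d" "a \<in> C_gr k" for d v k a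
      by (rule phi) (rule partial_hom_graphD(5)[OF \<Delta>(1) in_\<Delta>[OF that(1)] that(2)])
  qed blast
  have "g (i u) = f u" if u: "u \<in> total M" for u
  proof -
    have hom: "g (i u) = f u" if "u \<in> M d" for d u
    proof -
      have "i u \<in> N d" using i that unfolding graded_hom_def by blast
      then show ?thesis using g(2) phi \<Delta>(2) intro[OF that] by (metis subsetD)
    qed
    obtain D c where c: "finite D" "\<And>d. d \<in> D \<Longrightarrow> c d \<in> M d" "u = (\<Sum>d\<in>D. c d)"
      using u unfolding total_def by auto
    have g_add: "g (u + v) = g u + g v" if "u \<in> total N" "v \<in> total N" for u v
      using g(1) that by (simp add: graded_hom_def)
    have i_tot: "i u \<in> total N" if "u \<in> total M" for u
    proof -
      obtain D c where c: "finite D" "\<And>d. d \<in> D \<Longrightarrow> c d \<in> M d" "u = (\<Sum>d\<in>D. c d)"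
        using \<open>u \<in> total M\<close> unfolding total_def by auto
      have "i (\<Sum>d\<in>D. c d) \<in> total N"
        using c(1,2)
      proof (induction D)
        case (insert x F)
        then have "c x \<in> total M" "sum c F \<in> total M"
          using M.total_homogeneous[OF insert.prems] by (auto intro: M.component_sum_distrib(1))
        moreover have "i (c x) \<in> total N"
        proof -
          have "i (c x) \<in> N x"
            using i insert.prems[of x] unfolding graded_hom_def by blast
          then show ?thesis by (rule N.total_homogeneous)
        qed
        ultimately show ?case using insert by (simp add: i_add N.component_add(1))
      qed (simp add: i_0 N.total_zero)
      then show ?thesis by (simp add: c(3))
    qed
    have "g (i (\<Sum>d\<in>D. c d)) = f (\<Sum>d\<in>D. c d)"
      using c(1,2)
    proof (induction D)
      case empty
      then show ?case using hom[OF M.gr_zero] by simp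
    next
      case (insert x F)
      then have t: "c x \<in> total M" "sum c F \<in> total M"
        using M.total_homogeneous[OF insert.prems] by (auto intro: M.component_sum_distrib(1))
      then show ?case using insert hom[of "c x" x] by (simp add: i_add f_add g_add i_tot)
    qed
    then show ?thesis by (simp add: c(3))
  qed
  then show "\<exists>g. graded_hom sN N (*) C_gr g \<and> (\<forall>u\<in>total M. g (i u) = f u)"
    using g(1) by blast
qed

section \<open>Coherence\<close>

lemma sum_fun_apply: "(\<Sum>x\<in>F. f x) i = (\<Sum>x\<in>F. f x i)"
  by (induction F rule: infinite_finite_induct) auto

lemma span_set_list:
  assumes "module sc"
  shows "v \<in> module.span sc (set xs) \<longleftrightarrow> (\<exists>r. v = (\<Sum>l<length xs. sc (r l) (xs ! l)))"
proof
  interpret module sc by (rule assms)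
  show "\<exists>r. v = (\<Sum>l<length xs. sc (r l) (xs ! l))" if "v \<in> span (set xs)"
    using that
  proof (induction rule: span_induct_alt)
    case base
    show ?case by (rule exI[of _ "\<lambda>_. 0"]) simp
  next
    case (step c x y)
    then obtain r k where r: "y = (\<Sum>l<length xs. sc (r l) (xs ! l))" "k < length xs" "x = xs ! k"
      by (auto simp: in_set_conv_nth)
    have "sc c x = (\<Sum>l<length xs. if l = k then sc c (xs ! l) else 0)"
      using r(2,3) by simp
    then have "sc c x + y = (\<Sum>l<length xs. (if l = k then sc c (xs ! l) else 0) + sc (r l) (xs ! l))"
      by (simp only: r(1) sum.distrib)
    also have "\<dots> = (\<Sum>l<length xs. sc ((if l = k then c else 0) + r l) (xs ! l))"
      by (rule sum.cong) (auto simp: scale_left_distrib)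
    finally show ?case by (rule exI[of _ "\<lambda>l. (if l = k then c else 0) + r l"])
  qed
  show "v \<in> span (set xs)" if ex: "\<exists>r. v = (\<Sum>l<length xs. sc (r l) (xs ! l))"
  proof -
    obtain r where "v = (\<Sum>l<length xs. sc (r l) (xs ! l))" using ex by blast
    also have "\<dots> \<in> span (set xs)" by (intro span_sum span_scale span_base) simp
    finally show ?thesis .
  qed
qed

definition vec_part :: "int list \<Rightarrow> int \<Rightarrow> (nat \<Rightarrow> ringC) \<Rightarrow> nat \<Rightarrow> ringC" where
  "vec_part ds k v = (\<lambda>i. if i < length ds then component C_gr (v i) (k - ds ! i) else 0)"

definition vec_degrees :: "int list \<Rightarrow> (nat \<Rightarrow> ringC) \<Rightarrow> int set" where
  "vec_degrees ds v = (\<Union>i<length ds. (\<lambda>d. d + ds ! i) ` {d. component C_gr (v i) d \<noteq> 0})"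

lemma finite_vec_degrees: "finite (vec_degrees ds v)"
  unfolding vec_degrees_def by (intro finite_UN_I finite_imageI C.component_total) auto

lemma vec_part_in_free: "vec_part ds k v \<in> free_gr C_gr ds k"
  by (auto simp: vec_part_def free_gr_def intro: C.component_total)

lemma vec_part_sum:
  assumes "i < length ds"
  shows "(\<Sum>k\<in>vec_degrees ds v. vec_part ds k v i) = v i"
proof -
  have "(\<Sum>k\<in>vec_degrees ds v. vec_part ds k v i) =
      (\<Sum>d\<in>(\<lambda>k. k - ds ! i) ` vec_degrees ds v. component C_gr (v i) d)"
    using assms by (subst sum.reindex) (auto simp: inj_on_def vec_part_def)
  also have "\<dots> = v i"
  proof (rule C.component_sum)
    show "{d. component C_gr (v i) d \<noteq> 0} \<subseteq> (\<lambda>k. k - ds ! i) ` vec_degrees ds v"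
    proof
      fix d assume "d \<in> {d. component C_gr (v i) d \<noteq> 0}"
      then have "d + ds ! i \<in> vec_degrees ds v"
        using assms unfolding vec_degrees_def by blast
      then show "d \<in> (\<lambda>k. k - ds ! i) ` vec_degrees ds v"
        by (rule rev_image_eqI) simp
    qed
  qed (simp_all add: finite_vec_degrees)
  finally show ?thesis .
qed

lemma vec_part_sum_vec:
  assumes "\<forall>i\<ge>length ds. v i = 0"
  shows "(\<Sum>k\<in>vec_degrees ds v. vec_part ds k v) = v"
proof
  fix i
  show "(\<Sum>k\<in>vec_degrees ds v. vec_part ds k v) i = v i"
    using assms vec_part_sum[of i ds v]
    by (cases "i < length ds") (auto simp: sum_fun_apply vec_part_def)
qed

lemma total_free_gr: "total (free_gr C_gr ds) = {v. \<forall>i\<ge>length ds. v i = 0}"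
proof (intro equalityI subsetI CollectI)
  fix v assume "v \<in> total (free_gr C_gr ds)"
  then show "\<forall>i\<ge>length ds. v i = 0"
    unfolding total_def free_gr_def by (auto simp: sum_fun_apply)
next
  fix v :: "nat \<Rightarrow> ringC" assume "v \<in> {v. \<forall>i\<ge>length ds. v i = 0}"
  then have "v = (\<Sum>k\<in>vec_degrees ds v. vec_part ds k v)" using vec_part_sum_vec[of ds v] by auto
  then show "v \<in> total (free_gr C_gr ds)"
    unfolding total_def using finite_vec_degrees[of ds v] vec_part_in_free[of ds _ v] by blast
qed

lemma vec_part_relation:
  assumes a: "\<And>j. j < length ds \<Longrightarrow> a j \<in> C_gr (ds ! j)"
  shows "(\<Sum>j<length ds. vec_part ds k v j * a j) = component C_gr (\<Sum>j<length ds. v j * a j) k"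
  unfolding C.component_sum_distrib(2)[OF C_total]
  by (rule sum.cong) (simp_all add: vec_part_def C_component_mult[OF a])

text \<open>The homogeneous parts of the stable generators generate all syzygies. For a homogeneous syzygy
  one compares degrees modulo a truncation ideal that is deep enough to be invisible in the
  degrees of its entries.\<close>

lemma syzygies_finitely_generated:
  assumes a: "\<And>j. j < length ds \<Longrightarrow> a j \<in> C_gr (ds ! j)"
  shows "\<exists>T. finite T \<and>
    (\<forall>(w, k)\<in>T. w \<in> free_gr C_gr ds k \<and> (\<Sum>j<length ds. w j * a j) = 0) \<and>
    (\<forall>v. (\<forall>i\<ge>length ds. v i = 0) \<longrightarrow> (\<Sum>j<length ds. v j * a j) = 0 \<longrightarrow> v \<in> vec_span (fst ` T))"
proof -
  let ?s = "length ds"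
  have "\<forall>j<?s. a j \<in> C_gr (ds ! j)" using a by blast
  from homogeneous_syzygies[OF this]
  obtain G m0 where G: "finite G" "\<forall>g\<in>G. (\<Sum>j<?s. g j * a j) = 0"
    "\<forall>m\<ge>m0. \<forall>h. (\<Sum>j<?s. h j * a j) \<in> high m \<longrightarrow>
       (\<exists>d\<in>vec_span G. \<forall>j<?s. h j + d j \<in> high m)"
    by (elim exE conjE)
  define T where "T = (\<Union>g\<in>G. (\<lambda>k. (vec_part ds k g, k)) ` vec_degrees ds g)"
  have "finite T" unfolding T_def using G(1) finite_vec_degrees by blast
  have T: "w \<in> free_gr C_gr ds k \<and> (\<Sum>j<?s. w j * a j) = 0" if wk: "(w, k) \<in> T" for w k
  proof -
    obtain g where g: "g \<in> G" "w = vec_part ds k g" using wk unfolding T_def by auto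
    then have "(\<Sum>j<?s. w j * a j) = 0"
      using vec_part_relation[of ds a k g, OF a] G(2) by auto
    then show ?thesis using vec_part_in_free g(2) by simp
  qed
  have homogeneous: "v \<in> vec_span (fst ` T)"
    if v: "v \<in> free_gr C_gr ds e" and rel: "(\<Sum>j<?s. v j * a j) = 0" for v e
  proof -
    define m where "m = max m0 (nat (Max (insert 0 ((\<lambda>j. e - ds ! j) ` {..<?s}))))"
    have m0: "m0 \<le> m" by (simp add: m_def)
    have m: "e - ds ! j \<le> int m" if "j < ?s" for j
    proof -
      have "e - ds ! j \<le> Max (insert 0 ((\<lambda>j. e - ds ! j) ` {..<?s}))" using that by (intro Max_ge) auto
      then show ?thesis by (simp add: m_def)
    qed
    have "(\<Sum>j<?s. v j * a j) \<in> high m" using rel by simp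
    then obtain d where d: "d \<in> vec_span G" "\<forall>j<?s. v j + d j \<in> high m"
      using G(3)[rule_format, OF m0] by blast
    obtain h where h: "d = (\<Sum>g\<in>G. free_scale (h g) g)"
      using d(1) module.span_finite[OF module_free_scale G(1)] by auto
    define u where "u = (\<Sum>g\<in>G. \<Sum>k\<in>vec_degrees ds g.
      free_scale (component C_gr (h g) (e - k)) (vec_part ds k g))"
    have "v j = u j" for j
    proof (cases "j < ?s")
      case True
      have "component C_gr (d j) (e - ds ! j) = (\<Sum>g\<in>G. component C_gr (h g * g j) (e - ds ! j))"
        by (simp add: h sum_fun_apply free_scale_def C.component_sum_distrib)
      also have "\<dots> = u j"
        unfolding u_def sum_fun_apply
      proof (rule sum.cong)
        fix g
        have "h g * g j = (\<Sum>k\<in>vec_degrees ds g. h g * vec_part ds k g j)"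
          using vec_part_sum[OF True, of g] by (simp flip: sum_distrib_left)
        moreover have "component C_gr (h g * vec_part ds k g j) (e - ds ! j) =
            component C_gr (h g) (e - k) * vec_part ds k g j" for k
        proof -
          have "vec_part ds k g j \<in> C_gr (k - ds ! j)"
            using vec_part_in_free[of ds k g] True by (simp add: free_gr_def)
          from C_component_mult[OF this] show ?thesis by simp
        qed
        ultimately show "component C_gr (h g * g j) (e - ds ! j) =
            (\<Sum>k\<in>vec_degrees ds g. free_scale (component C_gr (h g) (e - k)) (vec_part ds k g) j)"
          by (simp add: C.component_sum_distrib free_scale_def)
      qed simp
      finally have dj: "component C_gr (d j) (e - ds ! j) = u j" .
      have vj: "v j \<in> C_gr (e - ds ! j)" using v True by (simp add: free_gr_def)
      have "component C_gr (v j + d j) (e - ds ! j) = v j + u j"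
        using C.component_homogeneous[OF vj] by (simp add: C.component_add dj)
      moreover have "component C_gr (v j + d j) (e - ds ! j) \<in> high m"
        using d(2) True by (intro high_component) simp
      moreover have "component C_gr (v j + d j) (e - ds ! j) \<in> C_gr (e - ds ! j)"
        by (rule C.component_total) simp
      ultimately have "v j + u j = 0" using C_gr_Int_high[OF _ _ m[OF True]] by metis
      then show ?thesis by (metis ringC_add_self_left add_0_right)
    next
      case False
      then show ?thesis
        using v by (simp add: free_gr_def u_def sum_fun_apply free_scale_def vec_part_def)
    qed
    then have "v = u" by (rule ext)
    moreover have "u \<in> vec_span (fst ` T)"
    proof -
      have "vec_part ds k g \<in> fst ` T" if "g \<in> G" "k \<in> vec_degrees ds g" for g k
        using that unfolding T_def by (force simp: image_UN)
      then show ?thesis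
        unfolding u_def
        by (intro module.span_sum[OF module_free_scale] module.span_scale[OF module_free_scale]
            module.span_base[OF module_free_scale]) auto
    qed
    ultimately show ?thesis by simp
  qed
  have "v \<in> vec_span (fst ` T)" if v: "\<forall>i\<ge>?s. v i = 0" and rel: "(\<Sum>j<?s. v j * a j) = 0" for v
  proof -
    have "vec_part ds k v \<in> vec_span (fst ` T)" for k
      using vec_part_relation[of ds a k v, OF a] rel
      by (intro homogeneous[OF vec_part_in_free[of ds k]]) simp
    then have "(\<Sum>k\<in>vec_degrees ds v. vec_part ds k v) \<in> vec_span (fst ` T)"
      by (intro module.span_sum[OF module_free_scale])
    then show ?thesis using vec_part_sum_vec[OF v] by simp
  qed
  then show ?thesis using \<open>finite T\<close> T by (intro exI[of _ T]) blast
qed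

text \<open>The presentation has one generator for each given element and one relation for each homogeneous
  syzygy in a finite generating set.\<close>

theorem C_coherent: "graded_coherent C_gr"
  unfolding graded_coherent_def
proof (intro conjI allI impI)
  show "graded_ring C_gr" by (rule C.graded_ring_axioms)
  fix S assume S: "finite S \<and> S \<subseteq> (\<Union>d. C_gr d)"
  let ?J = "\<lambda>d. ideal_gen S \<inter> C_gr d"
  obtain xs where xs: "set xs = S" using S finite_list by blast
  have "\<exists>deg. \<forall>x\<in>S. x \<in> C_gr (deg x)" using S by (intro bchoice) blast
  then obtain deg where deg: "\<forall>x\<in>S. x \<in> C_gr (deg x)" by blast
  define ds where "ds = map deg xs"
  let ?s = "length ds"
  define a where "a j = xs ! j" for j
  have a: "a j \<in> C_gr (ds ! j)" if "j < ?s" for j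
    using that deg xs nth_mem by (fastforce simp: ds_def a_def)
  define g where "g v = (\<Sum>j<?s. v j * a j)" for v
  have ideal: "u \<in> ideal_gen S \<longleftrightarrow> (\<exists>v. u = g v)" for u
    using span_set_list[OF module_times, of u xs] by (simp add: ideal_gen_def xs g_def a_def ds_def)
  have g_cong: "g v = g w" if "\<And>j. j < ?s \<Longrightarrow> v j = w j" for v w
    unfolding g_def using that by (intro sum.cong) auto
  have J_total: "total ?J = ideal_gen S"
  proof (intro equalityI subsetI)
    fix u assume "u \<in> total ?J"
    then obtain D m where "\<forall>d\<in>D. m d \<in> ?J d" "u = (\<Sum>d\<in>D. m d)" unfolding total_def by blast
    then show "u \<in> ideal_gen S"
      unfolding ideal_gen_def by (auto intro!: module.span_sum[OF module_times])
  next
    fix u assume "u \<in> ideal_gen S"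
    then obtain v where v: "u = g v" using ideal by blast
    have "component C_gr u d \<in> ?J d" for d
    proof -
      have "component C_gr u d = g (vec_part ds d v)"
        unfolding v g_def using vec_part_relation[of ds a d v, OF a] by simp
      then have "component C_gr u d \<in> ideal_gen S" using ideal by blast
      moreover have "component C_gr u d \<in> C_gr d" by (rule C.component_total) simp
      ultimately show ?thesis by blast
    qed
    moreover have "finite {d. component C_gr u d \<noteq> 0}"
      "u = (\<Sum>d | component C_gr u d \<noteq> 0. component C_gr u d)"
      by (rule C.component_total; simp)+
    ultimately show "u \<in> total ?J" unfolding total_def by blast
  qed
  have J_module: "graded_module C_gr (*) ?J"
  proof -
    have "graded_group ?J"
    proof
      show "0 \<in> ?J d" for d by (simp add: ideal_gen_0 C.gr_zero)
      show "u - v \<in> ?J d" if "u \<in> ?J d" "v \<in> ?J d" for u v d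
        using that by (blast intro: ideal_gen_diff C.gr_diff)
      show "m d = 0" if "finite D" "\<And>d. d \<in> D \<Longrightarrow> m d \<in> ?J d" "(\<Sum>d\<in>D. m d) = 0" "d \<in> D" for D m d
        using C.gr_independent[of D m d] that by blast
    qed
    then show ?thesis
      by (intro graded_module.intro C.graded_ring_axioms module_times graded_module_axioms.intro)
        (auto intro: ideal_gen_mult C.gr_mult)
  qed
  obtain T where T: "finite T"
    "\<forall>(w, k)\<in>T. w \<in> free_gr C_gr ds k \<and> g w = 0"
    "\<forall>v. (\<forall>i\<ge>?s. v i = 0) \<longrightarrow> g v = 0 \<longrightarrow> v \<in> vec_span (fst ` T)"
    using syzygies_finitely_generated[of ds a, OF a] unfolding g_def by blast
  obtain ps where ps: "set ps = T" using T(1) finite_list by blast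
  define es where "es = map snd ps"
  define f where "f r = (\<Sum>l<length es. free_scale (r l) (map fst ps ! l))" for r :: "nat \<Rightarrow> ringC"
  have w: "map fst ps ! l \<in> free_gr C_gr ds (es ! l)" "g (map fst ps ! l) = 0" if "l < length es" for l
  proof -
    have "ps ! l \<in> T" using that ps nth_mem by (auto simp: es_def)
    then show "map fst ps ! l \<in> free_gr C_gr ds (es ! l)" "g (map fst ps ! l) = 0"
      using that T(2) by (auto simp: es_def case_prod_beta)
  qed
  have g_add: "g (v + w) = g v + g w" for v w
    by (simp add: g_def distrib_right sum.distrib)
  have g_scale: "g (free_scale c v) = c * g v" for c v
    by (simp add: g_def free_scale_def sum_distrib_left mult.assoc)
  have f_hom: "graded_hom free_scale (free_gr C_gr es) free_scale (free_gr C_gr ds) f"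
    unfolding graded_hom_def
  proof (intro conjI ballI allI)
    show "f (u + v) = f u + f v" for u v
      by (simp add: f_def module.scale_left_distrib[OF module_free_scale] sum.distrib)
    show "f (free_scale c u) = free_scale c (f u)" for c u
      by (simp add: f_def free_scale_def fun_eq_iff sum_fun_apply sum_distrib_left mult.assoc)
    show "f ` free_gr C_gr es k \<subseteq> free_gr C_gr ds k" for k
    proof (rule image_subsetI)
      fix r assume r: "r \<in> free_gr C_gr es k"
      have "f r j \<in> C_gr (k - ds ! j)" if j: "j < ?s" for j
        unfolding f_def sum_fun_apply free_scale_def
      proof (rule C.gr_sum)
        fix l assume "l \<in> {..<length es}"
        then have "r l \<in> C_gr (k - es ! l)" "(map fst ps ! l) j \<in> C_gr (es ! l - ds ! j)"
          using r w(1)[of l] j by (auto simp: free_gr_def)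
        from C.gr_mult[OF this] show "r l * (map fst ps ! l) j \<in> C_gr (k - ds ! j)" by simp
      qed
      moreover have "f r j = 0" if j: "j \<ge> ?s" for j
        unfolding f_def sum_fun_apply free_scale_def
        using w(1) j by (intro sum.neutral) (auto simp: free_gr_def)
      ultimately show "f r \<in> free_gr C_gr ds k" by (simp add: free_gr_def)
    qed
  qed
  have g_hom: "graded_hom free_scale (free_gr C_gr ds) (*) ?J g"
    unfolding graded_hom_def
  proof (intro conjI ballI allI)
    show "g ` free_gr C_gr ds k \<subseteq> ?J k" for k
    proof (rule image_subsetI)
      fix v assume v: "v \<in> free_gr C_gr ds k"
      have "g v \<in> C_gr k"
        unfolding g_def
      proof (rule C.gr_sum)
        fix j assume "j \<in> {..<?s}"
        then have "v j \<in> C_gr (k - ds ! j)" "a j \<in> C_gr (ds ! j)" using v a by (auto simp: free_gr_def)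
        from C.gr_mult[OF this] show "v j * a j \<in> C_gr k" by simp
      qed
      then show "g v \<in> ?J k" using ideal by blast
    qed
  qed (simp_all add: g_add g_scale)
  have exact: "f ` total (free_gr C_gr es) = {v \<in> total (free_gr C_gr ds). g v = 0}"
  proof (intro equalityI subsetI)
    fix v assume "v \<in> f ` total (free_gr C_gr es)"
    then obtain r where v: "v = f r" by blast
    have "g (f r) = (\<Sum>l<length es. r l * g (map fst ps ! l))"
    proof -
      have "g (\<Sum>l\<in>F. free_scale (r l) (map fst ps ! l)) = (\<Sum>l\<in>F. r l * g (map fst ps ! l))"
        if "finite F" for F
        using that
      proof (induction F)
        case empty
        show ?case by (simp add: g_def)
      next
        case (insert l F)
        then show ?case by (simp only: sum.insert[OF insert.hyps] g_add g_scale)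
      qed
      then show ?thesis by (simp add: f_def)
    qed
    also have "\<dots> = 0" using w(2) by simp
    finally have "g v = 0" by (simp add: v)
    moreover have "\<forall>i\<ge>?s. v i = 0"
      unfolding v f_def sum_fun_apply free_scale_def
      using w(1) by (auto simp: free_gr_def intro!: sum.neutral)
    ultimately show "v \<in> {v \<in> total (free_gr C_gr ds). g v = 0}" by (simp add: total_free_gr)
  next
    fix v assume "v \<in> {v \<in> total (free_gr C_gr ds). g v = 0}"
    then have "v \<in> vec_span (set (map fst ps))" using T(3) by (simp add: total_free_gr ps)
    then obtain r where r: "v = (\<Sum>l<length es. free_scale (r l) (map fst ps ! l))"
      unfolding span_set_list[OF module_free_scale] by (auto simp: es_def)
    let ?r = "\<lambda>l. if l < length es then r l else 0"
    have "v = f ?r" unfolding r f_def by (rule sum.cong) auto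
    moreover have "?r \<in> total (free_gr C_gr es)" by (simp add: total_free_gr)
    ultimately show "v \<in> f ` total (free_gr C_gr es)" by blast
  qed
  have surj: "g ` total (free_gr C_gr ds) = total ?J"
  proof (intro equalityI subsetI)
    fix u assume "u \<in> total ?J"
    then obtain v where v: "u = g v" using ideal unfolding J_total by blast
    let ?v = "\<lambda>j. if j < ?s then v j else 0"
    have "g ?v = u" unfolding v by (rule g_cong) simp
    moreover have "?v \<in> total (free_gr C_gr ds)" by (simp add: total_free_gr)
    ultimately show "u \<in> g ` total (free_gr C_gr ds)" by blast
  qed (use ideal J_total in blast)
  show "finitely_presented C_gr (*) ?J"
    unfolding finitely_presented_def
    using J_module f_hom g_hom exact surj by blast
qed

section \<open>The elements \<open>x\<^sub>n\<close>\<close>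

lemma ringC_square_add: "(u + v) ^ 2 = u ^ 2 + (v ^ 2 :: ringC)"
proof -
  have "(u + v) ^ 2 = u ^ 2 + v ^ 2 + (u * v + u * v)"
    by (simp add: power2_eq_square algebra_simps)
  then show ?thesis by simp
qed

lemma ringC_square_sum: "(sum f F) ^ 2 = (\<Sum>i\<in>F. f i ^ 2 :: ringC)"
  by (induction F rule: infinite_finite_induct) (auto simp: ringC_square_add)

lemma frobenius_sum_Suc:
  fixes z :: "nat \<Rightarrow> ringC"
  shows "(\<Sum>i=0..Suc n. z (Suc n - i) ^ (2 ^ i)) = z (Suc n) + (\<Sum>i=0..n. z (n - i) ^ (2 ^ i)) ^ 2"
proof -
  have "(\<Sum>i=0..Suc n. z (Suc n - i) ^ (2 ^ i)) =
      z (Suc n) + (\<Sum>i=0..n. z (n - i) ^ (2 ^ Suc i))"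
    by (subst sum.atLeast0_atMost_Suc_shift) (simp add: o_def)
  also have "(\<Sum>i=0..n. z (n - i) ^ (2 ^ Suc i)) = (\<Sum>i=0..n. (z (n - i) ^ (2 ^ i)) ^ 2)"
    by (simp add: mult.commute flip: power_mult)
  finally show ?thesis by (simp only: ringC_square_sum)
qed

lemma x_C_characterization:
  "z = x_C \<longleftrightarrow> (\<forall>n. y_C n = (\<Sum>i=0..n. z (n - i) ^ (2 ^ i)))"
proof
  assume z: "z = x_C"
  show "\<forall>n. y_C n = (\<Sum>i=0..n. z (n - i) ^ (2 ^ i))"
  proof
    fix n
    show "y_C n = (\<Sum>i=0..n. z (n - i) ^ (2 ^ i))"
    proof (induction n)
      case (Suc n)
      show ?case unfolding frobenius_sum_Suc Suc[symmetric] by (simp add: z ac_simps)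
    qed (simp add: z)
  qed
next
  assume y: "\<forall>n. y_C n = (\<Sum>i=0..n. z (n - i) ^ (2 ^ i))"
  show "z = x_C"
  proof
    fix n
    show "z n = x_C n"
    proof (cases n)
      case 0
      then show ?thesis using y[rule_format, of 0] by simp
    next
      case (Suc k)
      have "y_C (Suc k) = z (Suc k) + y_C k ^ 2"
        using y[rule_format, of "Suc k"] y[rule_format, of k] unfolding frobenius_sum_Suc by simp
      then show ?thesis by (simp add: Suc add.assoc)
    qed
  qed
qed

section \<open>The reduced quotient\<close>

lemma nilradical_power: "u ^ k \<in> nilradical \<Longrightarrow> u \<in> (nilradical :: 'a::comm_ring_1 set)"
  unfolding nilradical_def by (auto simp flip: power_mult)

text \<open>Cubing turns \<open>y\<^sub>i x\<^sub>j\<close> into a multiple of \<open>y\<^sub>i\<^sub>+\<^sub>1 x\<^sub>j\<close>, and \<open>y\<^sub>j\<^sub>-\<^sub>1 x\<^sub>j = 0\<close>.\<close>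

lemma y_mult_x_nilpotent: "y_C i * x_C (Suc (i + r)) \<in> nilradical"
proof (induction r arbitrary: i)
  case 0
  then show ?case using nilradical_0 y_mult_x[of i] by (simp del: x_C.simps)
next
  case (Suc r)
  let ?x = "x_C (Suc (i + Suc r))"
  have "y_C (Suc i) * ?x \<in> nilradical"
    using Suc[of "Suc i"] by (simp del: x_C.simps)
  then have "(y_C i * ?x ^ 2) * (y_C (Suc i) * ?x) \<in> nilradical"
    by (rule nilradical_mult)
  also have "(y_C i * ?x ^ 2) * (y_C (Suc i) * ?x) = (y_C i * ?x) ^ 3"
    unfolding power_mult_distrib y_cubed power3_eq_cube[of ?x] power2_eq_square by (simp only: ac_simps)
  finally show ?case by (rule nilradical_power)
qed

lemma x_mult_x_nilpotent: assumes "i \<noteq> j" shows "x_C i * x_C j \<in> nilradical"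
proof -
  have y: "y_C i * x_C j \<in> nilradical" if "i < j" for i j
    using y_mult_x_nilpotent[of i "j - Suc i"] that by (simp del: x_C.simps)
  have less: "x_C i * x_C j \<in> nilradical" if "i < j" for i j
  proof (cases i)
    case 0
    then show ?thesis using y[of 0 j] that by simp
  next
    case (Suc k)
    have "x_C i * x_C j = y_C i * x_C j + y_C k * (y_C k * x_C j)"
      by (simp add: Suc distrib_right power2_eq_square mult.assoc)
    moreover have "\<dots> \<in> nilradical"
      using y[of i j] y[of k j] that Suc by (intro nilradical_add nilradical_mult[of "y_C k * x_C j"]) auto
    ultimately show ?thesis by (simp only:)
  qed
  show ?thesis
  proof (cases "i < j")
    case False
    then show ?thesis using less[of j i] assms by (simp add: mult.commute)
  qed (rule less)
qed

lemma abs_redC_add: "abs_redC (u + v) = abs_redC u + abs_redC v"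
  by (simp add: plus_redC.abs_eq)

lemma abs_redC_mult: "abs_redC (u * v) = abs_redC u * abs_redC v"
  by (simp add: times_redC.abs_eq)

lemma abs_redC_0: "abs_redC 0 = 0" and abs_redC_1: "abs_redC 1 = 1"
  by (simp_all add: zero_redC_def one_redC_def)

lemma redC_char2: "(1::redC) + 1 = 0"
  by (simp flip: abs_redC_1 abs_redC_add add: abs_redC_0)

lemma abs_redC_surj: "\<exists>v. u = abs_redC v"
  by (metis Quotient3_abs_rep[OF Quotient3_redC])

lemma x_red_mult: "i \<noteq> j \<Longrightarrow> x_red i * x_red j = 0"
  unfolding x_red_def abs_redC_mult[symmetric] abs_redC_0[symmetric] redC.abs_eq_iff
  using x_mult_x_nilpotent by simp

lemma f2_eval_hom:
  fixes a :: "nat \<Rightarrow> 'a::comm_ring_1" and f :: "'a \<Rightarrow> 'b::comm_ring_1"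
  assumes "(1::'a) + 1 = 0" "(1::'b) + 1 = 0" "f 0 = 0" "f 1 = 1"
    and "\<And>u v. f (u + v) = f u + f v" "\<And>u v. f (u * v) = f u * f v"
  shows "f (f2_eval a p) = f2_eval (\<lambda>i. f (a i)) p"
proof (induction p rule: f2_poly_induct)
  case (add m q)
  have power: "f (u ^ k) = f u ^ k" for u k by (induction k) (simp_all add: assms)
  have "f (\<Prod>i\<in>F. u i) = (\<Prod>i\<in>F. f (u i))" for F :: "nat set" and u
    by (induction F rule: infinite_finite_induct) (simp_all add: assms)
  then have "f (monomial_value a m) = monomial_value (\<lambda>i. f (a i)) m"
    by (simp add: monomial_value_def power)
  then show ?case using add by (simp add: f2_eval_add[OF assms(1)] f2_eval_add[OF assms(2)] assms(5))
qed (simp add: assms(3))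

lemma f2_eval_x_red: "f2_eval x_red p = abs_redC (f2_eval x_C p)"
  unfolding x_red_def
  by (rule f2_eval_hom[symmetric])
    (simp_all only: ringC_char2 redC_char2 abs_redC_0 abs_redC_1 abs_redC_add abs_redC_mult)

subsection \<open>The coordinate axes\<close>

lemma bit_poly_add_self [simp]: "(p::bit poly) + p = 0"
  by (rule poly_eqI) (simp only: coeff_add bit_add_self coeff_0)

lemma bit_poly_char2: "(1::bit poly) + 1 = 0"
  by (rule bit_poly_add_self)

text \<open>The images of the \<open>y\<^sub>j\<close>, forced by \<open>y\<^sub>j = \<Sum> x\<^sub>j\<^sub>-\<^sub>i ^ (2 ^ i)\<close> when \<open>x\<^sub>n\<close> maps to \<open>t\<close> and the other
  \<open>x\<^sub>i\<close> to zero.\<close>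

definition axis_value :: "nat \<Rightarrow> nat \<Rightarrow> bit poly" where
  "axis_value n j = (if j < n then 0 else monom 1 (2 ^ (j - n)))"

lemma axis_relation: "axis_value n i ^ 3 + axis_value n i * axis_value n (Suc i) = 0"
proof (cases "i < n")
  case False
  then have "2 ^ (i - n) * 3 = 2 ^ (i - n) + (2 ^ (Suc i - n) :: nat)"
    by (simp add: Suc_diff_le)
  moreover have "axis_value n i ^ 3 = monom 1 (2 ^ (i - n) * 3)"
    "axis_value n i * axis_value n (Suc i) = monom 1 (2 ^ (i - n) + 2 ^ (Suc i - n))"
    using False by (simp_all add: axis_value_def monom_power mult_monom)
  ultimately show ?thesis by (simp only: bit_poly_add_self)
qed (simp add: axis_value_def)

text \<open>Geometrically, restriction to the \<open>n\<close>-th coordinate axis of the space with coordinates \<open>x\<^sub>j\<close>. It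
  factors through the reduced quotient because its target is a domain.\<close>

lift_definition axis :: "nat \<Rightarrow> ringC \<Rightarrow> bit poly" is "\<lambda>n. f2_eval (axis_value n)"
proof -
  fix n p q assume "p - q \<in> ideal_C"
  then have "f2_eval (axis_value n) (p - q) = 0"
    unfolding ideal_C_def ideal_gen_def
  proof (induction rule: module.span_induct_alt[OF module_times, consumes 1, case_names base step])
    case (step c x y)
    then obtain i where x: "x = var i ^ 3 + var i * var (Suc i)" by auto
    show ?case
      unfolding x f2_eval_add[OF bit_poly_char2] f2_eval_mult[OF bit_poly_char2]
        f2_eval_power[OF bit_poly_char2] f2_eval_var axis_relation step.IH by simp
  qed simp
  moreover have "f2_eval (axis_value n) ((p - q) + q) =
      f2_eval (axis_value n) (p - q) + f2_eval (axis_value n) q"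
    by (rule f2_eval_add[OF bit_poly_char2])
  ultimately show "f2_eval (axis_value n) p = f2_eval (axis_value n) q"
    by (simp only: diff_add_cancel add_0_left)
qed

lemma axis_add: "axis n (u + v) = axis n u + axis n v"
  by transfer (rule f2_eval_add[OF bit_poly_char2])

lemma axis_mult: "axis n (u * v) = axis n u * axis n v"
  by transfer (rule f2_eval_mult[OF bit_poly_char2])

lemma axis_0 [simp]: "axis n 0 = 0"
  by (simp add: axis.abs_eq flip: abs_ringC_0)

lemma axis_1 [simp]: "axis n 1 = 1"
  by (simp add: axis.abs_eq flip: abs_ringC_1)

lemma axis_power: "axis n (u ^ k) = axis n u ^ k"
  by (induction k) (simp_all add: axis_mult)

lemma axis_y: "axis n (y_C j) = axis_value n j"
  unfolding y_C_def axis.abs_eq by simp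

lemma axis_x: "axis n (x_C j) = (if j = n then monom 1 1 else 0)"
proof (cases j)
  case 0
  then show ?thesis by (auto simp: axis_y axis_value_def)
next
  case (Suc k)
  consider "j < n" | "j = n" | "j > n" by linarith
  then show ?thesis
  proof cases
    case 3
    then have "2 ^ (j - n) = 2 ^ (k - n) * (2::nat)" using Suc by (simp add: Suc_diff_le)
    then show ?thesis using 3 Suc
      by (simp add: axis_add axis_power axis_y axis_value_def monom_power del: power_Suc)
  next
    case 2
    then have "n = Suc k" using Suc by simp
    then show ?thesis by (simp add: Suc axis_add axis_power axis_y axis_value_def)
  qed (use Suc in \<open>simp add: axis_add axis_power axis_y axis_value_def\<close>)
qed

lemma axis_nilradical: assumes "u \<in> nilradical" shows "axis n u = 0"
proof -
  obtain k where "u ^ k = 0" using assms by (auto simp: nilradical_def)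
  then have "axis n u ^ k = 0" by (simp flip: axis_power)
  then show ?thesis by simp
qed

lift_definition axis_red :: "nat \<Rightarrow> redC \<Rightarrow> bit poly" is axis
proof -
  fix n and u v :: ringC assume "u - v \<in> nilradical"
  then have "axis n (u + v) = 0" using axis_nilradical by simp
  then have "axis n u = - axis n v" by (simp add: axis_add eq_neg_iff_add_eq_0)
  also have "\<dots> = axis n v" by (simp add: neg_eq_iff_add_eq_0)
  finally show "axis n u = axis n v" .
qed

lemma axis_red_add: "axis_red n (u + v) = axis_red n u + axis_red n v"
  by transfer (rule axis_add)

lemma axis_red_mult: "axis_red n (u * v) = axis_red n u * axis_red n v"
  by transfer (rule axis_mult)

lemma axis_red_0 [simp]: "axis_red n 0 = 0"
  by (simp add: axis_red.abs_eq flip: abs_redC_0)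

lemma axis_red_1 [simp]: "axis_red n 1 = 1"
  by (simp add: axis_red.abs_eq flip: abs_redC_1)

lemma axis_red_sum: "axis_red n (sum f F) = (\<Sum>i\<in>F. axis_red n (f i))"
  by (induction F rule: infinite_finite_induct) (simp_all add: axis_red_add)

lemma axis_red_x: "axis_red n (x_red j) = (if j = n then monom 1 1 else 0)"
  unfolding x_red_def axis_red.abs_eq by (rule axis_x)

lemma coeff_monomial_value_axis:
  "coeff (monomial_value (\<lambda>j. if j = n then monom 1 1 else 0) m) k =
    (if m = delta n k then (1::bit) else 0)"
proof (cases "keys m \<subseteq> {n}")
  case True
  then have "m = delta n (lookup m n)"
    by (intro poly_mapping_eqI) (auto simp: lookup_single when_def in_keys_iff)
  then obtain l where m: "m = delta n l" by blast
  have "delta n l = delta n k \<longleftrightarrow> l = k" by (metis lookup_single_eq)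
  then show ?thesis by (simp add: m monom_power)
next
  case False
  then obtain i where i: "i \<in> keys m" "i \<noteq> n" by blast
  then have "monomial_value (\<lambda>j. if j = n then monom 1 1 else (0 :: bit poly)) m = 0"
    unfolding monomial_value_def by (intro prod_zero bexI[of _ i]) (auto simp: in_keys_iff)
  moreover have "m \<noteq> delta n k" using i by (auto split: if_splits)
  ultimately show ?thesis by simp
qed

text \<open>The coefficients of the pure powers in a polynomial can be recovered from its value at the
  \<open>x\<^sub>n\<close> by restricting to the axes.\<close>

lemma coeff_axis_red_eval: "coeff (axis_red n (f2_eval x_red p)) k = lookup p (delta n k)"
proof -
  have "axis_red n (f2_eval x_red p) = f2_eval (\<lambda>j. if j = n then monom 1 1 else 0) p"
    by (subst f2_eval_hom[OF redC_char2 bit_poly_char2])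
      (simp_all add: axis_red_add axis_red_mult axis_red_x)
  moreover have "coeff (f2_eval (\<lambda>j. if j = n then monom 1 1 else 0) p) k =
      lookup p (delta n k)"
  proof (induction p rule: f2_poly_induct)
    case (add m q)
    then show ?case
      by (simp add: f2_eval_add[OF bit_poly_char2] coeff_monomial_value_axis lookup_add lookup_single)
  qed simp
  ultimately show ?thesis by simp
qed

lemma mixed_monomial:
  assumes "\<And>n k. m \<noteq> delta n k"
  obtains i j m' where "i \<noteq> j" "m = m' + (delta i 1 + delta j 1)"
proof -
  have "m \<noteq> 0" using assms[of 0 0] by simp
  then obtain i where i: "i \<in> keys m" by (metis ex_in_conv keys_eq_empty)
  have "\<exists>j\<in>keys m. j \<noteq> i"
  proof (rule ccontr)
    assume "\<not> ?thesis"
    then have "m = delta i (lookup m i)"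
      by (intro poly_mapping_eqI) (auto simp: lookup_single when_def in_keys_iff)
    with assms show False by blast
  qed
  then obtain j where j: "j \<in> keys m" "j \<noteq> i" by blast
  have "m = (m - (delta i 1 + delta j 1)) + (delta i 1 + delta j 1)"
    by (rule poly_mapping_eqI)
      (use i j in \<open>auto simp: lookup_add lookup_minus lookup_single when_def in_keys_iff\<close>)
  with j(2) show ?thesis using that[of i j] by blast
qed

text \<open>A polynomial that vanishes on all axes contains no pure power and no constant term, so each of
  its monomials is divisible by a product of two different variables.\<close>

theorem kernel_x_red: "{p. f2_eval x_red p = 0} = ideal_gen {var i * var j | i j. i \<noteq> j}"
proof (intro equalityI subsetI)
  fix p assume "p \<in> {p. f2_eval x_red p = 0}"
  then have pure: "lookup p (delta n k) = 0" for n k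
    using coeff_axis_red_eval[of n p k] by simp
  have "Poly_Mapping.single m 1 \<in> ideal_gen {var i * var j | i j. i \<noteq> j}"
    if m: "m \<in> keys p" for m
  proof -
    have "m \<noteq> delta n k" for n k using m pure[of n k] by (auto simp: in_keys_iff)
    then obtain i j m' where ij: "i \<noteq> j" "m = m' + (delta i 1 + delta j 1)"
      by (rule mixed_monomial)
    have "Poly_Mapping.single m 1 = Poly_Mapping.single m' 1 * (var i * var j)"
      by (simp add: ij(2) var_def mult_single)
    also have "\<dots> \<in> ideal_gen {var i * var j | i j. i \<noteq> j}"
      using ij(1) by (intro ideal_gen_mult ideal_gen_base) blast
    finally show ?thesis .
  qed
  then show "p \<in> ideal_gen {var i * var j | i j. i \<noteq> j}"
    unfolding ideal_gen_def
    by (subst f2_poly_eq_sum_monomials) (rule module.span_sum[OF module_times])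
next
  fix p assume "p \<in> ideal_gen {var i * var j | i j. i \<noteq> j}"
  then have "f2_eval x_red p = 0"
    unfolding ideal_gen_def
  proof (induction rule: module.span_induct_alt[OF module_times, consumes 1, case_names base step])
    case (step c x y)
    then obtain i j where "x = var i * var j" "i \<noteq> j" by blast
    then show ?case
      using step.IH by (simp add: f2_eval_add[OF redC_char2] f2_eval_mult[OF redC_char2] x_red_mult)
  qed simp
  then show "p \<in> {p. f2_eval x_red p = 0}" by simp
qed

subsection \<open>Generation by the \<open>x\<^sub>n\<close>\<close>

lemma f2_poly_gr_add: "p \<in> f2_poly_gr d \<Longrightarrow> q \<in> f2_poly_gr d \<Longrightarrow> p + q \<in> f2_poly_gr d"
  using keys_add[of p q] unfolding f2_poly_gr_def by blast

lemma f2_poly_gr_mult: "p \<in> f2_poly_gr d \<Longrightarrow> q \<in> f2_poly_gr d' \<Longrightarrow> p * q \<in> f2_poly_gr (d + d')"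
  using keys_mult[of p q] unfolding f2_poly_gr_def by (fastforce simp: weight_add)

definition x_image :: "int \<Rightarrow> ringC set" where
  "x_image d = f2_eval x_C ` f2_poly_gr d"

lemma x_image_add: "u \<in> x_image d \<Longrightarrow> v \<in> x_image d \<Longrightarrow> u + v \<in> x_image d"
  unfolding x_image_def using f2_poly_gr_add by (auto simp flip: f2_eval_add[OF ringC_char2])

lemma x_image_mult: "u \<in> x_image d \<Longrightarrow> v \<in> x_image d' \<Longrightarrow> u * v \<in> x_image (d + d')"
  unfolding x_image_def using f2_poly_gr_mult by (auto simp flip: f2_eval_mult[OF ringC_char2])

lemma x_image_0: "0 \<in> x_image d"
  unfolding x_image_def by (rule image_eqI[of _ _ 0]) (simp_all add: f2_poly_gr_def)

lemma x_image_1: "1 \<in> x_image 0"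
  unfolding x_image_def by (rule image_eqI[of _ _ 1]) (simp_all add: f2_poly_gr_def)

lemma x_image_power: "u \<in> x_image d \<Longrightarrow> u ^ k \<in> x_image (int k * d)"
proof (induction k)
  case (Suc k)
  then have "u * u ^ k \<in> x_image (d + int k * d)" by (intro x_image_mult) auto
  then show ?case by (simp add: algebra_simps)
qed (simp add: x_image_1)

lemma x_image_x: "x_C n \<in> x_image (2 ^ n)"
  unfolding x_image_def by (rule image_eqI[of _ _ "var n"]) (simp_all add: f2_poly_gr_def var_def)

text \<open>Recursively, \<open>y\<^sub>n\<^sub>+\<^sub>1 = x\<^sub>n\<^sub>+\<^sub>1 + y\<^sub>n\<^sup>2\<close>.\<close>

lemma x_image_y: "y_C n \<in> x_image (2 ^ n)"
proof (induction n)
  case 0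
  then show ?case using x_image_x[of 0] by simp
next
  case (Suc n)
  have "y_C n ^ 2 \<in> x_image (2 ^ Suc n)" using x_image_power[OF Suc, of 2] by simp
  then have "x_C (Suc n) + y_C n ^ 2 \<in> x_image (2 ^ Suc n)" by (intro x_image_add x_image_x)
  then show ?case by (simp add: add.assoc)
qed

lemma x_image_ym: "ym e \<in> x_image (int (monom_weight e))"
proof -
  have "ym (\<Sum>i\<in>F. delta i (k i)) \<in> x_image (\<Sum>i\<in>F. int (k i) * 2 ^ i)" if "finite F" for F k
    using that
    by (induction F) (simp_all add: x_image_1 ym_add ym_delta x_image_mult x_image_power x_image_y)
  from this[of "keys e" "lookup e"]
  have "ym (\<Sum>i\<in>keys e. delta i (lookup e i)) \<in> x_image (int (monom_weight e))"
    by (simp add: monom_weight_def)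
  moreover have "(\<Sum>i\<in>keys e. delta i (lookup e i)) = e"
    by (rule poly_mapping_eqI) (auto simp: lookup_sum lookup_single when_def in_keys_iff)
  ultimately show ?thesis by simp
qed

lemma C_gr_power: "u \<in> C_gr d \<Longrightarrow> u ^ k \<in> C_gr (int k * d)"
proof (induction k)
  case (Suc k)
  then have "u * u ^ k \<in> C_gr (d + int k * d)" by (intro C.gr_mult) auto
  then show ?case by (simp add: algebra_simps)
qed (simp add: C.gr_one)

lemma x_C_homogeneous: "x_C n \<in> C_gr (2 ^ n)"
proof -
  have y: "y_C n \<in> C_gr (2 ^ n)" for n
    using mspan_ym[of "delta n 1"] by (simp add: C_gr_eq_mspan ym_delta)
  show ?thesis
  proof (cases n)
    case (Suc k)
    have "y_C k ^ 2 \<in> C_gr (2 ^ Suc k)" using C_gr_power[OF y[of k], of 2] by simp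
    then show ?thesis using y[of "Suc k"] by (simp add: Suc C.gr_add)
  qed (use y[of 0] in simp)
qed

lemma x_image_eq: "x_image d = C_gr d"
proof (intro equalityI subsetI)
  fix u assume "u \<in> x_image d"
  then obtain p where p: "p \<in> f2_poly_gr d" "u = f2_eval x_C p" unfolding x_image_def by blast
  have "monomial_value x_C m \<in> C_gr (int (monom_weight m))" for m
  proof -
    have "(\<Prod>i\<in>F. x_C i ^ k i) \<in> C_gr (\<Sum>i\<in>F. int (k i) * 2 ^ i)" if "finite F" for F k
      using that
      by (induction F) (simp_all add: C.gr_one C.gr_mult C_gr_power x_C_homogeneous)
    from this[of "keys m" "lookup m"] show ?thesis
      by (simp add: monomial_value_def monom_weight_def)
  qed
  note monomial = this
  have "f2_eval x_C (\<Sum>m\<in>F. Poly_Mapping.single m 1) \<in> C_gr d"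
    if "finite F" "F \<subseteq> keys p" for F
    using that
  proof (induction F)
    case (insert m F)
    then have "int (monom_weight m) = d" using p(1) by (simp add: f2_poly_gr_def)
    then have "monomial_value x_C m \<in> C_gr d" using monomial[of m] by simp
    then show ?case using insert by (simp add: f2_eval_add[OF ringC_char2] C.gr_add)
  qed (simp add: C.gr_zero)
  from this[OF finite_keys subset_refl] show "u \<in> C_gr d"
    unfolding p(2) by (simp only: f2_poly_eq_sum_monomials[symmetric])
next
  fix u assume "u \<in> C_gr d"
  then show "u \<in> x_image d"
    unfolding C_gr_eq_mspan
  proof (induction rule: mspan.induct)
    case (mspan_plus e u)
    then show ?case using x_image_ym[of e] by (auto intro: x_image_add)
  qed (rule x_image_0)
qed

lemma x_red_image_gr: "f2_eval x_red ` f2_poly_gr d = redC_gr d"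
  unfolding redC_gr_def x_image_eq[symmetric] x_image_def image_image f2_eval_x_red ..

lemma surj_f2_eval_x_red: "surj (f2_eval x_red)"
proof -
  have "u \<in> range (f2_eval x_C)" for u
  proof (induction u rule: ringC_induct)
    case zero
    show ?case by (rule range_eqI[of _ _ 0]) simp
  next
    case (add e u)
    obtain p q where "u = f2_eval x_C p" "ym e = f2_eval x_C q"
      using add x_image_ym[of e] unfolding x_image_def by blast
    then have "ym e + u = f2_eval x_C (q + p)" by (simp add: f2_eval_add[OF ringC_char2])
    then show ?case by (rule range_eqI)
  qed
  then show ?thesis
    unfolding surj_def f2_eval_x_red using abs_redC_surj by (metis rangeE)
qed

subsection \<open>The direct sum decomposition\<close>

definition bit_poly_at :: "bit poly \<Rightarrow> 'a::comm_ring_1 \<Rightarrow> 'a" where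
  "bit_poly_at r x = poly (map_poly of_bit r) x"

lemma bit_poly_at_0 [simp]: "bit_poly_at 0 x = 0"
  by (simp add: bit_poly_at_def)

lemma bit_poly_at_pCons: "bit_poly_at (pCons a r) x = of_bit a + x * bit_poly_at r x"
  by (simp add: bit_poly_at_def map_poly_pCons)

lemma bit_poly_at_add:
  fixes x :: "'a::comm_ring_1"
  assumes "(1::'a) + 1 = 0"
  shows "bit_poly_at (r + r') x = bit_poly_at r x + bit_poly_at r' x"
proof -
  have coeff: "coeff (map_poly of_bit q) k = (of_bit (coeff q k) :: 'a)" for q k
    by (simp add: coeff_map_poly)
  have "map_poly of_bit (r + r') = map_poly of_bit r + (map_poly of_bit r' :: 'a poly)"
    by (rule poly_eqI) (simp only: coeff coeff_add of_bit_add[OF assms])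
  then show ?thesis by (simp only: bit_poly_at_def poly_add)
qed

lemma bit_poly_at_monom: "bit_poly_at (monom 1 l) x = x ^ l"
  by (simp add: bit_poly_at_def map_poly_monom poly_monom)

lemma bit_poly_at_variable: "bit_poly_at r (monom 1 1) = r"
proof (induction r)
  case (pCons a r)
  have "of_bit a = [:a:]" by (cases a) (simp_all add: one_pCons)
  then show ?case
    by (simp only: bit_poly_at_pCons pCons.IH) (simp add: monom_altdef)
qed simp

lemma red_sum_eq:
  "red_sum (c, q) = of_bit c +
    (\<Sum>n\<in>keys q. x_red n * bit_poly_at (lookup q n) (x_red n))"
  by (simp add: red_sum_def bit_poly_at_def)

lemma axis_red_bit_poly_at: "axis_red n (bit_poly_at r u) = bit_poly_at r (axis_red n u)"
proof (induction r)
  case (pCons a r)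
  have "axis_red n (of_bit a) = of_bit a" by (cases a) simp_all
  then show ?case using pCons by (simp only: bit_poly_at_pCons axis_red_add axis_red_mult)
qed simp

lemma axis_red_red_sum: "axis_red n (red_sum (c, q)) = pCons c (lookup q n)"
proof -
  let ?f = "\<lambda>j. axis_red n (x_red j) * axis_red n (bit_poly_at (lookup q j) (x_red j))"
  have "(\<Sum>j\<in>keys q. ?f j) = (\<Sum>j\<in>keys q. if j = n then monom 1 1 * lookup q n else 0)"
    by (rule sum.cong) (auto simp: axis_red_x axis_red_bit_poly_at bit_poly_at_variable simp del: One_nat_def)
  also have "\<dots> = monom 1 1 * lookup q n"
    by (auto simp: in_keys_iff)
  also have "\<dots> = pCons 0 (lookup q n)"
    by (simp add: monom_altdef)
  finally have "axis_red n (red_sum (c, q)) = axis_red n (of_bit c) + pCons 0 (lookup q n)"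
    by (simp only: red_sum_eq axis_red_add axis_red_sum axis_red_mult)
  moreover have "axis_red n (of_bit c) = [:c:]" by (cases c) (simp_all add: one_pCons)
  ultimately show ?thesis by simp
qed

lemma red_sum_superset:
  assumes "finite F" "keys q \<subseteq> F"
  shows "red_sum (c, q) = of_bit c +
    (\<Sum>n\<in>F. x_red n * bit_poly_at (lookup q n) (x_red n))"
proof -
  have "(\<Sum>n\<in>keys q. x_red n * bit_poly_at (lookup q n) (x_red n)) =
      (\<Sum>n\<in>F. x_red n * bit_poly_at (lookup q n) (x_red n))"
    by (rule sum.mono_neutral_left[OF assms]) (simp add: in_keys_iff)
  then show ?thesis by (simp add: red_sum_eq)
qed

lemma red_sum_add: "red_sum (c, q) + red_sum (c', q') = red_sum (c + c', q + q')"
proof -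
  let ?F = "keys q \<union> keys q'"
  have "red_sum (c + c', q + q') = of_bit (c + c') +
      (\<Sum>n\<in>?F. x_red n * bit_poly_at (lookup (q + q') n) (x_red n))"
    by (rule red_sum_superset) (simp_all add: keys_add)
  also have "\<dots> = red_sum (c, q) + red_sum (c', q')"
  proof -
    have q: "red_sum (c, q) = of_bit c +
        (\<Sum>n\<in>?F. x_red n * bit_poly_at (lookup q n) (x_red n))"
      by (rule red_sum_superset) simp_all
    have q': "red_sum (c', q') = of_bit c' +
        (\<Sum>n\<in>?F. x_red n * bit_poly_at (lookup q' n) (x_red n))"
      by (rule red_sum_superset) simp_all
    show ?thesis
      unfolding q q' lookup_add bit_poly_at_add[OF redC_char2] of_bit_add[OF redC_char2]
        distrib_left sum.distrib
      by (simp only: ac_simps)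
  qed
  finally show ?thesis by simp
qed

lemma monomial_in_range_red_sum: "monomial_value x_red m \<in> range red_sum"
proof (cases "\<exists>n k. m = delta n k")
  case True
  then obtain n k where m: "m = delta n k" by blast
  show ?thesis
  proof (cases k)
    case 0
    have "red_sum (1, 0) = 1" by (simp add: red_sum_eq)
    then show ?thesis using 0 m by (metis monomial_value_single power_0 rangeI)
  next
    case (Suc l)
    have "red_sum (0, Poly_Mapping.single n (monom 1 l)) = x_red n ^ k"
      by (simp add: red_sum_eq Suc bit_poly_at_monom)
    then show ?thesis using m by (metis monomial_value_single rangeI)
  qed
next
  case False
  then obtain i j m' where "i \<noteq> j" "m = m' + (delta i 1 + delta j 1)"
    using mixed_monomial[of m] by blast
  then have "monomial_value x_red m = 0"
    by (simp add: monomial_value_add x_red_mult)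
  moreover have "red_sum (0, 0) = 0" by (simp add: red_sum_eq)
  ultimately show ?thesis by (metis rangeI)
qed

text \<open>Restriction to the \<open>n\<close>-th axis recovers the constant and the \<open>n\<close>-th summand. The image is everything
  because mixed monomials vanish.\<close>

theorem bij_red_sum: "bij red_sum"
proof (rule bijI)
  show "inj red_sum"
  proof (rule injI, clarify)
    fix c c' :: bit and q q' assume eq: "red_sum (c, q) = red_sum (c', q')"
    have "pCons c (lookup q n) = pCons c' (lookup q' n)" for n
      unfolding axis_red_red_sum[symmetric] eq ..
    then show "c = c' \<and> q = q'" by (auto intro: poly_mapping_eqI)
  qed
  have "f2_eval x_red p \<in> range red_sum" for p
  proof (induction p rule: f2_poly_induct)
    case zero
    have "red_sum (0, 0) = 0" by (simp add: red_sum_eq)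
    then show ?case by (metis f2_eval_0 rangeI)
  next
    case (add m p)
    obtain c q c' q' where "monomial_value x_red m = red_sum (c, q)" "f2_eval x_red p = red_sum (c', q')"
      using monomial_in_range_red_sum[of m] add.IH by (metis rangeE surj_pair)
    then have "f2_eval x_red (Poly_Mapping.single m 1 + p) = red_sum (c + c', q + q')"
      by (simp only: f2_eval_add[OF redC_char2] f2_eval_monomial red_sum_add)
    then show ?case by (rule range_eqI)
  qed
  then show "surj red_sum"
    using surj_f2_eval_x_red by (metis surj_def rangeE)
qed

section \<open>Self-injectivity, coherence and reduced quotient\<close>

theorem theorem1p6:
  shows "graded_self_injective C_gr TYPE('m::ab_group_add) TYPE('n::ab_group_add)
    \<and> graded_coherent C_gr
    \<and> (\<forall>z :: nat \<Rightarrow> ringC. z = x_C \<longleftrightarrow> (\<forall>n. y_C n = (\<Sum>i=0..n. z (n - i) ^ (2 ^ i))))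
    \<and> (surj (f2_eval x_red)
        \<and> {p. f2_eval x_red p = 0} = ideal_gen {var i * var j | i j. i \<noteq> j}
        \<and> (\<forall>d. f2_eval x_red ` f2_poly_gr d = redC_gr d))
    \<and> bij red_sum"
  using C_self_injective C_coherent x_C_characterization surj_f2_eval_x_red kernel_x_red
    x_red_image_gr bij_red_sum
  by (intro conjI allI) blast+

end
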